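(* Let $\bar{\mathcal X}$ be a complete separable metric space, $\mathcal X\subseteq\bar{\mathcal X}$ a bounded measurable subset, $\Lambda$ a locally finite measure on $\bar{\mathcal X}$, and let $P^{cl}(\cdot\mid\cdot)$ be a time-shift equivariant and causal cluster kernel with locally finite first and second moment measures. Let $\Xi$ be the associated spatio-temporal Poisson cluster process observed on $\mathcal X$. Then $\Xi$ is well-defined, (strongly) time-stationary and $L^2$ if and only if, for every Borel $A\subseteq\mathcal X$, $$\int_{\bar{\mathcal X}}M_1^{cl}(A\times\mathbb R_+\mid(y,0))\,\Lambda(dy)<\infty,$$ $$\int_{\bar{\mathcal X}}M_{[2],A}^{cl}\big(\varphi^{-1}(\mathbb R_+\times[0,t])\,\big|\,(y,0)\big)\,\Lambda(dy)<\infty\quad\text{for every }t>0,$$ where $\varphi:\mathbb R^2\to\mathbb R^2$, $\varphi(r,s)=(r,s-r)$. Moreover, in this case, for every Borel $A\subseteq\mathcal X$ and $t>0$, $$M_1(A\times(0,t])=t\,\mu(A)=t\int_{\bar{\mathcal X}}M_1^{cl}(A\times\mathbb R_+\mid(y,0))\,\Lambda(dy),$$ $$\breve\gamma_{[2],A}([0,t])=\breve\gamma^+_{[2],A}([0,t])=\int_{\bar{\mathcal X}}M_{[2],A}^{cl}\big(\varphi^{-1}(\mathbb R_+\times[0,t])\,\big|\,(y,0)\big)\,\Lambda(dy).$$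
   Context: $\mathbb R_+=[0,\infty)$. $\mathfrak N(\bar{\mathcal X}\times\mathbb R)$ is the space of locally finite counting measures on $\bar{\mathcal X}\times\mathbb R$. A locally finite measure is finite on bounded sets. Cluster kernel: $P^{cl}(\cdot\mid(y,s))$ is a probability kernel from $\bar{\mathcal X}\times\mathbb R$ to $\mathfrak N(\bar{\mathcal X}\times\mathbb R)$. Time-shift equivariant: $P^{cl}(D\mid(y,s))=P^{cl}(T_s^{-1}(D)\mid(y,0))$ where $T_s(\xi)=\xi(\cdot-(0,s))$, the shift of $\xi$ by $s$ in time. Causal: $P^{cl}(\{\xi:\xi(\bar{\mathcal X}\times(-\infty,0))\ge1\}\mid(y,0))=0$. For a point process $\xi=\sum_i\delta_{(x_i,t_i)}$ with law $P^{cl}(\cdot\mid(y,s))$, $M_1^{cl}(\cdot\mid(y,s))$ is its expectation measure and, for Borel $A$, $M_{[2],A}^{cl}(I\times J\mid(y,s))=\mathbb E\sum_{i\ne j}1\{x_i\in A,t_i\in I,x_j\in A,t_j\in J\}$ (a measure on $\mathbb R^2$). Poisson cluster process: let $\mathrm H=\sum_i\delta_{(Y_i,S_i)}$ be a Poisson process on $\bar{\mathcal X}\times\mathbb R$ with intensity measure $\Lambda\otimes\mathrm{Leb}$ and, given $\mathrm H$, let $\bar\Xi_i\sim P^{cl}(\cdot\mid(Y_i,S_i))$ be independent. Set $\bar\Xi=\sum_i\bar\Xi_i$ and let $\Xi$ be the restriction of $\bar\Xi$ to points with spatial location in $\mathcal X$ (observed on $\mathcal X\times(0,\infty)$; stationarity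 refers to the process on $\mathcal X\times\mathbb R$). "Well-defined" means that $\Xi$ is almost surely finite on $\mathcal X\times I$ for bounded intervals $I$. "(Strongly) time-stationary" means its law is invariant under time shifts, and "$L^2$" that its first two moment measures are finite on bounded sets. For such $\Xi=\sum_i\delta_{(X_i,T_i)}$: $M_1(B)=\mathbb E[\Xi(B)]$, $M_1=\mu\otimes\mathrm{Leb}$ for a finite measure $\mu$ on $\mathcal X$; $M_{[2],A}(I\times J)=\mathbb E\sum_{i\ne j}1\{X_i,X_j\in A,T_i\in I,T_j\in J\}$; there is a locally finite measure $\breve M_{[2],A}$ on $\mathbb R$ with $M_{[2],A}\varphi^{-1}=\mathrm{Leb}\otimes\breve M_{[2],A}$; and the time-reduced factorial covariance measure is $\breve\gamma_{[2],A}(S)=\breve M_{[2],A}(S)-\mu(A)^2\,\mathrm{Leb}(S)$ for bounded Borel $S$, with $\breve\gamma_{[2],A}^+$ the positive part of its Jordan decomposition. *)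

theory Defs
  imports "HOL-Probability.Probability"
begin

section \<open>Counting measures\<close>

definition locally_finite :: "'b::metric_space measure \<Rightarrow> bool" where
  "locally_finite \<nu> \<longleftrightarrow>
     sets \<nu> = sets borel \<and> (\<forall>B\<in>sets borel. bounded B \<longrightarrow> emeasure \<nu> B < \<infinity>)"

text \<open>\<open>enumerates I p \<xi>\<close> says that \<open>\<xi>\<close> is the sum of the Dirac measures at \<open>p i\<close> for \<open>i \<in> I\<close>;
  points may repeat, and \<open>\<xi>\<close> need not be locally finite.\<close>

definition enumerates :: "nat set \<Rightarrow> (nat \<Rightarrow> 'b) \<Rightarrow> 'b::topological_space measure \<Rightarrow> bool" where
  "enumerates I p \<xi> \<longleftrightarrow> \<xi> = distr (count_space I) borel p"

definition point_measures :: "'b::topological_space measure set" where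
  "point_measures = {\<xi>. \<exists>I p. enumerates I p \<xi>}"

text \<open>The sigma-algebra on a set \<open>S\<close> of Borel measures generated by the maps \<open>\<xi> \<mapsto> \<xi>(B)\<close>.\<close>

definition eval_algebra :: "'b::topological_space measure set \<Rightarrow> 'b measure measure" where
  "eval_algebra S = (SUP B\<in>sets borel. vimage_algebra S (\<lambda>\<xi>. emeasure \<xi> B) borel)"

definition counting_algebra :: "'b::metric_space measure measure" where
  "counting_algebra = eval_algebra {\<xi> \<in> point_measures. locally_finite \<xi>}"

text \<open>The sum over \<open>i \<noteq> j\<close> of the indicator of \<open>(p i, p j) \<in> D\<close>, where \<open>\<xi>\<close> is the sum of the
  Dirac measures at the \<open>p i\<close>.  When singletons are Borel, every enumeration gives the same value.\<close>

definition distinct_pairs :: "'b::topological_space measure \<Rightarrow> ('b \<times> 'b) set \<Rightarrow> ennreal" where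
  "distinct_pairs \<xi> D =
     (let (I, p) = (SOME (I, p). enumerates I p \<xi>)
      in emeasure (count_space UNIV) {(i, j). i \<in> I \<and> j \<in> I \<and> i \<noteq> j \<and> (p i, p j) \<in> D})"

definition time_shift :: "real \<Rightarrow> ('a::metric_space \<times> real) measure \<Rightarrow> ('a \<times> real) measure" where
  "time_shift s \<xi> = distr \<xi> borel (\<lambda>(x, t). (x, t + s))"

definition phi :: "real \<times> real \<Rightarrow> real \<times> real" where
  "phi = (\<lambda>(r, s). (r, s - r))"


section \<open>Moments of a random measure \<open>X\<close> on a probability space \<open>M\<close>\<close>

text \<open>For a law \<open>P\<close> on a space of measures, take \<open>M = P\<close> and \<open>X\<close> the identity.\<close>

definition moment1 :: "'w measure \<Rightarrow> ('w \<Rightarrow> 'b measure) \<Rightarrow> 'b set \<Rightarrow> ennreal" where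
  "moment1 M X B = (\<integral>\<^sup>+\<omega>. emeasure (X \<omega>) B \<partial>M)"

text \<open>The expectation of \<open>(X \<otimes> X)(D)\<close>, the product being written as an iterated integral so that
  it has its usual meaning also for realizations which are not sigma-finite.\<close>

definition moment2 :: "'w measure \<Rightarrow> ('w \<Rightarrow> 'b measure) \<Rightarrow> ('b \<times> 'b) set \<Rightarrow> ennreal" where
  "moment2 M X D = (\<integral>\<^sup>+\<omega>. (\<integral>\<^sup>+p. emeasure (X \<omega>) (Pair p -` D) \<partial>X \<omega>) \<partial>M)"

definition L2_process :: "'w measure \<Rightarrow> ('w \<Rightarrow> 'b::metric_space measure) \<Rightarrow> bool" where
  "L2_process M X \<longleftrightarrow>
     (\<forall>B\<in>sets borel. bounded B \<longrightarrow> moment1 M X B < \<infinity>) \<and>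
     (\<forall>D\<in>sets borel. bounded D \<longrightarrow> moment2 M X D < \<infinity>)"

text \<open>\<open>M\<^bsub>[2],A\<^esub>(S)\<close> for Borel sets \<open>S\<close> of the plane.\<close>

definition factorial_moment2 ::
    "'w measure \<Rightarrow> ('w \<Rightarrow> ('a::metric_space \<times> real) measure) \<Rightarrow> 'a set \<Rightarrow> (real \<times> real) set \<Rightarrow> ennreal" where
  "factorial_moment2 M X A S =
     (\<integral>\<^sup>+\<omega>. distinct_pairs (X \<omega>) {((x, t), (x', t')). x \<in> A \<and> x' \<in> A \<and> (t, t') \<in> S} \<partial>M)"

definition time_stationary :: "'w measure \<Rightarrow> ('w \<Rightarrow> ('a::metric_space \<times> real) measure) \<Rightarrow> bool" where
  "time_stationary M X \<longleftrightarrow>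
     (\<forall>s. distr M (eval_algebra point_measures) (\<lambda>\<omega>. time_shift s (X \<omega>)) =
          distr M (eval_algebra point_measures) X)"

definition well_defined_on ::
    "'a set \<Rightarrow> 'w measure \<Rightarrow> ('w \<Rightarrow> ('a::metric_space \<times> real) measure) \<Rightarrow> bool" where
  "well_defined_on XX M X \<longleftrightarrow>
     (AE \<omega> in M. \<forall>I. is_interval I \<and> bounded I \<longrightarrow> emeasure (X \<omega>) (XX \<times> I) < \<infinity>)"

definition spatial_intensity ::
    "'w measure \<Rightarrow> ('w \<Rightarrow> ('a::metric_space \<times> real) measure) \<Rightarrow> 'a measure" where
  "spatial_intensity M X =
     (THE \<mu>. sets \<mu> = sets borel \<and> finite_measure \<mu> \<and>
        (\<forall>B\<in>sets borel. moment1 M X B = emeasure (\<mu> \<Otimes>\<^sub>M lborel) B))"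

definition reduced_moment2 ::
    "'w measure \<Rightarrow> ('w \<Rightarrow> ('a::metric_space \<times> real) measure) \<Rightarrow> 'a set \<Rightarrow> real measure" where
  "reduced_moment2 M X A =
     (THE \<nu>. locally_finite \<nu> \<and>
        (\<forall>S\<in>sets borel. factorial_moment2 M X A (phi -` S) = emeasure (lborel \<Otimes>\<^sub>M \<nu>) S))"

text \<open>Meant for bounded Borel \<open>S\<close>, where all three measures are finite.\<close>

definition reduced_cov ::
    "'w measure \<Rightarrow> ('w \<Rightarrow> ('a::metric_space \<times> real) measure) \<Rightarrow> 'a set \<Rightarrow> real set \<Rightarrow> real" where
  "reduced_cov M X A S =
     measure (reduced_moment2 M X A) S - (measure (spatial_intensity M X) A)\<^sup>2 * measure lborel S"

text \<open>Jordan decomposition of a locally finite signed measure \<open>g\<close>, which is a set function on the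
  bounded Borel sets only: \<open>g = p - n\<close> with \<open>p\<close> and \<open>n\<close> locally finite and mutually singular.\<close>

definition jordan_decomposition ::
    "('b::metric_space set \<Rightarrow> real) \<Rightarrow> 'b measure \<Rightarrow> 'b measure \<Rightarrow> bool" where
  "jordan_decomposition g p n \<longleftrightarrow>
     locally_finite p \<and> locally_finite n \<and>
     (\<exists>H\<in>sets borel. emeasure p (- H) = 0 \<and> emeasure n H = 0) \<and>
     (\<forall>S\<in>sets borel. bounded S \<longrightarrow> g S = measure p S - measure n S)"

definition jordan_pos :: "('b::metric_space set \<Rightarrow> real) \<Rightarrow> 'b measure" where
  "jordan_pos g = (THE p. \<exists>n. jordan_decomposition g p n)"


section \<open>Poisson cluster processes\<close>

definition poisson_process ::
    "'w measure \<Rightarrow> ('w \<Rightarrow> 'b::topological_space measure) \<Rightarrow> 'b measure \<Rightarrow> bool" where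
  "poisson_process M H \<nu> \<longleftrightarrow>
     H \<in> M \<rightarrow>\<^sub>M eval_algebra point_measures \<and>
     (\<forall>B\<in>sets borel. emeasure \<nu> B < \<infinity> \<longrightarrow>
        (\<forall>k. measure M {\<omega> \<in> space M. emeasure (H \<omega>) B = of_nat k} =
             measure \<nu> B ^ k / fact k * exp (- measure \<nu> B))) \<and>
     (\<forall>B\<in>sets borel. emeasure \<nu> B = \<infinity> \<longrightarrow> (AE \<omega> in M. emeasure (H \<omega>) B = \<infinity>)) \<and>
     (\<forall>n B. (\<forall>k<n. B k \<in> sets borel) \<and> disjoint_family_on B {..<n::nat} \<longrightarrow>
        prob_space.indep_vars M (\<lambda>_. borel) (\<lambda>k \<omega>. emeasure (H \<omega>) (B k)) {..<n})"

definition cluster_kernel ::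
    "('a::polish_space \<times> real \<Rightarrow> ('a \<times> real) measure measure) \<Rightarrow> bool" where
  "cluster_kernel P \<longleftrightarrow> P \<in> borel \<rightarrow>\<^sub>M prob_algebra counting_algebra"

definition shift_equivariant ::
    "('a::polish_space \<times> real \<Rightarrow> ('a \<times> real) measure measure) \<Rightarrow> bool" where
  "shift_equivariant P \<longleftrightarrow>
     (\<forall>y s. \<forall>D\<in>sets counting_algebra.
        emeasure (P (y, s)) D =
        emeasure (P (y, 0)) (time_shift s -` D \<inter> space counting_algebra))"

definition causal ::
    "('a::polish_space \<times> real \<Rightarrow> ('a \<times> real) measure measure) \<Rightarrow> bool" where
  "causal P \<longleftrightarrow>
     (\<forall>y. emeasure (P (y, 0))
            {\<xi> \<in> space counting_algebra. emeasure \<xi> (UNIV \<times> {..<0}) \<ge> 1} = 0)"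

text \<open>The centres are \<open>Z i = (Y\<^sub>i, S\<^sub>i)\<close> for \<open>i < N\<close> and the cluster of \<open>Z i\<close> is \<open>C i\<close>; for
  \<open>i \<ge> N\<close> the values of \<open>Z i\<close> and \<open>C i\<close> are irrelevant.\<close>

definition ground_process ::
    "('w \<Rightarrow> enat) \<Rightarrow> (nat \<Rightarrow> 'w \<Rightarrow> 'b::topological_space) \<Rightarrow> 'w \<Rightarrow> 'b measure" where
  "ground_process N Z \<omega> = distr (count_space {i. enat i < N \<omega>}) borel (\<lambda>i. Z i \<omega>)"

text \<open>The events determined by the (enumerated) centres.\<close>

definition ground_events ::
    "'w measure \<Rightarrow> ('w \<Rightarrow> enat) \<Rightarrow> (nat \<Rightarrow> 'w \<Rightarrow> 'b::topological_space) \<Rightarrow> 'w set set" where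
  "ground_events M N Z =
     sigma_sets (space M) {{\<omega> \<in> space M. enat i < N \<omega> \<and> Z i \<omega> \<in> B} | i B. B \<in> sets borel}"

text \<open>The assumption \<open>clusters\<close> says that, conditionally on the centres, the clusters \<open>C i\<close> with
  \<open>i < N\<close> are independent with respective laws \<open>P (Z i)\<close>: it is the defining integral identity of
  the conditional probability that \<open>C i \<in> D i\<close> for all existing clusters \<open>i < n\<close>.\<close>

locale poisson_cluster_process = prob_space M
  for M :: "'w measure" +
  fixes \<Lambda> :: "'a::polish_space measure"
    and P :: "'a \<times> real \<Rightarrow> ('a \<times> real) measure measure"
    and N :: "'w \<Rightarrow> enat"
    and Z :: "nat \<Rightarrow> 'w \<Rightarrow> 'a \<times> real"
    and C :: "nat \<Rightarrow> 'w \<Rightarrow> ('a \<times> real) measure"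
  assumes N_measurable: "N \<in> M \<rightarrow>\<^sub>M count_space UNIV"
    and Z_measurable: "\<And>i. Z i \<in> M \<rightarrow>\<^sub>M borel"
    and C_measurable: "\<And>i. C i \<in> M \<rightarrow>\<^sub>M counting_algebra"
    and ground: "poisson_process M (ground_process N Z) (\<Lambda> \<Otimes>\<^sub>M lborel)"
    and clusters: "\<And>n D E. E \<in> ground_events M N Z \<Longrightarrow> (\<And>i. i < n \<Longrightarrow> D i \<in> sets counting_algebra) \<Longrightarrow>
        emeasure M {\<omega> \<in> E. \<forall>i<n. enat i < N \<omega> \<longrightarrow> C i \<omega> \<in> D i} =
        (\<integral>\<^sup>+\<omega>\<in>E. (\<Prod>i | i < n \<and> enat i < N \<omega>. emeasure (P (Z i \<omega>)) (D i)) \<partial>M)"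

definition superposition ::
    "('w \<Rightarrow> enat) \<Rightarrow> (nat \<Rightarrow> 'w \<Rightarrow> 'b::topological_space measure) \<Rightarrow> 'w \<Rightarrow> 'b measure" where
  "superposition N C \<omega> =
     measure_of UNIV (sets borel) (\<lambda>B. \<Sum>i. if enat i < N \<omega> then emeasure (C i \<omega>) B else 0)"

text \<open>The restriction to points located in \<open>XX\<close>, regarded as a measure on the whole space that
  does not charge the complement of \<open>XX \<times> \<real>\<close>.\<close>

definition observed_process ::
    "'a set \<Rightarrow> ('w \<Rightarrow> enat) \<Rightarrow> (nat \<Rightarrow> 'w \<Rightarrow> ('a::metric_space \<times> real) measure) \<Rightarrow>
     'w \<Rightarrow> ('a \<times> real) measure" where
  "observed_process XX N C \<omega> = density (superposition N C \<omega>) (indicator (XX \<times> UNIV))"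

end

theory Submission
  imports Defs
begin

text \<open>
  Conditionally on the centres the clusters are independent, so moments of the superposition
  reduce to moments of the Poisson process of centres: by Campbell's formula the intensity of the
  observed process is the integral of the cluster intensity, and a pair of distinct points lies
  either in two different clusters, which contributes the product of the intensities, or in one
  cluster, which contributes the integral of the cluster's factorial moment measure over all
  centres.  Equivariance turns the integral over the time of the centre into a translation
  average, and Tonelli's theorem shows that the second contribution is Lebesgue measure times a
  measure in the time lag.  Hence that measure is the reduced covariance; being nonnegative,
  it is its own Jordan positive part.

  Stationarity holds without any moment condition: the Laplace functional of the superposition is
  the Laplace functional of the centres evaluated at minus the logarithm of the Laplace transform
  of a cluster, which is invariant because the law of the counts of a Poisson process depends only
  on the intensity measure.  Laplace functionals determine the law through the power series
  obtained by varying one coefficient at a time.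
\<close>

section \<open>Enumerations of point measures\<close>

text \<open>The obstacle is that realizations of the superposition may have infinite counts on
  bounded sets until a moment condition is known. Its moment identities are therefore stated in
  \<open>ennreal\<close>, and second moments are first computed on rectangles, where the
  decomposition into clusters supplies measurability. Pair counts on general sets are shown
  measurable over locally finite realizations, because the argument subtracts; once
  \<open>L2_process\<close> is known, the process is replaced by an almost surely equal locally
  finite version.

  The Poisson hypothesis speaks only of counts of sets, and the cluster hypothesis only of events
  \<open>C i \<in> D i\<close>. Each is carried to functions by recognising both sides as integrals
  against two measures and comparing these on sets. The moment hypothesis on the kernel gives the
  sigma-finiteness that Tonelli needs when the time of the centre is integrated out.

  The condition of the theorem controls only lags in [0,t]; swapping the two points of a pair
  reflects lags, so that symmetric intervals are controlled too, as square integrability on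
  two-sided time windows requires.\<close>

lemma emeasure_count_space_UNIV: "emeasure (count_space UNIV) A = (if finite A then of_nat (card A) else \<infinity>)"
  by (simp add: emeasure_count_space)

lemma emeasure_count_space_bij_betw:
  assumes "bij_betw f A B"
  shows "emeasure (count_space UNIV) A = emeasure (count_space UNIV) B"
  using bij_betw_finite[OF assms] bij_betw_same_card[OF assms]
  by (simp add: emeasure_count_space_UNIV)

text \<open>The counting measure reports only whether a set is infinite, so countability is what
  makes two infinite sets equipotent.\<close>

lemma ex_bij_betw_same_count:
  assumes "countable A" "countable B"
    and eq: "emeasure (count_space UNIV) A = emeasure (count_space UNIV) B"
  shows "\<exists>f. bij_betw f A B"
proof (cases "finite A")
  case True
  then have "finite B" "card A = card B"
    using eq by (auto simp: emeasure_count_space_UNIV split: if_splits)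
  then show ?thesis using True by (intro finite_same_card_bij)
next
  case False
  then have "infinite B"
    using eq by (auto simp: emeasure_count_space_UNIV split: if_splits)
  then show ?thesis
    using False assms(1,2) by (meson bij_betw_inv bij_betw_trans to_nat_on_infinite)
qed

text \<open>A matching that respects the values is glued from bijections between the fibres over
  each value. It serves to compare two enumerations of one point measure.\<close>

lemma ex_bij_betw_same_fibres:
  assumes "countable I" "countable J"
    and eq: "\<And>x. emeasure (count_space UNIV) {i\<in>I. p i = x} = emeasure (count_space UNIV) {j\<in>J. q j = x}"
  obtains \<sigma> where "bij_betw \<sigma> I J" "\<And>i. i \<in> I \<Longrightarrow> q (\<sigma> i) = p i"
proof -
  have "\<exists>f. bij_betw f {i\<in>I. p i = x} {j\<in>J. q j = x}" for x
    by (intro ex_bij_betw_same_count eq) (use assms in auto)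
  then obtain F where F: "\<And>x. bij_betw (F x) {i\<in>I. p i = x} {j\<in>J. q j = x}"
    by metis
  define \<sigma> where "\<sigma> i = F (p i) i" for i
  have 1: "\<sigma> i \<in> J \<and> q (\<sigma> i) = p i" if "i \<in> I" for i
    using bij_betw_apply[OF F[of "p i"], of i] that by (auto simp: \<sigma>_def)
  have "inj_on \<sigma> I"
  proof (rule inj_onI)
    fix i j assume ij: "i \<in> I" "j \<in> I" "\<sigma> i = \<sigma> j"
    then have "p i = p j" using 1 by metis
    then show "i = j"
      using bij_betw_imp_inj_on[OF F[of "p i"]] ij by (auto simp: \<sigma>_def inj_on_def)
  qed
  moreover have "J \<subseteq> \<sigma> ` I"
  proof
    fix j assume "j \<in> J"
    then have "j \<in> F (q j) ` {i\<in>I. p i = q j}"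
      using bij_betw_imp_surj_on[OF F[of "q j"]] by simp
    then obtain i where "i \<in> I" "p i = q j" "F (q j) i = j" by auto
    then show "j \<in> \<sigma> ` I" by (auto simp: \<sigma>_def image_iff intro!: bexI[of _ i])
  qed
  ultimately have "bij_betw \<sigma> I J" using 1 by (auto simp: bij_betw_def)
  then show ?thesis using 1 that by blast
qed

lemma emeasure_distr_count_space:
  "B \<in> sets borel \<Longrightarrow>
    emeasure (distr (count_space I) borel p) B = emeasure (count_space UNIV) {i\<in>I. p i \<in> B}"
  by (subst emeasure_distr)
    (simp_all add: emeasure_count_space vimage_def Int_def conj_commute)

text \<open>\<open>enumerates\<close> admits only natural indices; transporting the index set along
  \<open>to_nat_on\<close> lets families indexed by pairs (cluster, point) be recognised as point
  measures.\<close>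

lemma distr_count_space_in_point_measures:
  assumes "countable I"
  shows "distr (count_space I) borel p \<in> point_measures"
proof -
  have "distr (count_space I) borel p
      = distr (count_space (to_nat_on I ` I)) borel (p \<circ> from_nat_into I)"
  proof (rule measure_eqI)
    fix B assume "B \<in> sets (distr (count_space I) borel p)"
    then have B: "B \<in> sets borel" by simp
    have "bij_betw (to_nat_on I) {i\<in>I. p i \<in> B}
       {j \<in> to_nat_on I ` I. (p \<circ> from_nat_into I) j \<in> B}"
      using assms inj_on_to_nat_on[OF assms]
      by (auto simp: bij_betw_def inj_on_def image_iff)
    from emeasure_count_space_bij_betw[OF this]
    show "emeasure (distr (count_space I) borel p) B =
        emeasure (distr (count_space (to_nat_on I ` I)) borel (p \<circ> from_nat_into I)) B"
      by (simp only: emeasure_distr_count_space[OF B])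
  qed simp
  then show ?thesis by (auto simp: point_measures_def enumerates_def)
qed

lemma point_measuresE:
  assumes "\<xi> \<in> point_measures"
  obtains I :: "nat set" and p where "\<xi> = distr (count_space I) borel p"
  using assms by (auto simp: point_measures_def enumerates_def)

lemma sets_point_measures [simp]: "\<xi> \<in> point_measures \<Longrightarrow> sets \<xi> = sets borel"
  by (auto simp: point_measures_def enumerates_def)

lemma space_point_measures [simp]: "\<xi> \<in> point_measures \<Longrightarrow> space \<xi> = UNIV"
  by (auto simp: point_measures_def enumerates_def)

lemma point_measure_values:
  assumes "\<xi> \<in> point_measures"
  shows "emeasure \<xi> B = \<infinity> \<or> (\<exists>n::nat. emeasure \<xi> B = of_nat n)"
proof (cases "B \<in> sets borel")
  case True
  with assms show ?thesis
    by (auto elim!: point_measuresE simp: emeasure_distr_count_space emeasure_count_space_UNIV)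
next
  case False
  then have "emeasure \<xi> B = 0" using assms by (simp add: emeasure_notin_sets)
  then show ?thesis by (metis of_nat_0)
qed

text \<open>The definition picks some enumeration. In a T1 space singletons are Borel, so any two
  enumerations have equally large fibres and differ by a relabelling of the indices, which acts on
  pairs coordinatewise and preserves distinctness.\<close>

lemma distinct_pairs_distr_count_space:
  fixes p :: "'i \<Rightarrow> 'b::t1_space"
  assumes I: "countable I"
  shows "distinct_pairs (distr (count_space I) borel p) D =
    emeasure (count_space UNIV) {(i, j). i \<in> I \<and> j \<in> I \<and> i \<noteq> j \<and> (p i, p j) \<in> D}"
proof -
  let ?\<xi> = "distr (count_space I) borel p"
  obtain J q where Jq: "(SOME (J, q). enumerates J q ?\<xi>) = (J, q)" by fastforce
  have "\<exists>Jq. case Jq of (J, q) \<Rightarrow> enumerates J q ?\<xi>"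
    using distr_count_space_in_point_measures[OF I, of p] by (auto simp: point_measures_def)
  from someI_ex[OF this] have "enumerates J q ?\<xi>"
    by (simp add: Jq)
  then have eq: "?\<xi> = distr (count_space J) borel q" by (simp add: enumerates_def)
  have "emeasure (count_space UNIV) {i\<in>I. p i = x} = emeasure (count_space UNIV) {j\<in>J. q j = x}" for x
    using emeasure_distr_count_space[of "{x}" I p] emeasure_distr_count_space[of "{x}" J q]
    by (simp add: eq)
  then obtain \<sigma> where \<sigma>: "bij_betw \<sigma> I J" "\<And>i. i \<in> I \<Longrightarrow> q (\<sigma> i) = p i"
    using ex_bij_betw_same_fibres[OF I, of J p q] by auto
  let ?S = "\<lambda>I p. {(i, j). i \<in> I \<and> j \<in> I \<and> i \<noteq> j \<and> (p i, p j) \<in> D}"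
  have "bij_betw (map_prod \<sigma> \<sigma>) (?S I p) (?S J q)"
    unfolding bij_betw_def
  proof
    show "inj_on (map_prod \<sigma> \<sigma>) (?S I p)"
      using bij_betw_imp_inj_on[OF \<sigma>(1)] by (auto simp: inj_on_def)
    show "map_prod \<sigma> \<sigma> ` ?S I p = ?S J q"
    proof
      show "map_prod \<sigma> \<sigma> ` ?S I p \<subseteq> ?S J q"
        using bij_betw_apply[OF \<sigma>(1)] bij_betw_imp_inj_on[OF \<sigma>(1)] \<sigma>(2) by (auto simp: inj_on_def)
      show "?S J q \<subseteq> map_prod \<sigma> \<sigma> ` ?S I p"
      proof (clarify)
        fix k l assume *: "k \<in> J" "l \<in> J" "k \<noteq> l" "(q k, q l) \<in> D"
        then obtain i j where "i \<in> I" "j \<in> I" "k = \<sigma> i" "l = \<sigma> j"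
          using bij_betw_imp_surj_on[OF \<sigma>(1)] by (metis imageE)
        with * \<sigma>(2) show "(k, l) \<in> map_prod \<sigma> \<sigma> ` ?S I p"
          by (intro image_eqI[of _ _ "(i, j)"]) auto
      qed
    qed
  qed
  from emeasure_count_space_bij_betw[OF this] show ?thesis
    by (simp add: distinct_pairs_def Jq)
qed

lemma distinct_pairs_nn_integral:
  fixes p :: "'i \<Rightarrow> 'b::t1_space"
  assumes I: "countable I"
  shows "distinct_pairs (distr (count_space I) borel p) D =
    (\<integral>\<^sup>+i. (\<integral>\<^sup>+j. of_bool (i \<noteq> j) * indicator D (p i, p j) \<partial>count_space I) \<partial>count_space I)"
proof -
  have "(\<integral>\<^sup>+i. (\<integral>\<^sup>+j. of_bool (i \<noteq> j) * indicator D (p i, p j) \<partial>count_space I) \<partial>count_space I)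
    = (\<integral>\<^sup>+i. (\<integral>\<^sup>+j. of_bool (i \<noteq> j) * indicator D (p i, p j) * indicator I j * indicator I i
        \<partial>count_space UNIV) \<partial>count_space UNIV)"
    by (simp add: nn_integral_count_space_indicator nn_integral_multc)
  also have "\<dots> = (\<integral>\<^sup>+ z. indicator {(i, j). i \<in> I \<and> j \<in> I \<and> i \<noteq> j \<and> (p i, p j) \<in> D} z \<partial>count_space UNIV)"
    by (subst nn_integral_fst_count_space[symmetric])
      (auto intro!: nn_integral_cong simp: indicator_def)
  finally show ?thesis
    by (simp add: distinct_pairs_distr_count_space[OF I])
qed

lemma nn_integral_count_space_Sigma:
  "(\<integral>\<^sup>+z. f z \<partial>count_space (Sigma K I)) =
   (\<integral>\<^sup>+k. (\<integral>\<^sup>+i. f (k, i) \<partial>count_space (I k)) \<partial>count_space K)"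
proof -
  have "(\<integral>\<^sup>+z. f z \<partial>count_space (Sigma K I)) = (\<integral>\<^sup>+z. f z * indicator (Sigma K I) z \<partial>count_space UNIV)"
    by (simp add: nn_integral_count_space_indicator)
  also have "\<dots> = (\<integral>\<^sup>+k. (\<integral>\<^sup>+i. f (k, i) * indicator (Sigma K I) (k, i) \<partial>count_space UNIV) \<partial>count_space UNIV)"
    by (rule nn_integral_fst_count_space[symmetric])
  also have "\<dots> = (\<integral>\<^sup>+k. (\<integral>\<^sup>+i. f (k, i) * indicator (I k) i \<partial>count_space UNIV) * indicator K k \<partial>count_space UNIV)"
    by (auto intro!: nn_integral_cong simp: nn_integral_multc[symmetric] indicator_def)
  finally show ?thesis by (simp add: nn_integral_count_space_indicator)
qed

lemma emeasure_count_space_nn_integral: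
  "emeasure (count_space UNIV) {i\<in>I. Q i} = (\<integral>\<^sup>+i. of_bool (Q i) \<partial>count_space I)"
proof -
  have "emeasure (count_space UNIV) {i\<in>I. Q i} = (\<integral>\<^sup>+i. indicator {i\<in>I. Q i} i \<partial>count_space UNIV)"
    by simp
  also have "\<dots> = (\<integral>\<^sup>+i. of_bool (Q i) * indicator I i \<partial>count_space UNIV)"
    by (intro nn_integral_cong) (auto simp: indicator_def)
  finally show ?thesis by (simp add: nn_integral_count_space_indicator)
qed

lemma emeasure_distr_count_space_nn_integral:
  "B \<in> sets borel \<Longrightarrow>
    emeasure (distr (count_space I) borel p) B = (\<integral>\<^sup>+i. indicator B (p i) \<partial>count_space I)"
  by (simp add: emeasure_distr_count_space emeasure_count_space_nn_integral indicator_def of_bool_def)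

text \<open>All index pairs are sorted by whether the indices agree; those with equal indices count
  the points lying in both sets. The additive form stays valid when counts are infinite.\<close>

lemma distinct_pairs_plus_diagonal:
  fixes \<xi> :: "'b::t1_space measure"
  assumes "\<xi> \<in> point_measures" "B1 \<in> sets borel" "B2 \<in> sets borel"
  shows "distinct_pairs \<xi> (B1 \<times> B2) + emeasure \<xi> (B1 \<inter> B2) = emeasure \<xi> B1 * emeasure \<xi> B2"
proof -
  obtain I p where \<xi>: "\<xi> = distr (count_space I) borel (p :: nat \<Rightarrow> _)"
    using assms(1) by (rule point_measuresE)
  have "distinct_pairs \<xi> (B1 \<times> B2) + emeasure \<xi> (B1 \<inter> B2) =
    (\<integral>\<^sup>+i. (\<integral>\<^sup>+j. of_bool (i \<noteq> j) * indicator (B1 \<times> B2) (p i, p j) \<partial>count_space I)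
       + indicator (B1 \<inter> B2) (p i) \<partial>count_space I)"
    using assms unfolding \<xi>
    by (subst distinct_pairs_nn_integral, simp, subst emeasure_distr_count_space_nn_integral, simp)
      (simp add: nn_integral_add)
  also have "\<dots> = (\<integral>\<^sup>+i. (\<integral>\<^sup>+j. indicator B1 (p i) * indicator B2 (p j) \<partial>count_space I) \<partial>count_space I)"
  proof (intro nn_integral_cong)
    fix i assume i: "i \<in> space (count_space I)"
    \<comment> \<open>The diagonal contribution is spread over j as a point mass at i, so that it
      merges termwise with the off-diagonal sum.\<close>
    have "indicator (B1 \<inter> B2) (p i) =
        (\<integral>\<^sup>+j. indicator (B1 \<inter> B2) (p i) * indicator {i} j \<partial>count_space I)"
      using i by (simp add: nn_integral_cmult one_ennreal_def[symmetric])
    then have "(\<integral>\<^sup>+j. of_bool (i \<noteq> j) * indicator (B1 \<times> B2) (p i, p j) \<partial>count_space I)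
       + indicator (B1 \<inter> B2) (p i)
     = (\<integral>\<^sup>+j. of_bool (i \<noteq> j) * indicator (B1 \<times> B2) (p i, p j) + indicator (B1 \<inter> B2) (p i) * indicator {i} j \<partial>count_space I)"
      by (simp add: nn_integral_add)
    also have "\<dots> = (\<integral>\<^sup>+j. indicator B1 (p i) * indicator B2 (p j) \<partial>count_space I)"
      by (intro nn_integral_cong) (auto simp: indicator_def)
    finally show "(\<integral>\<^sup>+j. of_bool (i \<noteq> j) * indicator (B1 \<times> B2) (p i, p j) \<partial>count_space I)
       + indicator (B1 \<inter> B2) (p i) = (\<integral>\<^sup>+j. indicator B1 (p i) * indicator B2 (p j) \<partial>count_space I)" .
  qed
  also have "\<dots> = emeasure \<xi> B1 * emeasure \<xi> B2"
    using assms unfolding \<xi>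
    by (simp add: emeasure_distr_count_space_nn_integral nn_integral_cmult nn_integral_multc)
  finally show ?thesis .
qed

text \<open>A pair of points of a superposition belongs to one cluster or to two different ones.\<close>

lemma superposition_point_measures:
  fixes \<xi> :: "'k \<Rightarrow> 'b::t1_space measure"
  assumes K: "countable K" and \<xi>: "\<And>k. k \<in> K \<Longrightarrow> \<xi> k \<in> point_measures"
    and G: "G \<in> sets borel" and sets: "sets X = sets borel"
    and X: "\<And>B. B \<in> sets borel \<Longrightarrow> emeasure X B = (\<integral>\<^sup>+k. emeasure (\<xi> k) (B \<inter> G) \<partial>count_space K)"
  shows "X \<in> point_measures"
    and "\<And>B1 B2. B1 \<in> sets borel \<Longrightarrow> B2 \<in> sets borel \<Longrightarrow> B1 \<subseteq> G \<Longrightarrow> B2 \<subseteq> G \<Longrightarrow>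
      distinct_pairs X (B1 \<times> B2) =
       (\<integral>\<^sup>+k. distinct_pairs (\<xi> k) (B1 \<times> B2) \<partial>count_space K) +
       (\<integral>\<^sup>+k. (\<integral>\<^sup>+l. of_bool (k \<noteq> l) * (emeasure (\<xi> k) B1 * emeasure (\<xi> l) B2) \<partial>count_space K) \<partial>count_space K)"
proof -
  have "\<forall>k\<in>K. \<exists>I p. \<xi> k = distr (count_space I) borel (p :: nat \<Rightarrow> 'b)"
    using \<xi> by (meson point_measuresE)
  then obtain I p where Ip: "\<And>k. k \<in> K \<Longrightarrow> \<xi> k = distr (count_space (I k)) borel (p k :: nat \<Rightarrow> 'b)"
    by metis
  \<comment> \<open>The points of the superposition are indexed by pairs (cluster, point of that
    cluster), keeping only points in \<open>G\<close>.\<close>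
  define J where "J = (SIGMA k:K. {i\<in>I k. p k i \<in> G})"
  define q where "q = (\<lambda>(k, i). p k i)"
  have J: "countable J" unfolding J_def using K by (intro countable_SIGMA) auto
  have ind: "(\<integral>\<^sup>+i. f (p k i) \<partial>count_space {i\<in>I k. p k i \<in> G}) = (\<integral>\<^sup>+i. f (p k i) \<partial>count_space (I k))"
    if "\<And>x. f x \<noteq> 0 \<Longrightarrow> x \<in> G" for f :: "'b \<Rightarrow> ennreal" and k
    using that by (intro nn_integral_count_space_eq) auto
  have Xq: "X = distr (count_space J) borel q"
  proof (rule measure_eqI)
    fix B assume "B \<in> sets X"
    then have B: "B \<in> sets borel" using sets by simp
    have "emeasure (distr (count_space J) borel q) B = (\<integral>\<^sup>+z. indicator (B \<inter> G) (q z) \<partial>count_space J)"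
      using B by (auto simp: emeasure_distr_count_space_nn_integral J_def q_def indicator_def intro!: nn_integral_cong)
    also have "\<dots> = (\<integral>\<^sup>+k. (\<integral>\<^sup>+i. indicator (B \<inter> G) (p k i) \<partial>count_space (I k)) \<partial>count_space K)"
      unfolding J_def nn_integral_count_space_Sigma q_def prod.case
      by (subst ind) (auto simp: indicator_def split: if_splits)
    also have "\<dots> = emeasure X B"
      using B G by (auto simp: X Ip emeasure_distr_count_space_nn_integral intro!: nn_integral_cong)
    finally show "emeasure X B = emeasure (distr (count_space J) borel q) B" ..
  qed (simp add: sets)
  show "X \<in> point_measures"
    unfolding Xq by (rule distr_count_space_in_point_measures[OF J])
  fix B1 B2 :: "'b set"
  assume B: "B1 \<in> sets borel" "B2 \<in> sets borel" "B1 \<subseteq> G" "B2 \<subseteq> G"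
  \<comment> \<open>Rectangles inside \<open>G\<close> do not see the discarded points, so the
    original enumerations of the clusters can be restored.\<close>
  have *: "(\<integral>\<^sup>+i. (\<integral>\<^sup>+j. f i j * indicator (B1 \<times> B2) (p k i, p l j) \<partial>count_space {j\<in>I l. p l j \<in> G})
              \<partial>count_space {i\<in>I k. p k i \<in> G})
         = (\<integral>\<^sup>+i. (\<integral>\<^sup>+j. f i j * indicator (B1 \<times> B2) (p k i, p l j) \<partial>count_space (I l))
              \<partial>count_space (I k))" for k l and f :: "nat \<Rightarrow> nat \<Rightarrow> ennreal"
  proof -
    have "(\<integral>\<^sup>+j. f i j * indicator (B1 \<times> B2) (p k i, p l j) \<partial>count_space {j\<in>I l. p l j \<in> G})
      = (\<integral>\<^sup>+j. f i j * indicator (B1 \<times> B2) (p k i, p l j) \<partial>count_space (I l))" for i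
      using B(4) by (intro nn_integral_count_space_eq) (auto simp: indicator_def)
    moreover have "indicator (B1 \<times> B2) (p k i, p l j) = (0::ennreal)" if "p k i \<notin> G" for i j
      using B(3) that by (auto simp: indicator_def)
    then have "(\<integral>\<^sup>+j. f i j * indicator (B1 \<times> B2) (p k i, p l j) \<partial>count_space (I l)) = 0" if "p k i \<notin> G" for i
      using that by (simp only: mult_zero_right nn_integral_const mult_zero_left not_False_eq_True)
    ultimately show ?thesis
      by (simp only:, intro nn_integral_count_space_eq) auto
  qed
  have swap: "(\<integral>\<^sup>+i. (\<integral>\<^sup>+l. g i l \<partial>count_space K) \<partial>count_space (I' :: nat set)) =
      (\<integral>\<^sup>+l. (\<integral>\<^sup>+i. g i l \<partial>count_space I') \<partial>count_space K)" for I' and g :: "nat \<Rightarrow> 'k \<Rightarrow> ennreal"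
    by (rule nn_integral_count_space_nn_integral) (auto simp: K)
  have "distinct_pairs X (B1 \<times> B2) =
    (\<integral>\<^sup>+x. (\<integral>\<^sup>+y. of_bool (x \<noteq> y) * indicator (B1 \<times> B2) (q x, q y) \<partial>count_space J) \<partial>count_space J)"
    unfolding Xq by (rule distinct_pairs_nn_integral[OF J])
  also have "\<dots> = (\<integral>\<^sup>+k. (\<integral>\<^sup>+l. (\<integral>\<^sup>+i. (\<integral>\<^sup>+j. of_bool ((k,i) \<noteq> (l,j)) * indicator (B1 \<times> B2) (p k i, p l j)
      \<partial>count_space (I l)) \<partial>count_space (I k)) \<partial>count_space K) \<partial>count_space K)"
    unfolding J_def nn_integral_count_space_Sigma q_def prod.case swap * ..
  also have "\<dots> = (\<integral>\<^sup>+k. (\<integral>\<^sup>+l. indicator {k} l * distinct_pairs (\<xi> k) (B1 \<times> B2) +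
      of_bool (k \<noteq> l) * (emeasure (\<xi> k) B1 * emeasure (\<xi> l) B2) \<partial>count_space K) \<partial>count_space K)"
  proof (intro nn_integral_cong)
    fix k l assume k: "k \<in> space (count_space K)" and l: "l \<in> space (count_space K)"
    have dk: "distinct_pairs (\<xi> k) (B1 \<times> B2) =
       (\<integral>\<^sup>+i. (\<integral>\<^sup>+j. of_bool (i \<noteq> j) * indicator (B1 \<times> B2) (p k i, p k j) \<partial>count_space (I k)) \<partial>count_space (I k))"
      using k by (simp add: Ip distinct_pairs_nn_integral)
    have kl: "emeasure (\<xi> k) B1 * emeasure (\<xi> l) B2 =
      (\<integral>\<^sup>+i. (\<integral>\<^sup>+j. indicator (B1 \<times> B2) (p k i, p l j) \<partial>count_space (I l)) \<partial>count_space (I k))"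
      using k l B by (simp add: Ip emeasure_distr_count_space_nn_integral indicator_times
          nn_integral_cmult nn_integral_multc)
    \<comment> \<open>For \<open>k = l\<close> distinctness means distinctness inside the cluster;
      for \<open>k \<noteq> l\<close> it is automatic and the pair count is a product of
      counts.\<close>
    show "(\<integral>\<^sup>+i. (\<integral>\<^sup>+j. of_bool ((k,i) \<noteq> (l,j)) * indicator (B1 \<times> B2) (p k i, p l j)
      \<partial>count_space (I l)) \<partial>count_space (I k)) = indicator {k} l * distinct_pairs (\<xi> k) (B1 \<times> B2) +
      of_bool (k \<noteq> l) * (emeasure (\<xi> k) B1 * emeasure (\<xi> l) B2)"
      by (cases "k = l") (use dk in simp, simp add: kl)
  qed
  also have "\<dots> = (\<integral>\<^sup>+k. (\<integral>\<^sup>+l. indicator {k} l * distinct_pairs (\<xi> k) (B1 \<times> B2) \<partial>count_space K) \<partial>count_space K) +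
       (\<integral>\<^sup>+k. (\<integral>\<^sup>+l. of_bool (k \<noteq> l) * (emeasure (\<xi> k) B1 * emeasure (\<xi> l) B2) \<partial>count_space K) \<partial>count_space K)"
    by (simp add: nn_integral_add)
  also have "(\<integral>\<^sup>+k. (\<integral>\<^sup>+l. indicator {k} l * distinct_pairs (\<xi> k) (B1 \<times> B2) \<partial>count_space K) \<partial>count_space K)
     = (\<integral>\<^sup>+k. distinct_pairs (\<xi> k) (B1 \<times> B2) \<partial>count_space K)"
    by (intro nn_integral_cong) (simp add: nn_integral_multc one_ennreal_def[symmetric])
  finally show "distinct_pairs X (B1 \<times> B2) =
       (\<integral>\<^sup>+k. distinct_pairs (\<xi> k) (B1 \<times> B2) \<partial>count_space K) +
       (\<integral>\<^sup>+k. (\<integral>\<^sup>+l. of_bool (k \<noteq> l) * (emeasure (\<xi> k) B1 * emeasure (\<xi> l) B2) \<partial>count_space K) \<partial>count_space K)" .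
qed

section \<open>Measurability of counts and pair counts\<close>

lemma space_eval_algebra [simp]: "space (eval_algebra S) = S"
  by (auto simp: eval_algebra_def space_Sup_eq_UN)

lemma measurable_emeasure_eval_algebra [measurable]:
  "B \<in> sets borel \<Longrightarrow> (\<lambda>\<xi>. emeasure \<xi> B) \<in> borel_measurable (eval_algebra S)"
  by (auto intro!: measurable_Sup1 measurable_vimage_algebra1 simp: eval_algebra_def)

lemma measurable_eval_algebraI:
  assumes "\<And>x. x \<in> space M \<Longrightarrow> f x \<in> S"
    and "\<And>B. B \<in> sets borel \<Longrightarrow> (\<lambda>x. emeasure (f x) B) \<in> borel_measurable M"
  shows "f \<in> M \<rightarrow>\<^sub>M eval_algebra S"
  unfolding eval_algebra_def
  using assms by (intro measurable_SUP2 measurable_vimage_algebra2) auto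

lemma space_counting_algebra: "space counting_algebra = {\<xi> \<in> point_measures. locally_finite \<xi>}"
  by (simp add: counting_algebra_def)

lemma measurable_emeasure_counting_algebra [measurable]:
  "B \<in> sets borel \<Longrightarrow> (\<lambda>\<xi>. emeasure \<xi> B) \<in> borel_measurable counting_algebra"
  by (simp add: counting_algebra_def)

lemma distinct_pairs_suminf:
  fixes \<xi> :: "'b::t1_space measure"
  assumes "\<xi> \<in> point_measures" "disjoint_family F"
  shows "distinct_pairs \<xi> (\<Union>n. F n) = (\<Sum>n. distinct_pairs \<xi> (F n))"
proof -
  obtain I p where \<xi>: "\<xi> = distr (count_space I) borel (p :: nat \<Rightarrow> _)"
    using assms(1) by (rule point_measuresE)
  let ?S = "\<lambda>D. {(i, j). i \<in> I \<and> j \<in> I \<and> i \<noteq> j \<and> (p i, p j) \<in> D}"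
  have "(\<Sum>n. emeasure (count_space UNIV) (?S (F n))) = emeasure (count_space UNIV) (\<Union>n. ?S (F n))"
    using assms(2) by (intro suminf_emeasure) (auto simp: disjoint_family_on_def)
  also have "(\<Union>n. ?S (F n)) = ?S (\<Union>n. F n)" by auto
  finally show ?thesis by (simp add: \<xi> distinct_pairs_distr_count_space)
qed

lemma distinct_pairs_incseq:
  fixes \<xi> :: "'b::t1_space measure"
  assumes "\<xi> \<in> point_measures" "incseq F"
  shows "distinct_pairs \<xi> (\<Union>n. F n) = (SUP n. distinct_pairs \<xi> (F n))"
proof -
  obtain I p where \<xi>: "\<xi> = distr (count_space I) borel (p :: nat \<Rightarrow> _)"
    using assms(1) by (rule point_measuresE)
  let ?S = "\<lambda>D. {(i, j). i \<in> I \<and> j \<in> I \<and> i \<noteq> j \<and> (p i, p j) \<in> D}"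
  have "(SUP n. emeasure (count_space UNIV) (?S (F n))) = emeasure (count_space UNIV) (\<Union>n. ?S (F n))"
    using assms(2) by (intro SUP_emeasure_incseq) (auto simp: mono_def subset_eq)
  also have "(\<Union>n. ?S (F n)) = ?S (\<Union>n. F n)" by auto
  finally show ?thesis by (simp add: \<xi> distinct_pairs_distr_count_space)
qed

lemma distinct_pairs_mono:
  fixes \<xi> :: "'b::t1_space measure"
  assumes "\<xi> \<in> point_measures" "D \<subseteq> D'"
  shows "distinct_pairs \<xi> D \<le> distinct_pairs \<xi> D'"
proof -
  obtain I p where \<xi>: "\<xi> = distr (count_space I) borel (p :: nat \<Rightarrow> _)"
    using assms(1) by (rule point_measuresE)
  show ?thesis
    using assms(2) by (auto simp: \<xi> distinct_pairs_distr_count_space intro!: emeasure_mono)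
qed

lemma distinct_pairs_add:
  fixes \<xi> :: "'b::t1_space measure"
  assumes "\<xi> \<in> point_measures" "D \<inter> D' = {}"
  shows "distinct_pairs \<xi> (D \<union> D') = distinct_pairs \<xi> D + distinct_pairs \<xi> D'"
proof -
  obtain I p where \<xi>: "\<xi> = distr (count_space I) borel (p :: nat \<Rightarrow> _)"
    using assms(1) by (rule point_measuresE)
  let ?S = "\<lambda>D. {(i, j). i \<in> I \<and> j \<in> I \<and> i \<noteq> j \<and> (p i, p j) \<in> D}"
  have "?S (D \<union> D') = ?S D \<union> ?S D'" by auto
  then show ?thesis using assms(2)
    by (subst (1 2 3) \<xi>, simp only: distinct_pairs_distr_count_space[OF countableI_type])
      (auto intro!: plus_emeasure[symmetric])
qed

lemma distinct_pairs_le: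
  fixes \<xi> :: "'b::t1_space measure"
  assumes "\<xi> \<in> point_measures" "B1 \<in> sets borel" "B2 \<in> sets borel"
  shows "distinct_pairs \<xi> (B1 \<times> B2) \<le> emeasure \<xi> B1 * emeasure \<xi> B2"
  using distinct_pairs_plus_diagonal[OF assms] by (metis le_iff_add)

lemma distinct_pairs_empty [simp]: "\<xi> \<in> point_measures \<Longrightarrow> distinct_pairs \<xi> {} = 0" for \<xi> :: "'b::t1_space measure"
  using distinct_pairs_le[of \<xi> "{}" "{}"] by simp

text \<open>On a rectangle the pair count is the product of two counts minus the count of the
  diagonal; the subtraction is legitimate because \<open>B\<close> is bounded and the measures are
  locally finite. The same finiteness serves the complement step of the Dynkin argument.\<close>

lemma distinct_pairs_measurable_bounded:
  fixes B :: "'b::metric_space set"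
  assumes D: "D \<in> sets (borel \<Otimes>\<^sub>M borel)" and B: "B \<in> sets borel" "bounded B"
  shows "(\<lambda>\<xi>. distinct_pairs \<xi> (D \<inter> B \<times> B)) \<in> borel_measurable counting_algebra"
proof -
  let ?G = "{a \<times> b |a b. a \<in> sets (borel :: 'b measure) \<and> b \<in> sets (borel :: 'b measure)}"
  have rect: "(\<lambda>\<xi>. distinct_pairs \<xi> (a \<times> b \<inter> B \<times> B)) \<in> borel_measurable counting_algebra"
    if ab: "a \<in> sets borel" "b \<in> sets borel" for a b
  proof -
    have "(\<lambda>\<xi>. emeasure \<xi> (a \<inter> B) * emeasure \<xi> (b \<inter> B) - emeasure \<xi> (a \<inter> b \<inter> B))
        \<in> borel_measurable counting_algebra"
      using ab B by measurable
    also have "?this \<longleftrightarrow> ?thesis"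
    proof (rule measurable_cong)
      fix \<xi> :: "'b measure" assume "\<xi> \<in> space counting_algebra"
      then have \<xi>: "\<xi> \<in> point_measures" "locally_finite \<xi>" by (auto simp: space_counting_algebra)
      have bd: "bounded (a \<inter> b \<inter> B)" using B(2) by (rule bounded_subset) auto
      have "emeasure \<xi> (a \<inter> b \<inter> B) \<noteq> top"
        using \<xi>(2) ab B bd unfolding locally_finite_def
        by (metis infinity_ennreal_def less_top sets.Int)
      moreover have "a \<inter> B \<inter> (b \<inter> B) = a \<inter> b \<inter> B" by auto
      ultimately show "emeasure \<xi> (a \<inter> B) * emeasure \<xi> (b \<inter> B) - emeasure \<xi> (a \<inter> b \<inter> B) =
          distinct_pairs \<xi> (a \<times> b \<inter> B \<times> B)"
        using distinct_pairs_plus_diagonal[of \<xi> "a \<inter> B" "b \<inter> B"] \<xi> ab B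
        by (metis Times_Int_Times ennreal_add_diff_cancel_right sets.Int)
    qed
    finally show ?thesis .
  qed
  have "D \<in> sigma_sets UNIV ?G" using D by (simp add: sets_pair_measure)
  with Int_stable_pair_measure_generator[of borel borel] subset_UNIV[of ?G, folded Pow_UNIV] show ?thesis
  proof (induction rule: sigma_sets_induct_disjoint)
    case (basic D)
    then show ?case using rect by auto
  next
    case empty
    show ?case using rect[of "{}" "{}"] by simp
  next
    case (compl D)
    have 1: "(\<lambda>\<xi>. distinct_pairs \<xi> (B \<times> B) - distinct_pairs \<xi> (D \<inter> B \<times> B)) \<in> borel_measurable counting_algebra"
      using rect[of UNIV UNIV] compl by simp
    have "?this \<longleftrightarrow> ?case"
    proof (rule measurable_cong)
      fix \<xi> :: "'b measure" assume "\<xi> \<in> space counting_algebra"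
      then have \<xi>: "\<xi> \<in> point_measures" "locally_finite \<xi>" by (auto simp: space_counting_algebra)
      have "distinct_pairs \<xi> (D \<inter> B \<times> B) \<le> distinct_pairs \<xi> (B \<times> B)"
        by (intro distinct_pairs_mono \<xi>) auto
      also have "\<dots> \<le> emeasure \<xi> B * emeasure \<xi> B" by (intro distinct_pairs_le \<xi> B)
      also have "\<dots> < top" using \<xi>(2) B by (auto simp: locally_finite_def ennreal_mult_less_top)
      finally have fin: "distinct_pairs \<xi> (D \<inter> B \<times> B) \<noteq> top" by simp
      have "B \<times> B = ((UNIV - D) \<inter> B \<times> B) \<union> (D \<inter> B \<times> B)" by auto
      then have "distinct_pairs \<xi> (B \<times> B) =
         distinct_pairs \<xi> ((UNIV - D) \<inter> B \<times> B) + distinct_pairs \<xi> (D \<inter> B \<times> B)"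
        using distinct_pairs_add[OF \<xi>(1), of "(UNIV - D) \<inter> B \<times> B" "D \<inter> B \<times> B"] by auto
      then show "distinct_pairs \<xi> (B \<times> B) - distinct_pairs \<xi> (D \<inter> B \<times> B) =
          distinct_pairs \<xi> ((UNIV - D) \<inter> B \<times> B)"
        using fin by simp
    qed
    with 1 show ?case by simp
  next
    case (union F)
    have "(\<lambda>\<xi>. \<Sum>n. distinct_pairs \<xi> (F n \<inter> B \<times> B)) \<in> borel_measurable counting_algebra"
      using union by measurable
    also have "?this \<longleftrightarrow> ?case"
    proof (rule measurable_cong)
      fix \<xi> :: "'b measure" assume "\<xi> \<in> space counting_algebra"
      then have \<xi>: "\<xi> \<in> point_measures" by (auto simp: space_counting_algebra)
      have "disjoint_family (\<lambda>n. F n \<inter> B \<times> B)"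
        using union(1) by (auto simp: disjoint_family_on_def)
      from distinct_pairs_suminf[OF \<xi> this]
      show "(\<Sum>n. distinct_pairs \<xi> (F n \<inter> B \<times> B)) = distinct_pairs \<xi> (\<Union> (range F) \<inter> B \<times> B)"
        by simp
    qed
    finally show ?case .
  qed
qed

text \<open>Bounded squares exhaust the product space, and pair counts are continuous from
  below.\<close>

lemma distinct_pairs_measurable:
  assumes D: "D \<in> sets (borel \<Otimes>\<^sub>M (borel :: 'b::metric_space measure))"
  shows "(\<lambda>\<xi>. distinct_pairs \<xi> D) \<in> borel_measurable counting_algebra"
proof -
  let ?B = "\<lambda>n::nat. ball (undefined :: 'b) (real n)"
  have "(\<lambda>\<xi>. SUP n. distinct_pairs \<xi> (D \<inter> ?B n \<times> ?B n)) \<in> borel_measurable counting_algebra"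
    by (intro borel_measurable_SUP distinct_pairs_measurable_bounded D) auto
  also have "?this \<longleftrightarrow> ?thesis"
  proof (rule measurable_cong)
    fix \<xi> :: "'b measure" assume "\<xi> \<in> space counting_algebra"
    then have \<xi>: "\<xi> \<in> point_measures" by (auto simp: space_counting_algebra)
    have "incseq (\<lambda>n. D \<inter> ?B n \<times> ?B n)"
      by (auto simp: mono_def)
    from distinct_pairs_incseq[OF \<xi> this]
    have "(SUP n. distinct_pairs \<xi> (D \<inter> ?B n \<times> ?B n)) = distinct_pairs \<xi> (\<Union>n. D \<inter> ?B n \<times> ?B n)" ..
    also have "(\<Union>n. D \<inter> ?B n \<times> ?B n) = D"
    proof -
      have "\<exists>n. a \<in> ?B n \<and> b \<in> ?B n" for a b
        using reals_Archimedean2[of "max (dist undefined a) (dist undefined b)"] by auto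
      then show ?thesis by fast
    qed
    finally show "(SUP n. distinct_pairs \<xi> (D \<inter> ?B n \<times> ?B n)) = distinct_pairs \<xi> D" .
  qed
  finally show ?thesis .
qed

section \<open>Second factorial moment measures and mean measures\<close>

definition marked_pairs :: "'a set \<Rightarrow> (real \<times> real) set \<Rightarrow> (('a \<times> real) \<times> ('a \<times> real)) set" where
  "marked_pairs A T = {((x, t), (x', t')). x \<in> A \<and> x' \<in> A \<and> (t, t') \<in> T}"

lemma marked_pairs_times: "marked_pairs A (I \<times> J) = (A \<times> I) \<times> (A \<times> J)"
  by (auto simp: marked_pairs_def)

lemma marked_pairs_empty [simp]: "marked_pairs A {} = {}"
  by (auto simp: marked_pairs_def)

lemma marked_pairs_Union: "marked_pairs A (\<Union>n. F n) = (\<Union>n. marked_pairs A (F n))"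
  by (auto simp: marked_pairs_def)

lemma sets_marked_pairs [measurable]:
  fixes A :: "'a::{metric_space, second_countable_topology} set"
  assumes A: "A \<in> sets borel" and T: "T \<in> sets borel"
  shows "marked_pairs A T \<in> sets (borel \<Otimes>\<^sub>M borel)"
proof -
  have T': "T \<in> sets (borel \<Otimes>\<^sub>M borel)" unfolding borel_prod by (rule T)
  have "{z \<in> space ((borel \<Otimes>\<^sub>M borel) \<Otimes>\<^sub>M (borel \<Otimes>\<^sub>M borel)).
      fst (fst z) \<in> A \<and> fst (snd z) \<in> A \<and> (snd (fst z), snd (snd z)) \<in> T}
      \<in> sets (((borel :: 'a measure) \<Otimes>\<^sub>M (borel :: real measure)) \<Otimes>\<^sub>M ((borel :: 'a measure) \<Otimes>\<^sub>M (borel :: real measure)))"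
    using A T' by measurable
  also have "{z \<in> space ((borel \<Otimes>\<^sub>M borel) \<Otimes>\<^sub>M (borel \<Otimes>\<^sub>M borel)).
      fst (fst z) \<in> A \<and> fst (snd z) \<in> A \<and> (snd (fst z), snd (snd z)) \<in> T} = marked_pairs A T"
    by (auto simp: marked_pairs_def space_pair_measure)
  finally show ?thesis unfolding borel_prod .
qed

lemma factorial_moment2_marked_pairs:
  "factorial_moment2 M X A T = (\<integral>\<^sup>+w. distinct_pairs (X w) (marked_pairs A T) \<partial>M)"
  by (simp add: factorial_moment2_def marked_pairs_def)

definition factorial_measure2 ::
    "'w measure \<Rightarrow> ('w \<Rightarrow> ('a::metric_space \<times> real) measure) \<Rightarrow> 'a set \<Rightarrow> (real \<times> real) measure" where
  "factorial_measure2 M X A = measure_of UNIV (sets borel) (factorial_moment2 M X A)"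

lemma sets_factorial_measure2 [simp]: "sets (factorial_measure2 M X A) = sets borel"
  using sets.sigma_sets_eq[of "borel :: (real \<times> real) measure"] by (simp add: factorial_measure2_def)

text \<open>\<open>measure_of\<close> returns the intended value for a countably additive function.
  Exchanging sum and expectation requires measurable pair counts, hence values of \<open>X\<close>
  in \<open>counting_algebra\<close>.\<close>

lemma emeasure_factorial_measure2:
  fixes A :: "'a::{metric_space, second_countable_topology} set"
  assumes X: "X \<in> M \<rightarrow>\<^sub>M counting_algebra" and A: "A \<in> sets borel"
  assumes T: "T \<in> sets borel"
  shows "emeasure (factorial_measure2 M X A) T = factorial_moment2 M X A T"
proof -
  have X_pm: "X w \<in> point_measures" if "w \<in> space M" for w
    using measurable_space[OF X that] by (simp add: space_counting_algebra)
  have "countably_additive (sets borel) (factorial_moment2 M X A)"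
    unfolding countably_additive_def
  proof (intro allI impI)
    fix F :: "nat \<Rightarrow> (real \<times> real) set"
    assume F: "range F \<subseteq> sets borel" "disjoint_family F"
    have dj: "disjoint_family (\<lambda>n. marked_pairs A (F n))"
      using F(2) by (fastforce simp: disjoint_family_on_def marked_pairs_def)
    have "(\<Sum>n. factorial_moment2 M X A (F n)) =
       (\<integral>\<^sup>+w. (\<Sum>n. distinct_pairs (X w) (marked_pairs A (F n))) \<partial>M)"
      unfolding factorial_moment2_marked_pairs using F(1) A
      by (intro nn_integral_suminf[symmetric] measurable_compose[OF X distinct_pairs_measurable]) auto
    also have "\<dots> = factorial_moment2 M X A (\<Union>n. F n)"
      unfolding factorial_moment2_marked_pairs marked_pairs_Union
      by (intro nn_integral_cong distinct_pairs_suminf[symmetric] X_pm dj)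
    finally show "(\<Sum>n. factorial_moment2 M X A (F n)) = factorial_moment2 M X A (\<Union>n. F n)" .
  qed
  moreover have "factorial_moment2 M X A {} = 0"
  proof -
    have "(\<integral>\<^sup>+w. distinct_pairs (X w) (marked_pairs A {}) \<partial>M) = (\<integral>\<^sup>+w. 0 \<partial>M)"
      by (intro nn_integral_cong) (simp add: X_pm)
    then show ?thesis by (simp add: factorial_moment2_marked_pairs)
  qed
  ultimately show ?thesis
    unfolding factorial_measure2_def using T sets.sigma_algebra_axioms[of "borel :: (real \<times> real) measure"]
    by (intro emeasure_measure_of_sigma) (auto simp: positive_def)
qed

text \<open>Besides expectations over a probability space, this forms mixtures of kernels over
  \<open>\<Lambda>\<close> or over the intensity of the centres, and sums of two measures.\<close>

definition mean_measure :: "'w measure \<Rightarrow> ('w \<Rightarrow> 'b::topological_space measure) \<Rightarrow> 'b measure" where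
  "mean_measure M X = measure_of UNIV (sets borel) (moment1 M X)"

lemma sets_mean_measure [simp]: "sets (mean_measure M X) = sets (borel :: 'b::topological_space measure)"
  using sets.sigma_sets_eq[of "borel :: 'b measure"] by (simp add: mean_measure_def)

lemma emeasure_mean_measure:
  fixes X :: "'w \<Rightarrow> 'b::topological_space measure"
  assumes X: "\<And>B. B \<in> sets borel \<Longrightarrow> (\<lambda>w. emeasure (X w) B) \<in> borel_measurable M"
    and sets: "\<And>w. w \<in> space M \<Longrightarrow> sets (X w) = sets borel"
    and B: "B \<in> sets borel"
  shows "emeasure (mean_measure M X) B = moment1 M X B"
proof -
  have "countably_additive (sets borel) (moment1 M X)"
    unfolding countably_additive_def moment1_def
  proof (intro allI impI)
    fix F :: "nat \<Rightarrow> 'b set"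
    assume F: "range F \<subseteq> sets borel" "disjoint_family F"
    have "(\<Sum>n. \<integral>\<^sup>+w. emeasure (X w) (F n) \<partial>M) = (\<integral>\<^sup>+w. (\<Sum>n. emeasure (X w) (F n)) \<partial>M)"
      using F(1) X by (intro nn_integral_suminf[symmetric]) auto
    also have "\<dots> = (\<integral>\<^sup>+w. emeasure (X w) (\<Union>n. F n) \<partial>M)"
      using F by (intro nn_integral_cong suminf_emeasure) (auto simp: sets)
    finally show "(\<Sum>n. \<integral>\<^sup>+w. emeasure (X w) (F n) \<partial>M) = (\<integral>\<^sup>+w. emeasure (X w) (\<Union>n. F n) \<partial>M)" .
  qed
  moreover have "moment1 M X {} = 0" by (simp add: moment1_def)
  ultimately show ?thesis
    unfolding mean_measure_def using B sets.sigma_algebra_axioms[of "borel :: 'b measure"]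
    by (intro emeasure_measure_of_sigma) (auto simp: positive_def)
qed

section \<open>Conditional independence of the clusters\<close>

lemma locally_finite_sigma_finite:
  fixes \<nu> :: "'b::metric_space measure"
  assumes "locally_finite \<nu>"
  shows "sigma_finite_measure \<nu>"
proof
  have sets: "sets \<nu> = sets borel" using assms by (simp add: locally_finite_def)
  show "\<exists>A. countable A \<and> A \<subseteq> sets \<nu> \<and> \<Union> A = space \<nu> \<and> (\<forall>a\<in>A. emeasure \<nu> a \<noteq> \<infinity>)"
  proof (intro exI conjI)
    let ?A = "range (\<lambda>n::nat. ball (undefined :: 'b) (real n))"
    show "countable ?A" by simp
    show "?A \<subseteq> sets \<nu>" by (auto simp: sets)
    have "space \<nu> = UNIV" using sets_eq_imp_space_eq[OF sets] by simp
    then show "\<Union> ?A = space \<nu>"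
      using reals_Archimedean2 by fastforce
    have "emeasure \<nu> (ball undefined (real n)) < \<infinity>" for n
      using assms by (simp add: locally_finite_def)
    then show "\<forall>a\<in>?A. emeasure \<nu> a \<noteq> \<infinity>" by (auto simp: less_top)
  qed
qed

text \<open>Since all sets of finite reference measure are tested, cutting along a disjoint
  sigma-finite partition of the reference space suffices; the two compared measures may be infinite
  on the pieces.\<close>

lemma measure_eqI_finite_sets:
  assumes "sigma_finite_measure \<nu>" and sets: "sets \<kappa> = sets \<nu>" "sets \<kappa>' = sets \<nu>"
    and eq: "\<And>B. B \<in> sets \<nu> \<Longrightarrow> emeasure \<nu> B < \<infinity> \<Longrightarrow> emeasure \<kappa> B = emeasure \<kappa>' B"
  shows "\<kappa> = \<kappa>'"
proof (rule measure_eqI)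
  show "sets \<kappa> = sets \<kappa>'" by (simp add: sets)
  fix B assume "B \<in> sets \<kappa>"
  then have B: "B \<in> sets \<nu>" by (simp add: sets)
  interpret sigma_finite_measure \<nu> by fact
  obtain A :: "nat \<Rightarrow> _ set" where A: "range A \<subseteq> sets \<nu>" "(\<Union>i. A i) = space \<nu>"
      "\<And>i. emeasure \<nu> (A i) \<noteq> \<infinity>" "disjoint_family A"
    using sigma_finite_disjoint by blast
  have U: "(\<Union>n. B \<inter> A n) = B" using A(2) sets.sets_into_space[OF B] by auto
  have fin: "emeasure \<nu> (B \<inter> A n) < \<infinity>" for n
    using emeasure_mono[of "B \<inter> A n" "A n" \<nu>] A(1,3) by (auto simp: less_top[symmetric] top_unique)
  have dj: "disjoint_family (\<lambda>n. B \<inter> A n)" using A(4) by (auto simp: disjoint_family_on_def)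
  have r: "range (\<lambda>n. B \<inter> A n) \<subseteq> sets \<nu>" using A(1) B by auto
  have "emeasure \<kappa> B = (\<Sum>n. emeasure \<kappa> (B \<inter> A n))"
    using suminf_emeasure[of "\<lambda>n. B \<inter> A n" \<kappa>] r dj by (simp only: U sets)
  also have "\<dots> = (\<Sum>n. emeasure \<kappa>' (B \<inter> A n))"
    using fin r by (intro suminf_cong eq) auto
  also have "\<dots> = emeasure \<kappa>' B"
    using suminf_emeasure[of "\<lambda>n. B \<inter> A n" \<kappa>'] r dj by (simp only: U sets)
  finally show "emeasure \<kappa> B = emeasure \<kappa>' B" .
qed

locale cluster_process = poisson_cluster_process M \<Lambda> P N Z C
  for M :: "'w measure"
    and \<Lambda> :: "'a::polish_space measure"
    and P :: "'a \<times> real \<Rightarrow> ('a \<times> real) measure measure"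
    and N :: "'w \<Rightarrow> enat"
    and Z :: "nat \<Rightarrow> 'w \<Rightarrow> 'a \<times> real"
    and C :: "nat \<Rightarrow> 'w \<Rightarrow> ('a \<times> real) measure" +
  assumes kernel: "cluster_kernel P" and locally_finite_\<Lambda>: "locally_finite \<Lambda>"
begin

definition idx :: "'w \<Rightarrow> nat set" where "idx w = {i. enat i < N w}"

abbreviation (input) csum :: "'w \<Rightarrow> (nat \<Rightarrow> ennreal) \<Rightarrow> ennreal" where
  "csum w g \<equiv> nn_integral (count_space (idx w)) g"

abbreviation (input) H :: "'w \<Rightarrow> ('a \<times> real) measure" where "H \<equiv> ground_process N Z"

definition \<nu> :: "('a \<times> real) measure" where "\<nu> = \<Lambda> \<Otimes>\<^sub>M lborel"

lemma sets_\<Lambda> [simp, measurable_cong]: "sets \<Lambda> = sets borel"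
  using locally_finite_\<Lambda> by (simp add: locally_finite_def)

lemma sets_\<nu> [simp, measurable_cong]: "sets \<nu> = sets borel"
proof -
  have "sets \<nu> = sets (borel \<Otimes>\<^sub>M borel :: ('a \<times> real) measure)"
    unfolding \<nu>_def by (intro sets_pair_measure_cong) auto
  then show ?thesis unfolding borel_prod .
qed

lemma space_\<nu> [simp]: "space \<nu> = UNIV"
  using sets_eq_imp_space_eq[OF sets_\<nu>] by simp

sublocale \<Lambda>: sigma_finite_measure \<Lambda>
  by (rule locally_finite_sigma_finite[OF locally_finite_\<Lambda>])

sublocale \<Lambda>L: pair_sigma_finite \<Lambda> "lborel :: real measure" ..

sublocale \<nu>: sigma_finite_measure \<nu>
  unfolding \<nu>_def by (rule \<Lambda>L.sigma_finite_measure_axioms)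

lemma pred_idx [measurable]: "Measurable.pred M (\<lambda>w. i \<in> idx w)"
  unfolding idx_def using measurable_compose[OF N_measurable, of "\<lambda>n. enat i < n" "count_space UNIV"] by simp

declare Z_measurable [measurable] C_measurable [measurable]

lemma ground_events_subset: "ground_events M N Z \<subseteq> sets M"
  unfolding ground_events_def
proof (rule sets.sigma_sets_subset, clarify)
  fix i and B :: "('a \<times> real) set" assume "B \<in> sets borel"
  moreover have "{w \<in> space M. enat i < N w \<and> Z i w \<in> B} = {w \<in> space M. i \<in> idx w \<and> Z i w \<in> B}"
    by (simp add: idx_def)
  ultimately show "{w \<in> space M. enat i < N w \<and> Z i w \<in> B} \<in> sets M"
    by simp
qed

sublocale ground: sigma_algebra "space M" "ground_events M N Z"
  unfolding ground_events_def by (rule sigma_algebra_sigma_sets) auto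

lemma ground_events_idx: "{w \<in> space M. i \<in> idx w} \<in> ground_events M N Z"
proof -
  have "{w \<in> space M. enat i < N w \<and> Z i w \<in> UNIV} \<in> ground_events M N Z"
    unfolding ground_events_def by (intro sigma_sets.Basic CollectI exI[of _ i] exI[of _ UNIV]) simp
  then show ?thesis by (simp add: idx_def)
qed

lemma kernel_subprob [measurable]: "P \<in> borel \<rightarrow>\<^sub>M subprob_algebra counting_algebra"
  using kernel unfolding cluster_kernel_def by (rule measurable_prob_algebraD)

lemma kernel_prob: "prob_space (P z)"
  using measurable_space[OF kernel[unfolded cluster_kernel_def], of z] by (simp add: space_prob_algebra)

lemma sets_kernel [simp]: "sets (P z) = sets counting_algebra"
  using measurable_space[OF kernel[unfolded cluster_kernel_def], of z] by (simp add: space_prob_algebra)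

lemma space_kernel [simp]: "space (P z) = space counting_algebra"
  using sets_eq_imp_space_eq[OF sets_kernel] by simp

lemma measurable_kernel_cong: "measurable (P z) K = measurable counting_algebra K"
  by (rule measurable_cong_sets) auto

definition cluster_mean :: "(('a \<times> real) measure \<Rightarrow> ennreal) \<Rightarrow> 'a \<times> real \<Rightarrow> ennreal" where
  "cluster_mean f z = (\<integral>\<^sup>+\<xi>. f \<xi> \<partial>P z)"

lemma measurable_cluster_mean [measurable]:
  "f \<in> borel_measurable counting_algebra \<Longrightarrow> cluster_mean f \<in> borel_measurable borel"
  unfolding cluster_mean_def
  by (rule measurable_compose[OF kernel_subprob nn_integral_measurable_subprob_algebra])

lemma cluster_mean_indicator: "D \<in> sets counting_algebra \<Longrightarrow> cluster_mean (indicator D) z = emeasure (P z) D"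
  by (simp add: cluster_mean_def)

lemma cluster_mean_1: "cluster_mean (\<lambda>_. 1) z = 1"
  using prob_space.emeasure_space_1[OF kernel_prob[of z]] by (simp add: cluster_mean_def)

text \<open>The identity for indicator functions is extended to general functions one cluster at a time;
  conditioning on the existence of that cluster makes both sides linear in its function.\<close>

lemma clusters_prod_partial:
  assumes "j \<le> n" "E \<in> ground_events M N Z"
    and "\<And>i. i < j \<Longrightarrow> f i \<in> borel_measurable counting_algebra"
    and "\<And>i. j \<le> i \<Longrightarrow> i < n \<Longrightarrow> \<exists>D\<in>sets counting_algebra. f i = indicator D"
  shows "(\<integral>\<^sup>+w\<in>E. (\<Prod>i<n. if i \<in> idx w then f i (C i w) else 1) \<partial>M) =
         (\<integral>\<^sup>+w\<in>E. (\<Prod>i<n. if i \<in> idx w then cluster_mean (f i) (Z i w) else 1) \<partial>M)"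
  using assms
proof (induction j arbitrary: E f)
  case 0
  then obtain D where D: "\<And>i. i < n \<Longrightarrow> D i \<in> sets counting_algebra" "\<And>i. i < n \<Longrightarrow> f i = indicator (D i)"
    by (metis le0)
  have E: "E \<in> sets M" using 0 ground_events_subset by auto
  then have ES: "E \<subseteq> space M" by (rule sets.sets_into_space)
  have "(\<integral>\<^sup>+w\<in>E. (\<Prod>i<n. if i \<in> idx w then f i (C i w) else 1) \<partial>M)
     = (\<integral>\<^sup>+w. indicator {w \<in> E. \<forall>i<n. enat i < N w \<longrightarrow> C i w \<in> D i} w \<partial>M)"
  proof (intro nn_integral_cong)
    fix w
    have "(\<Prod>i<n. if i \<in> idx w then f i (C i w) else 1) = (\<Prod>i<n. of_bool (i \<in> idx w \<longrightarrow> C i w \<in> D i))"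
      by (intro prod.cong) (auto simp: D indicator_def)
    also have "\<dots> = of_bool (\<forall>i<n. i \<in> idx w \<longrightarrow> C i w \<in> D i)"
      by (induction n) (auto simp: less_Suc_eq)
    finally show "(\<Prod>i<n. if i \<in> idx w then f i (C i w) else 1) * indicator E w =
       indicator {w \<in> E. \<forall>i<n. enat i < N w \<longrightarrow> C i w \<in> D i} w"
      by (auto simp: indicator_def idx_def)
  qed
  also have "\<dots> = emeasure M {w \<in> E. \<forall>i<n. enat i < N w \<longrightarrow> C i w \<in> D i}"
  proof (rule nn_integral_indicator)
    have "{w \<in> space M. \<forall>i<n. i \<in> idx w \<longrightarrow> C i w \<in> D i} \<in> sets M"
      using D(1) by measurable
    then have "E \<inter> {w \<in> space M. \<forall>i<n. i \<in> idx w \<longrightarrow> C i w \<in> D i} \<in> sets M"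
      by (intro sets.Int E)
    also have "E \<inter> {w \<in> space M. \<forall>i<n. i \<in> idx w \<longrightarrow> C i w \<in> D i} =
      {w \<in> E. \<forall>i<n. enat i < N w \<longrightarrow> C i w \<in> D i}"
      using ES by (auto simp: idx_def)
    finally show "{w \<in> E. \<forall>i<n. enat i < N w \<longrightarrow> C i w \<in> D i} \<in> sets M" .
  qed
  also have "\<dots> = (\<integral>\<^sup>+w\<in>E. (\<Prod>i | i < n \<and> enat i < N w. emeasure (P (Z i w)) (D i)) \<partial>M)"
    using 0 D(1) by (intro clusters)
  also have "\<dots> = (\<integral>\<^sup>+w\<in>E. (\<Prod>i<n. if i \<in> idx w then cluster_mean (f i) (Z i w) else 1) \<partial>M)"
  proof (intro nn_integral_cong)
    fix w
    have "(\<Prod>i | i < n \<and> enat i < N w. emeasure (P (Z i w)) (D i)) =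
        (\<Prod>i\<in>{i\<in>{..<n}. i \<in> idx w}. cluster_mean (f i) (Z i w))"
      by (intro prod.cong) (auto simp: idx_def D cluster_mean_indicator)
    also have "\<dots> = (\<Prod>i<n. if i \<in> idx w then cluster_mean (f i) (Z i w) else 1)"
      by (rule prod.inter_filter) simp
    finally show "(\<Prod>i | i < n \<and> enat i < N w. emeasure (P (Z i w)) (D i)) * indicator E w =
        (\<Prod>i<n. if i \<in> idx w then cluster_mean (f i) (Z i w) else 1) * indicator E w" by simp
  qed
  finally show ?case .
next
  case (Suc j)
  let ?W = "\<lambda>f w. \<Prod>i<n. if i \<in> idx w then f i (C i w) else 1"
  let ?V = "\<lambda>f w. \<Prod>i<n. if i \<in> idx w then cluster_mean (f i) (Z i w) else 1"
  let ?R = "\<lambda>w. \<Prod>i\<in>{..<n}-{j}. if i \<in> idx w then f i (C i w) else 1"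
  let ?Q = "\<lambda>w. \<Prod>i\<in>{..<n}-{j}. if i \<in> idx w then cluster_mean (f i) (Z i w) else 1"
  have j: "j < n" using Suc by simp
  have f_meas: "f i \<in> borel_measurable counting_algebra" if "i < n" for i
  proof (cases "i < Suc j")
    case False
    then have "\<exists>D\<in>sets counting_algebra. f i = indicator D" using Suc.prems(4) that by simp
    then show ?thesis by auto
  qed (use Suc in auto)
  have mR [measurable]: "?R \<in> borel_measurable M"
    by (intro borel_measurable_prod_ennreal measurable_If measurable_compose[OF C_measurable f_meas]) auto
  have mQ [measurable]: "?Q \<in> borel_measurable M"
    by (intro borel_measurable_prod_ennreal measurable_If measurable_compose[OF Z_measurable measurable_cluster_mean] f_meas) auto
  have W: "?W (f(j := h)) w = ?R w * (if j \<in> idx w then h (C j w) else 1)" for h w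
  proof -
    have "(\<Prod>i\<in>{..<n}-{j}. if i \<in> idx w then (f(j := h)) i (C i w) else 1) = ?R w"
      by (intro prod.cong) auto
    then show ?thesis
      using j by (subst prod.remove[of _ j]) (auto simp: mult.commute)
  qed
  have V: "?V (f(j := h)) w = ?Q w * (if j \<in> idx w then cluster_mean h (Z j w) else 1)" for h w
  proof -
    have "(\<Prod>i\<in>{..<n}-{j}. if i \<in> idx w then cluster_mean ((f(j := h)) i) (Z i w) else 1) = ?Q w"
      by (intro prod.cong) auto
    then show ?thesis
      using j by (subst prod.remove[of _ j]) (auto simp: mult.commute)
  qed
  \<comment> \<open>The induction hypothesis is used with an indicator in position \<open>j\<close>;
    \<open>E\<close> and \<open>D\<close> stay free because it is applied to two events and to every
    measurable set.\<close>
  have IH: "(\<integral>\<^sup>+w\<in>E. ?R w * (if j \<in> idx w then indicator D (C j w) else 1) \<partial>M) =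
         (\<integral>\<^sup>+w\<in>E. ?Q w * (if j \<in> idx w then cluster_mean (indicator D) (Z j w) else 1) \<partial>M)"
    if "E \<in> ground_events M N Z" "D \<in> sets counting_algebra" for E D
    using Suc.IH[of E "f(j := indicator D)"] that Suc.prems j
    unfolding W V by (force simp: less_Suc_eq le_Suc_eq)
  have E: "E \<in> sets M" using Suc ground_events_subset by auto
  define E1 where "E1 = E \<inter> {w \<in> space M. j \<in> idx w}"
  define E2 where "E2 = E - {w \<in> space M. j \<in> idx w}"
  have G: "E1 \<in> ground_events M N Z" "E2 \<in> ground_events M N Z"
    unfolding E1_def E2_def using Suc ground_events_idx[of j] by auto
  then have ES [measurable]: "E1 \<in> sets M" "E2 \<in> sets M" using ground_events_subset by auto
  have on1: "j \<in> idx w" if "w \<in> E1" for w using that by (auto simp: E1_def)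
  have on2: "j \<notin> idx w" if "w \<in> E2" for w
    using that sets.sets_into_space[OF E] by (auto simp: E2_def)
  have L1: "(\<integral>\<^sup>+w. ?R w * h (C j w) * indicator E1 w \<partial>M) =
     (\<integral>\<^sup>+w. ?Q w * cluster_mean h (Z j w) * indicator E1 w \<partial>M)" if h: "h \<in> borel_measurable counting_algebra" for h
  proof -
    \<comment> \<open>Both sides are integrals of \<open>h\<close> against measures on the space of
      realizations: \<open>?K1\<close> is the weighted law of cluster \<open>j\<close>,
      \<open>?K2\<close> the mixture of kernels with the corresponding weight. The induction
      hypothesis identifies them on every measurable set.\<close>
    let ?K1 = "distr (density M (\<lambda>w. ?R w * indicator E1 w)) counting_algebra (C j)"
    let ?K2 = "density M (\<lambda>w. ?Q w * indicator E1 w) \<bind> (\<lambda>w. P (Z j w))"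
    have K1: "(\<integral>\<^sup>+\<xi>. h \<xi> \<partial>?K1) = (\<integral>\<^sup>+w. ?R w * h (C j w) * indicator E1 w \<partial>M)"
      if [measurable]: "h \<in> borel_measurable counting_algebra" for h
      by (subst nn_integral_distr, measurable, subst nn_integral_density) (auto simp: mult_ac)
    have K2: "(\<integral>\<^sup>+\<xi>. h \<xi> \<partial>?K2) = (\<integral>\<^sup>+w. ?Q w * cluster_mean h (Z j w) * indicator E1 w \<partial>M)"
      if [measurable]: "h \<in> borel_measurable counting_algebra" for h
      by (subst nn_integral_bind[of _ counting_algebra], measurable, subst nn_integral_density)
        (auto simp: mult_ac cluster_mean_def[symmetric])
    have K2_sets: "sets ?K2 = sets counting_algebra"
      using not_empty by (intro sets_bind) auto
    have "?K1 = ?K2"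
    proof (rule measure_eqI)
      fix D assume "D \<in> sets ?K1"
      then have D [measurable]: "D \<in> sets counting_algebra" by simp
      have "emeasure ?K1 D = (\<integral>\<^sup>+w\<in>E1. ?R w * (if j \<in> idx w then indicator D (C j w) else 1) \<partial>M)"
      proof -
        have "emeasure ?K1 D = (\<integral>\<^sup>+\<xi>. indicator D \<xi> \<partial>?K1)" by simp
        also have "\<dots> = (\<integral>\<^sup>+w. ?R w * indicator D (C j w) * indicator E1 w \<partial>M)" by (rule K1) simp
        finally show ?thesis
          using on1 by (simp only:) (auto simp: indicator_def intro!: nn_integral_cong)
      qed
      also have "\<dots> = (\<integral>\<^sup>+w\<in>E1. ?Q w * (if j \<in> idx w then cluster_mean (indicator D) (Z j w) else 1) \<partial>M)"
        using G(1) D by (rule IH)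
      also have "\<dots> = emeasure ?K2 D"
      proof -
        have "emeasure ?K2 D = (\<integral>\<^sup>+\<xi>. indicator D \<xi> \<partial>?K2)" by (simp add: K2_sets)
        also have "\<dots> = (\<integral>\<^sup>+w. ?Q w * cluster_mean (indicator D) (Z j w) * indicator E1 w \<partial>M)" by (rule K2) simp
        finally show ?thesis
          using on1 by (simp only:) (auto simp: indicator_def intro!: nn_integral_cong)
      qed
      finally show "emeasure ?K1 D = emeasure ?K2 D" .
    qed (simp add: K2_sets)
    then show ?thesis using K1[OF h] K2[OF h] by simp
  qed
  have L2: "(\<integral>\<^sup>+w. ?R w * indicator E2 w \<partial>M) = (\<integral>\<^sup>+w. ?Q w * indicator E2 w \<partial>M)"
  proof -
    \<comment> \<open>Cluster \<open>j\<close> does not exist on \<open>E2\<close>, so any set may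
      stand in its position; the empty set is chosen.\<close>
    have "(\<integral>\<^sup>+w. ?R w * indicator E2 w \<partial>M) =
      (\<integral>\<^sup>+w\<in>E2. ?R w * (if j \<in> idx w then indicator {} (C j w) else 1) \<partial>M)"
      using on2 by (intro nn_integral_cong) (auto simp: indicator_def)
    also have "\<dots> = (\<integral>\<^sup>+w\<in>E2. ?Q w * (if j \<in> idx w then cluster_mean (indicator {}) (Z j w) else 1) \<partial>M)"
      using G(2) by (rule IH) simp
    also have "\<dots> = (\<integral>\<^sup>+w. ?Q w * indicator E2 w \<partial>M)"
      using on2 by (intro nn_integral_cong) (auto simp: indicator_def)
    finally show ?thesis .
  qed
  have W: "?W f w = ?R w * (if j \<in> idx w then f j (C j w) else 1)"
    and V: "?V f w = ?Q w * (if j \<in> idx w then cluster_mean (f j) (Z j w) else 1)" for w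
    using j by (simp_all add: prod.remove[of "{..<n}" j] mult.commute)
  have fj [measurable]: "f j \<in> borel_measurable counting_algebra" using f_meas j by simp
  have "(\<integral>\<^sup>+w\<in>E. ?W f w \<partial>M) = (\<integral>\<^sup>+w. ?R w * f j (C j w) * indicator E1 w + ?R w * indicator E2 w \<partial>M)"
    using W by (intro nn_integral_cong) (auto simp: E1_def E2_def indicator_def)
  also have "\<dots> = (\<integral>\<^sup>+w. ?R w * f j (C j w) * indicator E1 w \<partial>M) + (\<integral>\<^sup>+w. ?R w * indicator E2 w \<partial>M)"
    by (rule nn_integral_add) auto
  also have "\<dots> = (\<integral>\<^sup>+w. ?Q w * cluster_mean (f j) (Z j w) * indicator E1 w \<partial>M) + (\<integral>\<^sup>+w. ?Q w * indicator E2 w \<partial>M)"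
    by (simp only: L1[OF fj] L2)
  also have "\<dots> = (\<integral>\<^sup>+w. ?Q w * cluster_mean (f j) (Z j w) * indicator E1 w + ?Q w * indicator E2 w \<partial>M)"
    by (rule nn_integral_add[symmetric]) auto
  also have "\<dots> = (\<integral>\<^sup>+w\<in>E. ?V f w \<partial>M)"
    using V by (intro nn_integral_cong) (auto simp: E1_def E2_def indicator_def)
  finally show ?case .
qed

lemma clusters_prod:
  assumes "E \<in> ground_events M N Z" "\<And>i. i < n \<Longrightarrow> f i \<in> borel_measurable counting_algebra"
  shows "(\<integral>\<^sup>+w\<in>E. (\<Prod>i<n. if i \<in> idx w then f i (C i w) else 1) \<partial>M) =
         (\<integral>\<^sup>+w\<in>E. (\<Prod>i<n. if i \<in> idx w then cluster_mean (f i) (Z i w) else 1) \<partial>M)"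
  using clusters_prod_partial[of n n E f] assms by auto

text \<open>The product identity is applied on the event that cluster \<open>i\<close> exists, with
  the constant 1 for all other clusters, whose kernel means are then 1.\<close>

lemma cluster_single:
  assumes f: "f \<in> borel_measurable counting_algebra"
  shows "(\<integral>\<^sup>+w. of_bool (i \<in> idx w) * f (C i w) \<partial>M) =
         (\<integral>\<^sup>+w. of_bool (i \<in> idx w) * cluster_mean f (Z i w) \<partial>M)"
proof -
  let ?f = "\<lambda>k. if k = i then f else (\<lambda>_. 1)"
  have p: "(\<Prod>k<Suc i. g k) = g i" if "\<And>k. k < i \<Longrightarrow> g k = 1" for g :: "nat \<Rightarrow> ennreal"
    using that by simp
  let ?E = "{w \<in> space M. i \<in> idx w}"
  have "(\<integral>\<^sup>+w. of_bool (i \<in> idx w) * f (C i w) \<partial>M) =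
      (\<integral>\<^sup>+w\<in>?E. (\<Prod>k<Suc i. if k \<in> idx w then ?f k (C k w) else 1) \<partial>M)"
    by (intro nn_integral_cong, subst p) (auto simp: indicator_def)
  also have "\<dots> = (\<integral>\<^sup>+w\<in>?E. (\<Prod>k<Suc i. if k \<in> idx w then cluster_mean (?f k) (Z k w) else 1) \<partial>M)"
    using f by (intro clusters_prod ground_events_idx) auto
  also have "\<dots> = (\<integral>\<^sup>+w. of_bool (i \<in> idx w) * cluster_mean f (Z i w) \<partial>M)"
    by (intro nn_integral_cong, subst p) (auto simp: indicator_def cluster_mean_1)
  finally show ?thesis .
qed

lemma cluster_pair:
  assumes fg: "f \<in> borel_measurable counting_algebra" "g \<in> borel_measurable counting_algebra" and ij: "i \<noteq> j"
  shows "(\<integral>\<^sup>+w. of_bool (i \<in> idx w \<and> j \<in> idx w) * (f (C i w) * g (C j w)) \<partial>M) =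
         (\<integral>\<^sup>+w. of_bool (i \<in> idx w \<and> j \<in> idx w) * (cluster_mean f (Z i w) * cluster_mean g (Z j w)) \<partial>M)"
proof -
  let ?f = "\<lambda>k. if k = i then f else if k = j then g else (\<lambda>_. 1)"
  let ?n = "Suc (max i j)"
  have p: "(\<Prod>k<?n. h k) = h i * h j" if "\<And>k. k \<noteq> i \<Longrightarrow> k \<noteq> j \<Longrightarrow> h k = 1" for h :: "nat \<Rightarrow> ennreal"
  proof -
    have "(\<Prod>k<?n. h k) = (\<Prod>k\<in>{i, j}. h k)"
      using that by (intro prod.mono_neutral_right) auto
    then show ?thesis using ij by simp
  qed
  let ?E = "{w \<in> space M. i \<in> idx w} \<inter> {w \<in> space M. j \<in> idx w}"
  have "?E \<in> ground_events M N Z" using ground_events_idx by (intro ground.Int)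
  then have "(\<integral>\<^sup>+w\<in>?E. (\<Prod>k<?n. if k \<in> idx w then ?f k (C k w) else 1) \<partial>M) =
    (\<integral>\<^sup>+w\<in>?E. (\<Prod>k<?n. if k \<in> idx w then cluster_mean (?f k) (Z k w) else 1) \<partial>M)"
    using fg by (intro clusters_prod) auto
  also have "(\<integral>\<^sup>+w\<in>?E. (\<Prod>k<?n. if k \<in> idx w then ?f k (C k w) else 1) \<partial>M) =
    (\<integral>\<^sup>+w. of_bool (i \<in> idx w \<and> j \<in> idx w) * (f (C i w) * g (C j w)) \<partial>M)"
    using ij by (intro nn_integral_cong, subst p) (auto simp: indicator_def)
  also have "(\<integral>\<^sup>+w\<in>?E. (\<Prod>k<?n. if k \<in> idx w then cluster_mean (?f k) (Z k w) else 1) \<partial>M) =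
    (\<integral>\<^sup>+w. of_bool (i \<in> idx w \<and> j \<in> idx w) * (cluster_mean f (Z i w) * cluster_mean g (Z j w)) \<partial>M)"
    using ij by (intro nn_integral_cong, subst p) (auto simp: indicator_def cluster_mean_1)
  finally show ?thesis .
qed

end

section \<open>Moments of the process of centres\<close>

definition pois :: "real \<Rightarrow> nat \<Rightarrow> real" where "pois l k = l ^ k / fact k * exp (- l)"

lemma pois_nonneg: "0 \<le> l \<Longrightarrow> 0 \<le> pois l k"
  by (simp add: pois_def)

lemma pois_sums: "pois l sums 1"
proof -
  have "(\<lambda>k. l ^ k / fact k * exp (- l)) sums (exp l * exp (- l))"
    using exp_converges[of l] by (intro sums_mult2) (simp add: divide_inverse mult.commute)
  then show ?thesis by (simp add: pois_def[abs_def] exp_minus)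
qed

text \<open>This size-biasing identity turns a weight into a shift of the index, so the mean and the
  second factorial moment reduce to the normalisation \<open>pois_sums\<close>.\<close>

lemma pois_Suc: "real (Suc k) * pois l (Suc k) = l * pois l k"
  by (simp add: pois_def field_simps del: of_nat_Suc)

lemma pois_mean_sums: "(\<lambda>k. real k * pois l k) sums l"
proof -
  have "(\<lambda>k. real (Suc k) * pois l (Suc k)) sums l"
    unfolding pois_Suc using sums_mult[OF pois_sums, of l] by simp
  from sums_Suc[of "\<lambda>k. real k * pois l k", OF this] show ?thesis by simp
qed

lemma pois_factorial_sums: "(\<lambda>k. real k * real (k - 1) * pois l k) sums l\<^sup>2"
proof -
  have "(\<lambda>k. l * (real k * pois l k)) sums (l * l)"
    by (intro sums_mult pois_mean_sums)
  also have "(\<lambda>k. l * (real k * pois l k)) = (\<lambda>k. real (Suc k) * real (Suc k - 1) * pois l (Suc k))"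
  proof
    fix k
    have "real (Suc k) * real (Suc k - 1) * pois l (Suc k) = real k * (real (Suc k) * pois l (Suc k))"
      by (simp del: of_nat_Suc)
    also have "\<dots> = l * (real k * pois l k)" by (simp only: pois_Suc mult.left_commute)
    finally show "l * (real k * pois l k) = real (Suc k) * real (Suc k - 1) * pois l (Suc k)" ..
  qed
  finally have "(\<lambda>k. real (Suc k) * real (Suc k - 1) * pois l (Suc k)) sums (l * l)" .
  from sums_Suc[of "\<lambda>k. real k * real (k - 1) * pois l k", OF this] show ?thesis
    by (simp add: power2_eq_square)
qed

section \<open>Sums over a random index set and counts of centres\<close>

context cluster_process
begin

text \<open>The index set depends on \<open>w\<close>; moving it into the integrand gives a sum over
  a fixed countable set, as measurability and the exchange with the expectation require.\<close>

lemma idx_nn_integral: "(csum w (\<lambda>i. g i)) = (\<integral>\<^sup>+i. of_bool (i \<in> idx w) * g i \<partial>count_space UNIV)"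
  by (subst nn_integral_count_space_indicator) (auto intro!: nn_integral_cong simp: indicator_def)

lemma measurable_idx_nn_integral [measurable]:
  assumes [measurable]: "\<And>i. g i \<in> borel_measurable M"
  shows "(\<lambda>w. csum w (\<lambda>i. g i w)) \<in> borel_measurable M"
  unfolding idx_nn_integral nn_integral_count_space_nat by measurable

lemma idx_integral:
  assumes [measurable]: "\<And>i. g i \<in> borel_measurable M"
  shows "(\<integral>\<^sup>+w. (csum w (\<lambda>i. g i w)) \<partial>M) =
    (\<integral>\<^sup>+i. (\<integral>\<^sup>+w. of_bool (i \<in> idx w) * g i w \<partial>M) \<partial>count_space UNIV)"
  unfolding idx_nn_integral nn_integral_count_space_nat by (rule nn_integral_suminf) measurable

lemma idx_integral2:
  assumes [measurable]: "\<And>i j. h i j \<in> borel_measurable M"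
  shows "(\<integral>\<^sup>+w. (csum w (\<lambda>i. (csum w (\<lambda>j. h i j w)))) \<partial>M) =
    (\<integral>\<^sup>+i. (\<integral>\<^sup>+j. (\<integral>\<^sup>+w. of_bool (i \<in> idx w \<and> j \<in> idx w) * h i j w \<partial>M) \<partial>count_space UNIV) \<partial>count_space UNIV)"
proof -
  have "(\<integral>\<^sup>+w. (csum w (\<lambda>i. (csum w (\<lambda>j. h i j w)))) \<partial>M) =
    (\<integral>\<^sup>+i. (\<integral>\<^sup>+w. (csum w (\<lambda>j. of_bool (i \<in> idx w) * h i j w)) \<partial>M) \<partial>count_space UNIV)"
    by (subst idx_integral) (simp_all add: nn_integral_cmult)
  also have "\<dots> = (\<integral>\<^sup>+i. (\<integral>\<^sup>+j. (\<integral>\<^sup>+w. of_bool (j \<in> idx w) * (of_bool (i \<in> idx w) * h i j w) \<partial>M) \<partial>count_space UNIV) \<partial>count_space UNIV)"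
    by (intro nn_integral_cong idx_integral) measurable
  finally show ?thesis
    by (simp add: of_bool_conj mult_ac)
qed

lemma emeasure_ground:
  "B \<in> sets borel \<Longrightarrow> emeasure (H w) B = csum w (\<lambda>i. indicator B (Z i w))"
  by (simp add: ground_process_def emeasure_distr_count_space_nn_integral idx_def)

lemma measurable_emeasure_ground [measurable]:
  "B \<in> sets borel \<Longrightarrow> (\<lambda>w. emeasure (H w) B) \<in> borel_measurable M"
  by (simp add: emeasure_ground)

lemma ground_point_measure: "H w \<in> point_measures"
  by (simp add: ground_process_def distr_count_space_in_point_measures)

lemma ground_count_prob:
  assumes "B \<in> sets borel" "emeasure \<nu> B < \<infinity>"
  shows "emeasure M {w \<in> space M. emeasure (H w) B = of_nat k} = ennreal (pois (measure \<nu> B) k)"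
  using ground assms by (simp add: poisson_process_def emeasure_eq_measure pois_def \<nu>_def)

text \<open>The Poisson probabilities of the finite values already add up to 1, which excludes the
  value infinity.\<close>

lemma AE_ground_count:
  assumes B: "B \<in> sets borel" "emeasure \<nu> B < \<infinity>"
  shows "AE w in M. \<exists>k. emeasure (H w) B = of_nat k"
proof -
  let ?A = "\<lambda>k. {w \<in> space M. emeasure (H w) B = of_nat k}"
  have A [measurable]: "?A k \<in> sets M" for k using B by measurable
  have "disjoint_family ?A" by (auto simp: disjoint_family_on_def)
  then have "emeasure M (\<Union>k. ?A k) = (\<Sum>k. emeasure M (?A k))"
    by (intro suminf_emeasure[symmetric]) (use A in auto)
  also have "\<dots> = 1"
    unfolding ground_count_prob[OF B]
    by (subst suminf_ennreal_eq[OF _ pois_sums]) (simp_all add: pois_nonneg)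
  finally have "prob (\<Union>k. ?A k) = 1" by (simp add: measure_def)
  then have "AE w in M. w \<in> (\<Union>k. ?A k)" by (rule AE_prob_1)
  then show ?thesis by eventually_elim auto
qed

text \<open>Almost surely the count has one of countably many values, so \<open>g\<close> enters
  only through its values at natural numbers.\<close>

lemma nn_integral_ground_count:
  assumes B: "B \<in> sets borel" "emeasure \<nu> B < \<infinity>"
  shows "(\<integral>\<^sup>+w. g (emeasure (H w) B) \<partial>M) =
    (\<Sum>k. g (of_nat k) * ennreal (pois (measure \<nu> B) k))"
proof -
  let ?A = "\<lambda>k. {w \<in> space M. emeasure (H w) B = of_nat k}"
  have A [measurable]: "?A k \<in> sets M" for k using B by measurable
  have dj: "disjoint_family ?A" by (auto simp: disjoint_family_on_def)
  have "(\<integral>\<^sup>+w. g (emeasure (H w) B) \<partial>M) = (\<integral>\<^sup>+w. (\<Sum>k. g (of_nat k) * indicator (?A k) w) \<partial>M)"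
  proof (rule nn_integral_cong_AE)
    show "AE w in M. g (emeasure (H w) B) = (\<Sum>k. g (of_nat k) * indicator (?A k) w)"
      using AE_ground_count[OF B] AE_space
    proof eventually_elim
      case (elim w)
      then obtain k where k: "emeasure (H w) B = of_nat k" by auto
      then have "w \<in> ?A k" using elim by simp
      from suminf_cmult_indicator[OF dj this, of "\<lambda>k. g (of_nat k)"] k show ?case by simp
    qed
  qed
  also have "\<dots> = (\<Sum>k. \<integral>\<^sup>+w. g (of_nat k) * indicator (?A k) w \<partial>M)"
    by (rule nn_integral_suminf) measurable
  also have "\<dots> = (\<Sum>k. g (of_nat k) * ennreal (pois (measure \<nu> B) k))"
    using A by (simp add: nn_integral_cmult_indicator ground_count_prob[OF B])
  finally show ?thesis .
qed

lemma ground_mean: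
  assumes B: "B \<in> sets borel"
  shows "(\<integral>\<^sup>+w. emeasure (H w) B \<partial>M) = emeasure \<nu> B"
proof (cases "emeasure \<nu> B < \<infinity>")
  case True
  have "(\<integral>\<^sup>+w. emeasure (H w) B \<partial>M) = (\<Sum>k. of_nat k * ennreal (pois (measure \<nu> B) k))"
    using nn_integral_ground_count[OF B True, of "\<lambda>x. x"] .
  also have "\<dots> = (\<Sum>k. ennreal (real k * pois (measure \<nu> B) k))"
    by (simp add: ennreal_mult pois_nonneg ennreal_of_nat_eq_real_of_nat)
  also have "\<dots> = ennreal (measure \<nu> B)"
    by (intro suminf_ennreal_eq pois_mean_sums) (simp add: pois_nonneg)
  also have "\<dots> = emeasure \<nu> B" using True by (simp add: emeasure_eq_ennreal_measure)
  finally show ?thesis .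
next
  case False
  then have "emeasure \<nu> B = \<infinity>" by (simp add: less_top[symmetric])
  then have "AE w in M. emeasure (H w) B = \<infinity>"
    using ground B by (simp add: poisson_process_def \<nu>_def)
  then have "(\<integral>\<^sup>+w. emeasure (H w) B \<partial>M) = (\<integral>\<^sup>+w. \<infinity> \<partial>M)"
    by (rule nn_integral_cong_AE)
  then show ?thesis using \<open>emeasure \<nu> B = \<infinity>\<close> by (simp add: emeasure_space_1)
qed

text \<open>As a functional of \<open>f\<close>, the expected weighted sum over the centres is the
  integral against one measure: the weighted product of counting measure and \<open>M\<close>,
  pushed forward by the location. Identities for indicators thus extend at once to all nonnegative
  measurable \<open>f\<close>.\<close>

lemma weighted_ground_measure:
  assumes u [measurable]: "\<And>i. u i \<in> borel_measurable M"
  obtains \<kappa> where "sets \<kappa> = sets borel"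
    "\<And>f. f \<in> borel_measurable borel \<Longrightarrow>
      (\<integral>\<^sup>+z. f z \<partial>\<kappa>) = (\<integral>\<^sup>+w. (csum w (\<lambda>i. u i w * f (Z i w))) \<partial>M)"
proof -
  let ?d = "\<lambda>(i, w). of_bool (i \<in> idx w) * u i w"
  have d: "?d \<in> borel_measurable (count_space UNIV \<Otimes>\<^sub>M M)"
    by (intro measurable_pair_measure_countable1) auto
  have z: "(\<lambda>(i, w). Z i w) \<in> count_space UNIV \<Otimes>\<^sub>M M \<rightarrow>\<^sub>M borel"
    by (intro measurable_pair_measure_countable1) auto
  let ?\<kappa> = "distr (density (count_space UNIV \<Otimes>\<^sub>M M) ?d) borel (\<lambda>(i, w). Z i w)"
  show ?thesis
  proof (rule that)
    show "sets ?\<kappa> = sets borel" by simp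
    fix f :: "'a \<times> real \<Rightarrow> ennreal" assume f [measurable]: "f \<in> borel_measurable borel"
    have fz: "(\<lambda>x. f (case x of (i, w) \<Rightarrow> Z i w)) \<in> borel_measurable (count_space UNIV \<Otimes>\<^sub>M M)"
      using measurable_compose[OF z f] .
    have "(\<integral>\<^sup>+z. f z \<partial>?\<kappa>) = (\<integral>\<^sup>+x. ?d x * f (case x of (i, w) \<Rightarrow> Z i w) \<partial>(count_space UNIV \<Otimes>\<^sub>M M))"
      using d z fz f by (subst nn_integral_distr) (auto intro!: nn_integral_density)
    also have "\<dots> = (\<integral>\<^sup>+i. (\<integral>\<^sup>+w. of_bool (i \<in> idx w) * (u i w * f (Z i w)) \<partial>M) \<partial>count_space UNIV)"
      using d fz by (subst nn_integral_fst[symmetric]) (auto simp: mult.assoc)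
    also have "\<dots> = (\<integral>\<^sup>+w. (csum w (\<lambda>i. u i w * f (Z i w))) \<partial>M)"
      by (rule idx_integral[symmetric]) measurable
    finally show "(\<integral>\<^sup>+z. f z \<partial>?\<kappa>) = (\<integral>\<^sup>+w. (csum w (\<lambda>i. u i w * f (Z i w))) \<partial>M)" .
  qed
qed

lemma ground_campbell:
  assumes f: "f \<in> borel_measurable borel"
  shows "(\<integral>\<^sup>+w. (csum w (\<lambda>i. f (Z i w))) \<partial>M) = (\<integral>\<^sup>+z. f z \<partial>\<nu>)"
proof -
  obtain \<kappa> where \<kappa>: "sets \<kappa> = sets borel"
    "\<And>f. f \<in> borel_measurable borel \<Longrightarrow>
      (\<integral>\<^sup>+z. f z \<partial>\<kappa>) = (\<integral>\<^sup>+w. (csum w (\<lambda>i. 1 * f (Z i w))) \<partial>M)"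
    by (rule weighted_ground_measure[of "\<lambda>_ _. 1"]) auto
  have "\<kappa> = \<nu>"
  proof (rule measure_eqI)
    fix B assume "B \<in> sets \<kappa>"
    then have B: "B \<in> sets borel" by (simp add: \<kappa>)
    then have "emeasure \<kappa> B = (\<integral>\<^sup>+z. indicator B z \<partial>\<kappa>)" by (simp add: \<kappa>)
    also have "\<dots> = emeasure \<nu> B"
      using B by (subst \<kappa>) (simp_all add: emeasure_ground[symmetric] ground_mean)
    finally show "emeasure \<kappa> B = emeasure \<nu> B" .
  qed (simp add: \<kappa>)
  then show ?thesis using \<kappa>(2)[OF f] by simp
qed

lemma measurable_ground_distinct_pairs:
  assumes [measurable]: "B1 \<in> sets borel" "B2 \<in> sets borel"
  shows "(\<lambda>w. distinct_pairs (H w) (B1 \<times> B2)) \<in> borel_measurable M"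
  unfolding ground_process_def idx_def[symmetric] distinct_pairs_nn_integral[OF countableI_type] indicator_times
  by measurable

lemma ground_indep:
  assumes "\<forall>k<n. B k \<in> sets borel" "disjoint_family_on B {..<n::nat}"
  shows "indep_vars (\<lambda>_. borel) (\<lambda>k w. emeasure (H w) (B k)) {..<n}"
  using ground[unfolded poisson_process_def, THEN conjunct2, THEN conjunct2, THEN conjunct2,
      THEN spec, of n, THEN spec, of B] assms by simp

text \<open>Disjoint sets have no diagonal, so the pair count is a product of two independent
  counts.\<close>

lemma ground_pairs_disjoint:
  assumes B: "B1 \<in> sets borel" "B2 \<in> sets borel" "B1 \<inter> B2 = {}"
  shows "(\<integral>\<^sup>+w. distinct_pairs (H w) (B1 \<times> B2) \<partial>M) = emeasure \<nu> B1 * emeasure \<nu> B2"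
proof -
  let ?B = "\<lambda>k::nat. if k = 0 then B1 else B2"
  have "disjoint_family_on ?B {..<2}" using B by (auto simp: disjoint_family_on_def)
  moreover have "\<forall>k<2. ?B k \<in> sets borel" using B by auto
  ultimately have "indep_vars (\<lambda>_. borel) (\<lambda>k w. emeasure (H w) (?B k)) {..<2}"
    by (intro ground_indep) auto
  from indep_vars_nn_integral[OF _ this]
  have "(\<integral>\<^sup>+w. emeasure (H w) B1 * emeasure (H w) B2 \<partial>M) = emeasure \<nu> B1 * emeasure \<nu> B2"
    using B by (simp add: lessThan_Suc numeral_2_eq_2 ground_mean mult.commute)
  moreover have "distinct_pairs (H w) (B1 \<times> B2) =
      emeasure (H w) B1 * emeasure (H w) B2" for w
    using distinct_pairs_plus_diagonal[OF ground_point_measure B(1,2), of w] B(3) by simp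
  ultimately show ?thesis by simp
qed

text \<open>A count X contributes X(X - 1) pairs, and the second factorial moment of a Poisson
  variable is the square of its parameter.\<close>

lemma ground_pairs_diagonal:
  assumes B: "B \<in> sets borel" "emeasure \<nu> B < \<infinity>"
  shows "(\<integral>\<^sup>+w. distinct_pairs (H w) (B \<times> B) \<partial>M) = emeasure \<nu> B * emeasure \<nu> B"
proof -
  let ?X = "\<lambda>w. emeasure (H w) B"
  have "(\<integral>\<^sup>+w. distinct_pairs (H w) (B \<times> B) \<partial>M) = (\<integral>\<^sup>+w. ?X w * ?X w - ?X w \<partial>M)"
  proof (rule nn_integral_cong_AE)
    show "AE w in M. distinct_pairs (H w) (B \<times> B) = ?X w * ?X w - ?X w"
      using AE_ground_count[OF B]
    proof eventually_elim
      case (elim w)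
      then have "?X w \<noteq> top" by auto
      then show ?case
        using distinct_pairs_plus_diagonal[OF ground_point_measure B(1,1), of w]
        by (metis Int_absorb ennreal_add_diff_cancel_right)
    qed
  qed
  also have "\<dots> = (\<Sum>k. (of_nat k * of_nat k - of_nat k) * ennreal (pois (measure \<nu> B) k))"
    using nn_integral_ground_count[OF B, of "\<lambda>x. x * x - x"] .
  also have "\<dots> = (\<Sum>k. ennreal (real k * real (k - 1) * pois (measure \<nu> B) k))"
  proof (intro suminf_cong)
    fix k :: nat
    \<comment> \<open>The truncated subtraction loses nothing, since a natural number never exceeds
      its square.\<close>
    have "(of_nat k * of_nat k - of_nat k :: ennreal) = of_nat (k * k - k)"
      by (simp add: ennreal_of_nat_eq_real_of_nat ennreal_mult[symmetric] ennreal_minus del: of_nat_mult)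
        (simp add: of_nat_diff)
    also have "k * k - k = k * (k - 1)" by (simp add: diff_mult_distrib2)
    finally show "(of_nat k * of_nat k - of_nat k) * ennreal (pois (measure \<nu> B) k) =
       ennreal (real k * real (k - 1) * pois (measure \<nu> B) k)"
      by (simp add: ennreal_mult pois_nonneg ennreal_of_nat_eq_real_of_nat)
  qed
  also have "\<dots> = ennreal ((measure \<nu> B)\<^sup>2)"
    by (intro suminf_ennreal_eq pois_factorial_sums) (simp add: pois_nonneg)
  also have "\<dots> = emeasure \<nu> B * emeasure \<nu> B"
    using B by (simp add: emeasure_eq_ennreal_measure power2_eq_square ennreal_mult)
  finally show ?thesis .
qed

lemma ground_pairs_rectangle:
  assumes B: "B1 \<in> sets borel" "B2 \<in> sets borel" "emeasure \<nu> B1 < \<infinity>" "emeasure \<nu> B2 < \<infinity>"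
  shows "(\<integral>\<^sup>+w. distinct_pairs (H w) (B1 \<times> B2) \<partial>M) = emeasure \<nu> B1 * emeasure \<nu> B2"
proof -
  let ?D = "B1 \<inter> B2" and ?d = "\<lambda>w. distinct_pairs (H w)"
  have D: "?D \<in> sets borel" "B1 - B2 \<in> sets borel" "B2 - B1 \<in> sets borel" using B by auto
  have finD: "emeasure \<nu> ?D < \<infinity>"
    using emeasure_mono[of ?D B1 \<nu>] B by (simp add: le_less_trans)
  \<comment> \<open>The rectangle splits into a square, where the factorial moment applies, and two
    rectangles with disjoint sides, where independence applies.\<close>
  have split: "?d w (B1 \<times> B2) = ?d w ((B1 - B2) \<times> B2) + (?d w (?D \<times> ?D) + ?d w (?D \<times> (B2 - B1)))" for w
  proof -
    have "B1 \<times> B2 = (B1 - B2) \<times> B2 \<union> (?D \<times> ?D \<union> ?D \<times> (B2 - B1))" by auto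
    then have "?d w (B1 \<times> B2) = ?d w ((B1 - B2) \<times> B2 \<union> (?D \<times> ?D \<union> ?D \<times> (B2 - B1)))" by (rule arg_cong)
    also have "\<dots> = ?d w ((B1 - B2) \<times> B2) + ?d w (?D \<times> ?D \<union> ?D \<times> (B2 - B1))"
      by (intro distinct_pairs_add ground_point_measure) auto
    also have "?d w (?D \<times> ?D \<union> ?D \<times> (B2 - B1)) = ?d w (?D \<times> ?D) + ?d w (?D \<times> (B2 - B1))"
      by (intro distinct_pairs_add ground_point_measure) auto
    finally show ?thesis .
  qed
  have "(\<integral>\<^sup>+w. ?d w (B1 \<times> B2) \<partial>M) = (\<integral>\<^sup>+w. ?d w ((B1 - B2) \<times> B2) \<partial>M) +
     ((\<integral>\<^sup>+w. ?d w (?D \<times> ?D) \<partial>M) + (\<integral>\<^sup>+w. ?d w (?D \<times> (B2 - B1)) \<partial>M))"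
    unfolding split using B D
    by (subst nn_integral_add) (auto intro!: borel_measurable_add measurable_ground_distinct_pairs
        arg_cong2[where f="(+)"] nn_integral_add)
  also have "\<dots> = emeasure \<nu> (B1 - B2) * emeasure \<nu> B2 + (emeasure \<nu> ?D * emeasure \<nu> ?D + emeasure \<nu> ?D * emeasure \<nu> (B2 - B1))"
    using B D finD by (subst (1 2) ground_pairs_disjoint) (auto simp: ground_pairs_diagonal)
  also have "\<dots> = emeasure \<nu> (B1 - B2) * emeasure \<nu> B2 + emeasure \<nu> ?D * (emeasure \<nu> ?D + emeasure \<nu> (B2 - B1))"
    by (simp add: distrib_left)
  also have "emeasure \<nu> ?D + emeasure \<nu> (B2 - B1) = emeasure \<nu> B2"
    using B D by (subst plus_emeasure) (auto intro!: arg_cong[where f="emeasure \<nu>"])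
  also have "emeasure \<nu> (B1 - B2) * emeasure \<nu> B2 + emeasure \<nu> ?D * emeasure \<nu> B2 =
      (emeasure \<nu> (B1 - B2) + emeasure \<nu> ?D) * emeasure \<nu> B2" by (simp add: distrib_right)
  also have "emeasure \<nu> (B1 - B2) + emeasure \<nu> ?D = emeasure \<nu> B1"
    using B D by (subst plus_emeasure) (auto intro!: arg_cong[where f="emeasure \<nu>"])
  finally show ?thesis .
qed

text \<open>Rectangles of finite measure determine the second factorial moment measure; the two
  factors are extended to general functions separately.\<close>

lemma ground_campbell_pairs:
  assumes f [measurable]: "f \<in> borel_measurable borel" and g [measurable]: "g \<in> borel_measurable borel"
  shows "(\<integral>\<^sup>+w. (csum w (\<lambda>i. (csum w (\<lambda>j. of_bool (i \<noteq> j) * (f (Z i w) * g (Z j w)))))) \<partial>M)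
    = (\<integral>\<^sup>+z. f z \<partial>\<nu>) * (\<integral>\<^sup>+z. g z \<partial>\<nu>)"
proof -
  let ?\<Phi> = "\<lambda>f g. (\<integral>\<^sup>+w. (csum w (\<lambda>i. (csum w (\<lambda>j. of_bool (i \<noteq> j) * (f (Z i w) * g (Z j w)))))) \<partial>M)"
  \<comment> \<open>With an indicator as second factor, the weight at a centre is the number of
    other centres in \<open>B2\<close>.\<close>
  have first: "?\<Phi> f (indicator B2) = (\<integral>\<^sup>+z. f z \<partial>\<nu>) * emeasure \<nu> B2"
    if B2 [measurable]: "B2 \<in> sets borel" "emeasure \<nu> B2 < \<infinity>" and f [measurable]: "f \<in> borel_measurable borel" for B2 f
  proof -
    have u: "(\<lambda>w. csum w (\<lambda>j. of_bool (i \<noteq> j) * indicator B2 (Z j w))) \<in> borel_measurable M" for i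
      by measurable
    obtain \<kappa> where \<kappa>: "sets \<kappa> = sets borel"
      "\<And>f. f \<in> borel_measurable borel \<Longrightarrow> (\<integral>\<^sup>+z. f z \<partial>\<kappa>) =
         (\<integral>\<^sup>+w. (csum w (\<lambda>i. (csum w (\<lambda>j. of_bool (i \<noteq> j) * indicator B2 (Z j w))) * f (Z i w))) \<partial>M)"
      by (rule weighted_ground_measure[of "\<lambda>i w. csum w (\<lambda>j. of_bool (i \<noteq> j) * indicator B2 (Z j w))"])
        (use u in auto)
    have \<kappa>\<Phi>: "(\<integral>\<^sup>+z. f z \<partial>\<kappa>) = ?\<Phi> f (indicator B2)" if "f \<in> borel_measurable borel" for f
      unfolding \<kappa>(2)[OF that]
      by (intro nn_integral_cong, subst nn_integral_multc[symmetric], simp, intro nn_integral_cong)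
        (simp add: mult_ac)
    have "\<kappa> = density \<nu> (\<lambda>_. emeasure \<nu> B2)"
    proof (rule measure_eqI_finite_sets[OF \<nu>.sigma_finite_measure_axioms])
      fix B1 assume "B1 \<in> sets \<nu>" "emeasure \<nu> B1 < \<infinity>"
      then have B1: "B1 \<in> sets borel" "emeasure \<nu> B1 < \<infinity>" by auto
      have "emeasure \<kappa> B1 = ?\<Phi> (indicator B1) (indicator B2)"
        using B1 \<kappa> by (simp flip: \<kappa>\<Phi>)
      also have "\<dots> = (\<integral>\<^sup>+w. distinct_pairs (H w) (B1 \<times> B2) \<partial>M)"
        unfolding ground_process_def idx_def[symmetric] distinct_pairs_nn_integral[OF countableI_type] indicator_times
        by simp
      also have "\<dots> = emeasure \<nu> B1 * emeasure \<nu> B2"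
        by (intro ground_pairs_rectangle B1 B2)
      finally show "emeasure \<kappa> B1 = emeasure (density \<nu> (\<lambda>_. emeasure \<nu> B2)) B1"
        using B1 by (simp add: emeasure_density_const mult.commute)
    qed (simp_all add: \<kappa>)
    then show ?thesis
      using f by (simp flip: \<kappa>\<Phi>) (simp add: nn_integral_density nn_integral_multc mult.commute)
  qed
  \<comment> \<open>Now the roles change: \<open>f\<close> is fixed, and the weight at centre
    \<open>j\<close> is the sum of \<open>f\<close> over the other centres. The integral of
    \<open>f\<close> may be infinite, which the comparison on sets of finite
    \<open>\<nu>\<close>-measure tolerates.\<close>
  have u: "(\<lambda>w. csum w (\<lambda>i. of_bool (i \<noteq> j) * f (Z i w))) \<in> borel_measurable M" for j
    by measurable
  obtain \<kappa> where \<kappa>: "sets \<kappa> = sets borel"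
    "\<And>g. g \<in> borel_measurable borel \<Longrightarrow> (\<integral>\<^sup>+z. g z \<partial>\<kappa>) =
       (\<integral>\<^sup>+w. (csum w (\<lambda>j. (csum w (\<lambda>i. of_bool (i \<noteq> j) * f (Z i w))) * g (Z j w))) \<partial>M)"
    by (rule weighted_ground_measure[of "\<lambda>j w. csum w (\<lambda>i. of_bool (i \<noteq> j) * f (Z i w))"])
      (use u in auto)
  have \<kappa>\<Phi>: "(\<integral>\<^sup>+z. g z \<partial>\<kappa>) = ?\<Phi> f g" if "g \<in> borel_measurable borel" for g
  proof -
    have "(\<integral>\<^sup>+z. g z \<partial>\<kappa>) = (\<integral>\<^sup>+w. (csum w (\<lambda>j. (csum w (\<lambda>i. of_bool (i \<noteq> j) * (f (Z i w) * g (Z j w)))))) \<partial>M)"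
      unfolding \<kappa>(2)[OF that]
      by (intro nn_integral_cong, subst nn_integral_multc[symmetric], simp, intro nn_integral_cong)
        (simp add: mult_ac)
    also have "\<dots> = ?\<Phi> f g"
      by (intro nn_integral_cong nn_integral_count_space_nn_integral) auto
    finally show ?thesis .
  qed
  have "\<kappa> = density \<nu> (\<lambda>_. \<integral>\<^sup>+z. f z \<partial>\<nu>)"
  proof (rule measure_eqI_finite_sets[OF \<nu>.sigma_finite_measure_axioms])
    fix B2 assume "B2 \<in> sets \<nu>" "emeasure \<nu> B2 < \<infinity>"
    then have B2: "B2 \<in> sets borel" "emeasure \<nu> B2 < \<infinity>" by auto
    have "emeasure \<kappa> B2 = ?\<Phi> f (indicator B2)"
      using B2 \<kappa> by (simp flip: \<kappa>\<Phi>)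
    also have "\<dots> = (\<integral>\<^sup>+z. f z \<partial>\<nu>) * emeasure \<nu> B2" by (rule first[OF B2 f])
    finally show "emeasure \<kappa> B2 = emeasure (density \<nu> (\<lambda>_. \<integral>\<^sup>+z. f z \<partial>\<nu>)) B2"
      using B2 by (simp add: emeasure_density_const)
  qed (simp_all add: \<kappa>)
  then show ?thesis
    using g by (simp flip: \<kappa>\<Phi>) (simp add: nn_integral_density nn_integral_cmult)
qed

section \<open>Campbell formulas for the clusters\<close>

lemma cluster_campbell:
  assumes f [measurable]: "f \<in> borel_measurable counting_algebra"
  shows "(\<integral>\<^sup>+w. (csum w (\<lambda>i. f (C i w))) \<partial>M) = (\<integral>\<^sup>+z. cluster_mean f z \<partial>\<nu>)"
proof -
  have "(\<integral>\<^sup>+w. (csum w (\<lambda>i. f (C i w))) \<partial>M) =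
     (\<integral>\<^sup>+w. (csum w (\<lambda>i. cluster_mean f (Z i w))) \<partial>M)"
    by (subst (1 2) idx_integral) (auto simp: cluster_single)
  then show ?thesis by (simp add: ground_campbell)
qed

text \<open>Two different clusters are conditionally independent, so each can be replaced by its
  kernel mean; the diagonal, where this fails, is cut out by the factor
  \<open>of_bool (i \<noteq> j)\<close>.\<close>

lemma cluster_campbell_pairs:
  assumes f [measurable]: "f \<in> borel_measurable counting_algebra"
    and g [measurable]: "g \<in> borel_measurable counting_algebra"
  shows "(\<integral>\<^sup>+w. (csum w (\<lambda>i. (csum w (\<lambda>j. of_bool (i \<noteq> j) * (f (C i w) * g (C j w)))))) \<partial>M)
    = (\<integral>\<^sup>+z. cluster_mean f z \<partial>\<nu>) * (\<integral>\<^sup>+z. cluster_mean g z \<partial>\<nu>)"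
proof -
  have "(\<integral>\<^sup>+w. of_bool (i \<in> idx w \<and> j \<in> idx w) * (of_bool (i \<noteq> j) * (f (C i w) * g (C j w))) \<partial>M) =
    (\<integral>\<^sup>+w. of_bool (i \<in> idx w \<and> j \<in> idx w) * (of_bool (i \<noteq> j) * (cluster_mean f (Z i w) * cluster_mean g (Z j w))) \<partial>M)" for i j
    using cluster_pair[OF f g, of i j] by (cases "i = j") simp_all
  then have "(\<integral>\<^sup>+w. (csum w (\<lambda>i. (csum w (\<lambda>j. of_bool (i \<noteq> j) * (f (C i w) * g (C j w)))))) \<partial>M)
   = (\<integral>\<^sup>+w. (csum w (\<lambda>i. (csum w (\<lambda>j. of_bool (i \<noteq> j) * (cluster_mean f (Z i w) * cluster_mean g (Z j w)))))) \<partial>M)"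
    by (subst (1 2) idx_integral2) auto
  then show ?thesis by (simp add: ground_campbell_pairs)
qed

end

section \<open>Laplace functionals and laws of point processes\<close>

text \<open>The value 0 at infinity makes exp(-x) continuous and multiplicative on the whole of
  [0,\<infinity>], so Laplace functionals make sense for infinite counts.\<close>

definition expneg :: "ennreal \<Rightarrow> ennreal" where
  "expneg x = (if x = \<infinity> then 0 else ennreal (exp (- enn2real x)))"

lemma expneg_0 [simp]: "expneg 0 = 1" by (simp add: expneg_def)

lemma expneg_le_1: "expneg x \<le> 1"
  by (auto simp: expneg_def ennreal_le_1)

lemma expneg_ennreal: "0 \<le> r \<Longrightarrow> expneg (ennreal r) = ennreal (exp (- r))"
  by (simp add: expneg_def)

lemma expneg_add: "expneg (x + y) = expneg x * expneg y"
  by (cases x; cases y) (auto simp: expneg_def enn2real_plus mult_exp_exp ennreal_mult[symmetric] simp flip: ennreal_plus)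

lemma expneg_sum: "finite I \<Longrightarrow> expneg (\<Sum>i\<in>I. f i) = (\<Prod>i\<in>I. expneg (f i))"
  by (induction I rule: finite_induct) (auto simp: expneg_add)

lemma measurable_expneg [measurable]: "expneg \<in> borel_measurable borel"
  unfolding expneg_def[abs_def] by measurable

lemma tendsto_expneg:
  assumes u: "(u \<longlongrightarrow> l) F"
  shows "((\<lambda>n. expneg (u n)) \<longlongrightarrow> expneg l) F"
proof (cases "l = \<infinity>")
  case False
  then obtain r where r: "l = ennreal r" "0 \<le> r" by (cases l) auto
  then have "((\<lambda>n. enn2real (u n)) \<longlongrightarrow> r) F"
    using u by (intro tendsto_enn2real) auto
  then have "((\<lambda>n. ennreal (exp (- enn2real (u n)))) \<longlongrightarrow> ennreal (exp (- r))) F"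
    by (intro tendsto_ennrealI tendsto_exp tendsto_minus)
  moreover have "\<forall>\<^sub>F n in F. ennreal (exp (- enn2real (u n))) = expneg (u n)"
    using order_tendstoD(2)[OF u, of top] False
    by (auto simp: less_top expneg_def elim!: eventually_mono)
  ultimately show ?thesis
    using r by (simp add: expneg_ennreal tendsto_cong)
next
  case True
  show ?thesis
  proof (rule order_tendstoI)
    fix a assume "expneg l < a"
    then have a: "0 < a" using True by (simp add: expneg_def)
    \<comment> \<open>Truncation at 1 keeps the threshold finite, so that -ln r is a real level
      beyond which \<open>expneg\<close> drops below r.\<close>
    define r where "r = enn2real (min a 1)"
    have r: "0 < r" "ennreal r \<le> a"
      using a by (auto simp: r_def enn2real_positive_iff min_def split: if_splits)
         (metis ennreal_enn2real_if ennreal_one_less_top le_less_trans linear less_top order_refl)+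
    have "\<forall>\<^sub>F n in F. ennreal (max 0 (- ln r)) < u n"
      using True by (intro order_tendstoD(1)[OF u]) auto
    then show "\<forall>\<^sub>F n in F. expneg (u n) < a"
    proof eventually_elim
      case (elim n)
      show ?case
      proof (cases "u n")
        case (real q)
        with elim have "ennreal (max 0 (- ln r)) < ennreal q" by (simp only:)
        then have "max 0 (- ln r) < q" by (subst (asm) ennreal_less_iff) auto
        then have "- ln r < q" by simp
        then have "exp (- q) < r" using r by (metis exp_less_cancel_iff exp_ln minus_less_iff)
        then have "ennreal (exp (- q)) < ennreal r" using r by (simp add: ennreal_less_iff)
        then show ?thesis using r real by (simp add: expneg_ennreal)
      qed (use a in \<open>simp add: expneg_def\<close>)
    qed
  qed (use True in \<open>simp add: expneg_def\<close>)
qed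

text \<open>A right inverse of \<open>expneg\<close> on [0,1], the range of the Laplace transforms
  of clusters; it lets a product over centres be written as the exponential of a sum.\<close>

definition neglog :: "ennreal \<Rightarrow> ennreal" where
  "neglog x = (if x = 0 then \<infinity> else ennreal (- ln (enn2real x)))"

lemma measurable_neglog [measurable]: "neglog \<in> borel_measurable borel"
  unfolding neglog_def[abs_def] by measurable

lemma expneg_neglog:
  assumes "x \<le> 1" shows "expneg (neglog x) = x"
proof (cases "x = 0")
  case False
  have "x \<noteq> top" using assms by (auto simp: top_unique)
  then obtain r where r: "x = ennreal r" "0 \<le> r" by (cases x) auto
  with False assms have "0 < r" "r \<le> 1" by (auto simp: less_le)
  then have "neglog x = ennreal (- ln r)" "0 \<le> - ln r"
    using r by (auto simp: neglog_def)
  then show ?thesis using r \<open>0 < r\<close> by (simp add: expneg_ennreal)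
qed (simp add: neglog_def expneg_def)

text \<open>Once the lower coefficients agree, the difference series can be divided by z^m; letting
  z tend to 0 isolates the next coefficient. The bound on the coefficients provides convergence in
  the open unit interval.\<close>

lemma powser_eq_on_unit_interval:
  fixes a b :: "nat \<Rightarrow> real"
  assumes bd: "\<And>n. \<bar>a n\<bar> \<le> 1" "\<And>n. \<bar>b n\<bar> \<le> 1"
    and eq: "\<And>z. 0 < z \<Longrightarrow> z < 1 \<Longrightarrow> (\<Sum>n. a n * z ^ n) = (\<Sum>n. b n * z ^ n)"
  shows "a m = b m"
proof (induction m rule: less_induct)
  case (less m)
  define d where "d n = a n - b n" for n
  have summ: "summable (\<lambda>n. c n * z ^ n)" if "\<bar>z\<bar> < 1" "\<And>n. \<bar>c n\<bar> \<le> 2" for c :: "nat \<Rightarrow> real" and z :: real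
  proof (rule summable_comparison_test')
    show "summable (\<lambda>n. 2 * \<bar>z\<bar> ^ n)" using that by (intro summable_mult summable_geometric) simp
    show "norm (c n * z ^ n) \<le> 2 * \<bar>z\<bar> ^ n" for n
      using that(2)[of n] by (simp add: abs_mult power_abs mult_right_mono)
  qed
  \<comment> \<open>The difference of two coefficients of modulus at most 1 has modulus at most 2,
    which is the constant allowed in \<open>summ\<close>.\<close>
  have d2: "\<bar>d n\<bar> \<le> 2" for n using bd[of n] by (simp add: d_def)
  define g where "g z = (\<Sum>n. d (n + m) * z ^ n)" for z
  have gs: "(\<lambda>n. d (n + m) * z ^ n) sums g z" if "\<bar>z\<bar> < 1" for z
    unfolding g_def using that d2 by (intro summable_sums summ) auto
  have lim: "(g \<longlongrightarrow> d (0 + m)) (at 0)"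
    by (rule powser_limit_0[of 1]) (use gs in auto)
  have g0: "g z = 0" if z: "0 < z" "z < 1" for z
  proof -
    have "(\<Sum>n. d n * z ^ n) = (\<Sum>n. a n * z ^ n) - (\<Sum>n. b n * z ^ n)"
      unfolding d_def left_diff_distrib
      using z order_trans[OF bd(1), of 2] order_trans[OF bd(2), of 2]
      by (intro suminf_diff[symmetric] summ) auto
    then have "(\<Sum>n. d n * z ^ n) = 0" using eq[OF z] by simp
    moreover have "(\<Sum>n. d n * z ^ n) = (\<Sum>n. d (n + m) * z ^ (n + m)) + (\<Sum>n<m. d n * z ^ n)"
      using z d2 by (intro suminf_split_initial_segment summ) auto
    moreover have "(\<Sum>n<m. d n * z ^ n) = 0"
      using less by (intro sum.neutral) (auto simp: d_def)
    moreover have "(\<Sum>n. d (n + m) * z ^ (n + m)) = g z * z ^ m"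
    proof -
      have "(\<lambda>n. d (n + m) * z ^ n * z ^ m) sums (g z * z ^ m)"
        using z by (intro sums_mult2 gs) auto
      then show ?thesis by (simp add: power_add mult.assoc sums_unique[symmetric])
    qed
    ultimately show ?thesis using z by simp
  qed
  \<comment> \<open>The series is known to vanish for positive z, so the limit at 0 is compared from
    the right.\<close>
  have "\<forall>\<^sub>F z in at_right (0::real). g z = 0"
    using eventually_at_right_less[of "0::real"] g0
    by (subst eventually_at_right[of 0 1]) (auto intro!: exI[of _ 1])
  then have "(g \<longlongrightarrow> 0) (at_right 0)" by (rule tendsto_eventually)
  moreover have "(g \<longlongrightarrow> d m) (at_right 0)"
    using lim by (simp add: filterlim_at_split)
  ultimately have "d m = 0"
    using tendsto_unique trivial_limit_at_right_real by blast
  then show ?case by (simp add: d_def)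
qed

text \<open>With z = exp(-c), both sides are power series in z whose coefficients are the weighted
  probabilities of the finite counts; infinite counts contribute nothing as c > 0. The weights
  \<open>V\<close> and \<open>W\<close> carry events about other counts, so that the result can be
  iterated.\<close>

lemma (in prob_space) generating_function_unique:
  assumes [measurable]: "V \<in> borel_measurable M" "W \<in> borel_measurable M"
      "x \<in> borel_measurable M" "y \<in> borel_measurable M"
    and le: "\<And>w. V w \<le> 1" "\<And>w. W w \<le> 1"
    and val: "\<And>w. w \<in> space M \<Longrightarrow> x w = \<infinity> \<or> (\<exists>n::nat. x w = of_nat n)"
      "\<And>w. w \<in> space M \<Longrightarrow> y w = \<infinity> \<or> (\<exists>n::nat. y w = of_nat n)"
    and eq: "\<And>c. 0 < c \<Longrightarrow> (\<integral>\<^sup>+w. V w * expneg (ennreal c * x w) \<partial>M) = (\<integral>\<^sup>+w. W w * expneg (ennreal c * y w) \<partial>M)"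
  shows "(\<integral>\<^sup>+w. V w * of_bool (x w = of_nat m) \<partial>M) = (\<integral>\<^sup>+w. W w * of_bool (y w = of_nat m) \<partial>M)"
proof -
  define a where "a V x m = (\<integral>\<^sup>+w. V w * of_bool (x w = of_nat m) \<partial>M)" for V :: "'a \<Rightarrow> ennreal" and x :: "'a \<Rightarrow> ennreal" and m :: nat
  have a1: "a V x m \<le> 1" if "\<And>w. V w \<le> 1" for V x m
  proof -
    have "a V x m \<le> (\<integral>\<^sup>+w. 1 \<partial>M)"
      unfolding a_def using that by (intro nn_integral_mono) auto
    then show ?thesis by (simp add: emeasure_space_1)
  qed
  have a_real: "a V x m = ennreal (enn2real (a V x m))" "enn2real (a V x m) \<le> 1" if "\<And>w. V w \<le> 1" for V x m
  proof -
    have le: "a V x m \<le> 1" using that by (rule a1)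
    then have "a V x m < top" using le_less_trans ennreal_one_less_top by blast
    then show "a V x m = ennreal (enn2real (a V x m))" by simp
    show "enn2real (a V x m) \<le> 1" using le by (intro enn2real_leI) auto
  qed
  have summ: "summable (\<lambda>m. enn2real (a V x m) * z ^ m)"
    if V: "\<And>w. V w \<le> 1" and z: "0 < z" "z < 1" for V x z
  proof (rule summable_comparison_test')
    show "summable (\<lambda>m. z ^ m)" using z by (intro summable_geometric) simp
    show "norm (enn2real (a V x m) * z ^ m) \<le> z ^ m" for m
    proof -
      have "enn2real (a V x m) \<le> 1" by (rule a_real(2)[OF V])
      then show ?thesis using z by (simp add: abs_mult mult_left_le_one_le)
    qed
  qed
  have expand: "(\<integral>\<^sup>+w. V w * expneg (ennreal (- ln z) * x w) \<partial>M) = ennreal (\<Sum>m. enn2real (a V x m) * z ^ m)"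
    if [measurable]: "V \<in> borel_measurable M" "x \<in> borel_measurable M" and V: "\<And>w. V w \<le> 1"
      and val: "\<And>w. w \<in> space M \<Longrightarrow> x w = \<infinity> \<or> (\<exists>n::nat. x w = of_nat n)"
      and z: "0 < z" "z < 1" for V x z
  proof -
    have lnz: "0 < - ln z" using z by simp
    have ez: "expneg (ennreal (- ln z) * of_nat n) = ennreal (z ^ n)" for n
    proof -
      have "ennreal (- ln z) * of_nat n = ennreal (- ln z * real n)"
        by (subst ennreal_mult) (use lnz in \<open>simp_all add: ennreal_of_nat_eq_real_of_nat\<close>)
      moreover have "exp (ln z * real n) = z ^ n" using z
        by (metis exp_ln exp_of_nat2_mult)
      moreover have "0 \<le> - ln z * real n" using lnz by (intro mult_nonneg_nonneg) auto
      ultimately show ?thesis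
        by (subst \<open>ennreal (- ln z) * of_nat n = _\<close>, subst expneg_ennreal) simp_all
    qed
    have "(\<integral>\<^sup>+w. V w * expneg (ennreal (- ln z) * x w) \<partial>M) =
      (\<integral>\<^sup>+w. (\<Sum>m. V w * of_bool (x w = of_nat m) * ennreal (z ^ m)) \<partial>M)"
    proof (intro nn_integral_cong)
      fix w assume "w \<in> space M"
      from val[OF this] show "V w * expneg (ennreal (- ln z) * x w) = (\<Sum>m. V w * of_bool (x w = of_nat m) * ennreal (z ^ m))"
      proof
        assume "x w = \<infinity>"
        then show ?thesis using lnz by (simp add: expneg_def ennreal_mult_eq_top_iff ennreal_mult_top)
      next
        assume "\<exists>n::nat. x w = of_nat n"
        then obtain n where n: "x w = of_nat n" ..
        have "(\<Sum>m. V w * of_bool (x w = of_nat m) * ennreal (z ^ m)) =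
           (\<Sum>m\<in>{n}. V w * of_bool (x w = of_nat m) * ennreal (z ^ m))"
          by (rule suminf_finite) (auto simp: n)
        then show ?thesis by (simp add: n ez)
      qed
    qed
    also have "\<dots> = (\<Sum>m. a V x m * ennreal (z ^ m))"
      unfolding a_def by (subst nn_integral_suminf) (auto simp: nn_integral_multc)
    also have "\<dots> = (\<Sum>m. ennreal (enn2real (a V x m) * z ^ m))"
      using z by (intro suminf_cong) (subst a_real(1)[OF V], simp add: ennreal_mult)
    also have "\<dots> = ennreal (\<Sum>m. enn2real (a V x m) * z ^ m)"
    proof (rule suminf_ennreal2)
      show "summable (\<lambda>m. enn2real (a V x m) * z ^ m)" using V z by (rule summ)
    qed (use z in simp)
    finally show ?thesis .
  qed
  have "enn2real (a V x m) = enn2real (a W y m)"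
  proof (rule powser_eq_on_unit_interval)
    show "\<bar>enn2real (a V x n)\<bar> \<le> 1" "\<bar>enn2real (a W y n)\<bar> \<le> 1" for n
      using a_real(2) le by auto
    fix z :: real assume z: "0 < z" "z < 1"
    have nn: "0 \<le> (\<Sum>m. enn2real (a V x m) * z ^ m)" if "\<And>w. V w \<le> 1" for V x
    proof (rule suminf_nonneg)
      show "summable (\<lambda>m. enn2real (a V x m) * z ^ m)" using that z by (rule summ)
    qed (use z in simp)
    have "ennreal (\<Sum>m. enn2real (a V x m) * z ^ m) = ennreal (\<Sum>m. enn2real (a W y m) * z ^ m)"
      using eq[of "- ln z"] z expand[OF assms(1,3) le(1) val(1) z] expand[OF assms(2,4) le(2) val(2) z] by simp
    then show "(\<Sum>m. enn2real (a V x m) * z ^ m) = (\<Sum>m. enn2real (a W y m) * z ^ m)"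
      using nn le by simp
  qed
  then have "a V x m = a W y m"
    by (metis a_real(1) le)
  then show ?thesis by (simp add: a_def)
qed

text \<open>A point measure takes values in the naturals or infinity, and the value infinity is the
  complement of all finite ones, so finite counts already generate. Imposing conditions on several
  sets at once makes the generator stable under intersection.\<close>

lemma sets_eval_algebra_point_measures:
  "sets (eval_algebra (point_measures :: 'b::topological_space measure set)) = sigma_sets point_measures
     {{\<xi> \<in> point_measures. \<forall>k<j. emeasure \<xi> (b k) = of_nat (m k)} | j b (m :: nat \<Rightarrow> nat).
        \<forall>k<j. b k \<in> sets (borel :: 'b measure)}" (is "_ = sigma_sets _ ?G")
proof
  let ?S = "sigma (point_measures :: 'b measure set) ?G"
  have G: "?G \<subseteq> Pow point_measures" by auto
  have "(\<lambda>\<xi>. \<xi>) \<in> ?S \<rightarrow>\<^sub>M eval_algebra (point_measures :: 'b measure set)"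
  proof (rule measurable_eval_algebraI)
    fix B :: "'b set" assume B: "B \<in> sets borel"
    let ?A = "\<lambda>m::nat. {\<xi> \<in> point_measures. emeasure \<xi> B = of_nat m}"
    have A [measurable]: "?A m \<in> sets ?S" for m
    proof -
      have "?A m \<in> ?G"
        using B by (intro CollectI exI[of _ "1::nat"] exI[of _ "\<lambda>_. B"] exI[of _ "\<lambda>_. m"]) auto
      then show ?thesis using G by (simp add: sigma_sets.Basic)
    qed
    have "(\<lambda>\<xi>. if \<xi> \<in> (\<Union>m. ?A m) then (\<Sum>m. of_nat m * indicator (?A m) \<xi>) else (\<infinity>::ennreal)) \<in> borel_measurable ?S"
      by measurable
    also have "?this \<longleftrightarrow> (\<lambda>\<xi>. emeasure \<xi> B) \<in> borel_measurable ?S"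
    proof (rule measurable_cong)
      fix \<xi> assume "\<xi> \<in> space ?S"
      then have \<xi>: "\<xi> \<in> point_measures" using G by simp
      have dj: "disjoint_family ?A" by (auto simp: disjoint_family_on_def)
      show "(if \<xi> \<in> (\<Union>m. ?A m) then (\<Sum>m. of_nat m * indicator (?A m) \<xi>) else (\<infinity>::ennreal)) = emeasure \<xi> B"
      proof (cases "\<exists>n::nat. emeasure \<xi> B = of_nat n")
        case True
        then obtain n :: nat where n: "emeasure \<xi> B = of_nat n" ..
        then have "\<xi> \<in> ?A n" using \<xi> by simp
        from suminf_cmult_indicator[OF dj this, of of_nat] n \<xi> show ?thesis by auto
      next
        case False
        then show ?thesis using point_measure_values[OF \<xi>, of B] by auto
      qed
    qed
    finally show "(\<lambda>\<xi>. emeasure \<xi> B) \<in> borel_measurable ?S" .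
  qed (use G in simp)
  then have "(\<lambda>\<xi>. \<xi>) -` A \<inter> space ?S \<in> sets ?S" if "A \<in> sets (eval_algebra (point_measures :: 'b measure set))" for A
    using that by (rule measurable_sets)
  moreover have "(\<lambda>\<xi>. \<xi>) -` A \<inter> space ?S = A" if "A \<in> sets (eval_algebra (point_measures :: 'b measure set))" for A
    using sets.sets_into_space[OF that] space_measure_of[OF G] by auto
  ultimately have "sets (eval_algebra (point_measures :: 'b measure set)) \<subseteq> sets ?S" by auto
  then show "sets (eval_algebra (point_measures :: 'b measure set)) \<subseteq> sigma_sets point_measures ?G"
    unfolding sets_measure_of[OF G] .
  show "sigma_sets point_measures ?G \<subseteq> sets (eval_algebra (point_measures :: 'b measure set))"
  proof -
    have "?G \<subseteq> sets (eval_algebra point_measures)"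
    proof clarify
      fix j :: nat and b :: "nat \<Rightarrow> 'b set" and m :: "nat \<Rightarrow> nat" assume b: "\<forall>k<j. b k \<in> sets borel"
      have 1: "{\<xi> \<in> space (eval_algebra point_measures). emeasure \<xi> (b k) = of_nat (m k)}
          \<in> sets (eval_algebra point_measures)" if "k \<in> {..<j}" for k
      proof -
        have [measurable]: "b k \<in> sets borel" using b that by simp
        show ?thesis by measurable
      qed
      have "{\<xi> \<in> space (eval_algebra point_measures). \<forall>k\<in>{..<j}. emeasure \<xi> (b k) = of_nat (m k)}
          \<in> sets (eval_algebra point_measures)"
        by (rule sets.sets_Collect_finite_All[OF 1 finite_lessThan])
      then show "{\<xi> \<in> point_measures. \<forall>k<j. emeasure \<xi> (b k) = of_nat (m k)} \<in> sets (eval_algebra point_measures)"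
        unfolding space_eval_algebra Ball_def lessThan_iff .
    qed
    then show ?thesis
      using sets.sigma_sets_subset[of ?G "eval_algebra point_measures"] by simp
  qed
qed

lemma measurable_count_of_bool:
  fixes f :: "'a \<Rightarrow> ennreal"
  assumes [measurable]: "f \<in> borel_measurable M"
  shows "(\<lambda>w. of_bool (f w = of_nat m) :: ennreal) \<in> borel_measurable M"
  by measurable

lemma (in prob_space) point_process_law_eqI:
  fixes X Y :: "'a \<Rightarrow> 'b::topological_space measure"
  assumes X [measurable]: "X \<in> M \<rightarrow>\<^sub>M eval_algebra point_measures"
    and Y [measurable]: "Y \<in> M \<rightarrow>\<^sub>M eval_algebra point_measures"
    and eq: "\<And>(n::nat) c B. (\<forall>k<n. 0 < c k) \<Longrightarrow> (\<forall>k<n. B k \<in> sets borel) \<Longrightarrow>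
      (\<integral>\<^sup>+w. expneg (\<Sum>k<n. ennreal (c k) * emeasure (X w) (B k)) \<partial>M) =
      (\<integral>\<^sup>+w. expneg (\<Sum>k<n. ennreal (c k) * emeasure (Y w) (B k)) \<partial>M)"
  shows "distr M (eval_algebra point_measures) X = distr M (eval_algebra point_measures) Y"
proof -
  have eX: "(\<lambda>w. emeasure (X w) B) \<in> borel_measurable M" if "B \<in> sets borel" for B
    using measurable_compose[OF X measurable_emeasure_eval_algebra[OF that]] .
  have eY: "(\<lambda>w. emeasure (Y w) B) \<in> borel_measurable M" if "B \<in> sets borel" for B
    using measurable_compose[OF Y measurable_emeasure_eval_algebra[OF that]] .
  have pX: "X w \<in> point_measures" if "w \<in> space M" for w using measurable_space[OF X that] by simp
  have pY: "Y w \<in> point_measures" if "w \<in> space M" for w using measurable_space[OF Y that] by simp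
  \<comment> \<open>Counts are moved one by one from the exponent to the product of events. Moving a
    count needs the identity for an exponent with one more term of free coefficient, so
    \<open>n\<close>, \<open>c\<close> and \<open>B\<close> vary in the induction.\<close>
  have joint: "(\<integral>\<^sup>+w. (\<Prod>k<j. of_bool (emeasure (X w) (b k) = of_nat (m k))) * expneg (\<Sum>k<n. ennreal (c k) * emeasure (X w) (B k)) \<partial>M) =
      (\<integral>\<^sup>+w. (\<Prod>k<j. of_bool (emeasure (Y w) (b k) = of_nat (m k))) * expneg (\<Sum>k<n. ennreal (c k) * emeasure (Y w) (B k)) \<partial>M)"
    if "\<forall>k<j. b k \<in> sets borel" "\<forall>k<n. 0 < c k" "\<forall>k<n. B k \<in> sets borel" for j n and b B :: "nat \<Rightarrow> 'b set" and m :: "nat \<Rightarrow> nat" and c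
    using that
  proof (induction j arbitrary: n c B)
    case 0
    show ?case
      unfolding lessThan_0 prod.empty mult_1 by (rule eq) (use 0 in auto)
  next
    case (Suc j)
    define V where "V X w = (\<Prod>k<j. of_bool (emeasure (X w) (b k) = of_nat (m k))) * expneg (\<Sum>k<n. ennreal (c k) * emeasure (X w) (B k))"
      for X :: "'a \<Rightarrow> 'b measure" and w
    have V1: "V X w \<le> 1" for X w
    proof -
      have "(\<Prod>k<j. of_bool (emeasure (X w) (b k) = of_nat (m k))) \<le> (1::ennreal)"
        by (induction j) (auto intro: mult_le_one)
      then have "V X w \<le> 1 * 1" unfolding V_def by (intro mult_mono expneg_le_1) auto
      then show ?thesis by simp
    qed
    have VX: "V X \<in> borel_measurable M" unfolding V_def
      by (intro borel_measurable_times_ennreal borel_measurable_prod_ennreal measurable_compose[OF _ measurable_expneg]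
        borel_measurable_sum measurable_count_of_bool eX) (use Suc.prems in auto)
    have VY: "V Y \<in> borel_measurable M" unfolding V_def
      by (intro borel_measurable_times_ennreal borel_measurable_prod_ennreal measurable_compose[OF _ measurable_expneg]
        borel_measurable_sum measurable_count_of_bool eY) (use Suc.prems in auto)
    have bj: "b j \<in> sets borel" using Suc.prems by simp
    have "(\<integral>\<^sup>+w. V X w * of_bool (emeasure (X w) (b j) = of_nat (m j)) \<partial>M) =
          (\<integral>\<^sup>+w. V Y w * of_bool (emeasure (Y w) (b j) = of_nat (m j)) \<partial>M)"
    proof (rule generating_function_unique[OF VX VY eX[OF bj] eY[OF bj] V1 V1])
      fix d :: real assume d: "0 < d"
      have "V X w * expneg (ennreal d * emeasure (X w) (b j)) =
        (\<Prod>k<j. of_bool (emeasure (X w) (b k) = of_nat (m k))) *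
        expneg (\<Sum>k<Suc n. ennreal ((c(n := d)) k) * emeasure (X w) ((B(n := b j)) k))" for X w
        by (simp add: V_def expneg_add mult.assoc)
      then show "(\<integral>\<^sup>+w. V X w * expneg (ennreal d * emeasure (X w) (b j)) \<partial>M) =
          (\<integral>\<^sup>+w. V Y w * expneg (ennreal d * emeasure (Y w) (b j)) \<partial>M)"
        using Suc.prems d by (simp only:) (intro Suc.IH, auto simp: less_Suc_eq)
    qed (use point_measure_values pX pY in auto)
    moreover have "V X w * of_bool (emeasure (X w) (b j) = of_nat (m j)) =
      (\<Prod>k<Suc j. of_bool (emeasure (X w) (b k) = of_nat (m k))) * expneg (\<Sum>k<n. ennreal (c k) * emeasure (X w) (B k))" for X w
      by (simp add: V_def mult_ac)
    ultimately show ?case by (simp only:)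
  qed
  let ?G = "{{\<xi> \<in> point_measures. \<forall>k<j. emeasure \<xi> (b k) = of_nat (m k)} | j b (m :: nat \<Rightarrow> nat).
        \<forall>k<j. b k \<in> sets (borel :: 'b measure)}"
  show ?thesis
  proof (rule measure_eqI_generator_eq[where A="\<lambda>_. point_measures"])
    show "Int_stable ?G"
    proof (rule Int_stableI)
      fix S T assume "S \<in> ?G" "T \<in> ?G"
      obtain j b and m :: "nat \<Rightarrow> nat" where
        S: "S = {\<xi> \<in> point_measures. \<forall>k<j. emeasure \<xi> (b k) = of_nat (m k)}" "\<forall>k<j. b k \<in> sets borel"
        using \<open>S \<in> ?G\<close> by blast
      obtain j' b' and m' :: "nat \<Rightarrow> nat" where
        T: "T = {\<xi> \<in> point_measures. \<forall>k<j'. emeasure \<xi> (b' k) = of_nat (m' k)}" "\<forall>k<j'. b' k \<in> sets borel"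
        using \<open>T \<in> ?G\<close> by blast
      \<comment> \<open>Intersections concatenate the two lists of conditions; the second list
        occupies the indices from \<open>j\<close> on.\<close>
      have all: "(\<forall>k<j + j'. Q k) \<longleftrightarrow> (\<forall>k<j. Q k) \<and> (\<forall>k<j'. Q (j + k))" for Q
        by (metis add_less_cancel_left le_add_diff_inverse not_le trans_less_add1)
      have "S \<inter> T = {\<xi> \<in> point_measures. \<forall>k<j + j'. emeasure \<xi> (if k < j then b k else b' (k - j)) =
          of_nat (if k < j then m k else m' (k - j))}"
        unfolding all S T by auto
      moreover have "\<forall>k<j + j'. (if k < j then b k else b' (k - j)) \<in> sets borel"
        unfolding all using S T by auto
      ultimately show "S \<inter> T \<in> ?G"
        by (intro CollectI exI[of _ "j + j'"] exI[of _ "\<lambda>k. if k < j then b k else b' (k - j)"]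
            exI[of _ "\<lambda>k. if k < j then m k else m' (k - j)"]) auto
    qed
    fix S assume "S \<in> ?G"
    then obtain j b and m :: "nat \<Rightarrow> nat" where
        S: "S = {\<xi> \<in> point_measures. \<forall>k<j. emeasure \<xi> (b k) = of_nat (m k)}" and b: "\<forall>k<j. b k \<in> sets borel"
      by blast
    have S_sets: "S \<in> sets (eval_algebra point_measures)"
      using \<open>S \<in> ?G\<close> unfolding sets_eval_algebra_point_measures by (rule sigma_sets.Basic)
    \<comment> \<open>With no terms left in the exponent the exponential factor is 1, so
      \<open>joint\<close> speaks of plain probabilities.\<close>
    have *: "emeasure (distr M (eval_algebra point_measures) X) S =
        (\<integral>\<^sup>+w. (\<Prod>k<j. of_bool (emeasure (X w) (b k) = of_nat (m k))) * expneg (\<Sum>k<(0::nat). ennreal (1::real) * emeasure (X w) {}) \<partial>M)"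
      if X: "X \<in> M \<rightarrow>\<^sub>M eval_algebra point_measures" for X
    proof -
      have "emeasure (distr M (eval_algebra point_measures) X) S = emeasure M (X -` S \<inter> space M)"
        using X S_sets by (rule emeasure_distr)
      also have "\<dots> = (\<integral>\<^sup>+w. indicator (X -` S \<inter> space M) w \<partial>M)"
        using measurable_sets[OF X S_sets] by simp
      also have "\<dots> = (\<integral>\<^sup>+w. (\<Prod>k<j. of_bool (emeasure (X w) (b k) = of_nat (m k))) \<partial>M)"
      proof (intro nn_integral_cong)
        fix w assume w: "w \<in> space M"
        have p: "(\<Prod>k<j. of_bool (emeasure (X w) (b k) = of_nat (m k))) = (of_bool (\<forall>k<j. emeasure (X w) (b k) = of_nat (m k)) :: ennreal)"
          by (induction j) (auto simp: less_Suc_eq)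
        have "indicator (X -` S \<inter> space M) w = (of_bool (\<forall>k<j. emeasure (X w) (b k) = of_nat (m k)) :: ennreal)"
          using w measurable_space[OF X w] by (simp add: S indicator_def)
        also note p[symmetric]
        finally show "indicator (X -` S \<inter> space M) w = (\<Prod>k<j. of_bool (emeasure (X w) (b k) = of_nat (m k)) :: ennreal)" .
      qed
      finally show ?thesis by simp
    qed
    show "emeasure (distr M (eval_algebra point_measures) X) S = emeasure (distr M (eval_algebra point_measures) Y) S"
      unfolding *[OF X] *[OF Y] using b by (intro joint) auto
  next
    \<comment> \<open>The empty list of conditions puts the whole space into the generator.\<close>
    show "range (\<lambda>_. point_measures) \<subseteq> ?G"
      by (auto intro!: exI[of _ "0::nat"])
    interpret D: prob_space "distr M (eval_algebra point_measures) X" using X by (rule prob_space_distr)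
    show "emeasure (distr M (eval_algebra point_measures) X) point_measures \<noteq> \<infinity>"
      using D.emeasure_space_1 by simp
  qed (auto simp: sets_eval_algebra_point_measures)
qed

section \<open>Stationarity\<close>

definition tshift :: "real \<Rightarrow> 'a \<times> real \<Rightarrow> 'a \<times> real" where "tshift s = (\<lambda>(x, t). (x, t + s))"

lemma shift_shift: "tshift s (tshift u z) = tshift (u + s) z"
  by (cases z) (simp add: tshift_def add.assoc)

lemma measurable_shift [measurable]: "tshift s \<in> borel_measurable (borel :: ('a::metric_space \<times> real) measure)"
  unfolding tshift_def split_beta by (intro borel_measurable_continuous_onI continuous_intros)

lemma vimage_shift_borel: "B \<in> sets borel \<Longrightarrow> tshift s -` B \<in> sets (borel :: ('a::metric_space \<times> real) measure)"
  using measurable_sets[OF measurable_shift, of B s] by simp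

lemma time_shift_eq: "time_shift s \<xi> = distr \<xi> borel (tshift s)"
  by (simp add: time_shift_def tshift_def)

lemma emeasure_time_shift:
  assumes "sets \<xi> = sets borel" "B \<in> sets borel"
  shows "emeasure (time_shift s \<xi>) B = emeasure \<xi> (tshift s -` B)"
proof -
  have "tshift s \<in> \<xi> \<rightarrow>\<^sub>M borel" using assms(1) measurable_shift measurable_cong_sets by blast
  moreover have "space \<xi> = UNIV" using sets_eq_imp_space_eq[OF assms(1)] by simp
  ultimately show ?thesis using assms(2) by (simp add: time_shift_eq emeasure_distr)
qed

lemma time_shift_point_measures:
  fixes \<xi> :: "('a::metric_space \<times> real) measure"
  assumes "\<xi> \<in> point_measures" shows "time_shift s \<xi> \<in> point_measures"
proof -
  obtain I :: "nat set" and p where "\<xi> = distr (count_space I) borel p" using assms by (rule point_measuresE)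
  then have "time_shift s \<xi> = distr (count_space I) borel (tshift s \<circ> p)"
    unfolding time_shift_eq by (simp add: distr_distr)
  then show ?thesis by (simp add: distr_count_space_in_point_measures)
qed

lemma bounded_vimage_shift:
  fixes B :: "('a::metric_space \<times> real) set"
  assumes "bounded B" shows "bounded (tshift s -` B)"
proof -
  obtain x t e where e: "\<And>y. y \<in> B \<Longrightarrow> dist (x, t) y \<le> e"
    using assms unfolding bounded_def by (metis surj_pair)
  have "dist (x, t - s) y = dist (x, t) (tshift s y)" for y
    by (cases y) (simp add: tshift_def dist_Pair_Pair dist_real_def algebra_simps)
  then show ?thesis using e unfolding bounded_def by (metis vimageE)
qed

lemma locally_finite_time_shift:
  fixes \<xi> :: "('a::metric_space \<times> real) measure"
  assumes "locally_finite \<xi>" shows "locally_finite (time_shift s \<xi>)"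
proof -
  have sets: "sets \<xi> = sets borel" using assms by (simp add: locally_finite_def)
  have "sets (time_shift s \<xi>) = sets borel" by (simp add: time_shift_eq)
  moreover have "emeasure (time_shift s \<xi>) B < \<infinity>" if "B \<in> sets borel" "bounded B" for B
    unfolding emeasure_time_shift[OF sets that(1)]
    using assms bounded_vimage_shift[OF that(2)] vimage_shift_borel[OF that(1)]
    unfolding locally_finite_def by blast
  ultimately show ?thesis by (simp add: locally_finite_def)
qed

lemma measurable_time_shift: "time_shift s \<in> counting_algebra \<rightarrow>\<^sub>M (counting_algebra :: ('a::metric_space \<times> real) measure measure)"
proof -
  have "time_shift s \<in> counting_algebra \<rightarrow>\<^sub>M eval_algebra {\<xi> :: ('a \<times> real) measure. \<xi> \<in> point_measures \<and> locally_finite \<xi>}"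
  proof (rule measurable_eval_algebraI)
    fix B :: "('a \<times> real) set" assume B: "B \<in> sets borel"
    have "(\<lambda>\<xi>. emeasure \<xi> (tshift s -` B)) \<in> borel_measurable counting_algebra"
      using vimage_shift_borel[OF B] by (rule measurable_emeasure_counting_algebra)
    also have "?this \<longleftrightarrow> (\<lambda>\<xi>. emeasure (time_shift s \<xi>) B) \<in> borel_measurable counting_algebra"
      using B by (intro measurable_cong) (auto simp: emeasure_time_shift space_counting_algebra)
    finally show "(\<lambda>\<xi>. emeasure (time_shift s \<xi>) B) \<in> borel_measurable counting_algebra" .
  qed (auto simp: space_counting_algebra time_shift_point_measures locally_finite_time_shift)
  then show ?thesis by (simp add: counting_algebra_def)
qed

lemma time_shift_time_shift:
  fixes \<xi> :: "('a::metric_space \<times> real) measure"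
  assumes "sets \<xi> = sets borel" shows "time_shift s (time_shift u \<xi>) = time_shift (u + s) \<xi>"
proof -
  have "tshift u \<in> \<xi> \<rightarrow>\<^sub>M borel" using assms measurable_shift measurable_cong_sets by blast
  then show ?thesis
    unfolding time_shift_eq by (subst distr_distr) (auto simp: comp_def shift_shift)
qed

lemma emeasure_lborel_translate:
  fixes T :: "real set"
  assumes "T \<in> sets borel"
  shows "emeasure lborel ((\<lambda>t. s + t) -` T) = emeasure lborel T"
proof -
  have "emeasure lborel T = emeasure (distr lborel borel (\<lambda>t. s + t)) T"
    by (simp add: lborel_distr_plus)
  also have "\<dots> = emeasure lborel ((\<lambda>t. s + t) -` T)" using assms by (subst emeasure_distr) auto
  finally show ?thesis ..
qed

locale observed_cluster_process = cluster_process M \<Lambda> P N Z C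
  for M :: "'w measure"
    and \<Lambda> :: "'a::polish_space measure"
    and P :: "'a \<times> real \<Rightarrow> ('a \<times> real) measure measure"
    and N :: "'w \<Rightarrow> enat"
    and Z :: "nat \<Rightarrow> 'w \<Rightarrow> 'a \<times> real"
    and C :: "nat \<Rightarrow> 'w \<Rightarrow> ('a \<times> real) measure" +
  fixes XX :: "'a set"
  assumes equivariant: "shift_equivariant P" and causal: "causal P"
    and kernel_L2: "\<And>y s. L2_process (P (y, s)) (\<lambda>\<xi>. \<xi>)"
    and XX: "XX \<in> sets borel" "bounded XX"
begin

section \<open>The observed process as a random point measure\<close>

definition \<Xi> :: "'w \<Rightarrow> ('a \<times> real) measure" where "\<Xi> = observed_process XX N C"

definition G :: "('a \<times> real) set" where "G = XX \<times> UNIV"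

lemma times_borel:
  fixes A :: "'a set" and T :: "real set"
  assumes "A \<in> sets borel" "T \<in> sets borel" shows "A \<times> T \<in> sets borel"
proof -
  have "A \<times> T \<in> sets (borel \<Otimes>\<^sub>M borel)" using assms by (rule pair_measureI)
  then show ?thesis unfolding borel_prod .
qed

lemma G_borel [measurable]: "G \<in> sets borel" unfolding G_def using XX by (intro times_borel) auto

lemma sets_superposition [simp]: "sets (superposition N C w) = sets borel"
  using sets.sigma_sets_eq[of "borel :: ('a \<times> real) measure"] by (simp add: superposition_def)

lemma C_point_measure: "w \<in> space M \<Longrightarrow> C i w \<in> point_measures"
  using measurable_space[OF C_measurable, of w i] by (simp add: space_counting_algebra)

lemma emeasure_superposition:
  assumes w: "w \<in> space M" and B: "B \<in> sets borel"
  shows "emeasure (superposition N C w) B = csum w (\<lambda>i. emeasure (C i w) B)"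
proof -
  let ?m = "\<lambda>B. \<Sum>i. if enat i < N w then emeasure (C i w) B else 0"
  have m: "?m B = csum w (\<lambda>i. emeasure (C i w) B)" for B
    unfolding idx_nn_integral nn_integral_count_space_nat by (intro suminf_cong) (simp add: idx_def)
  have "countably_additive (sets borel) ?m"
    unfolding m countably_additive_def
  proof (intro allI impI)
    fix F :: "nat \<Rightarrow> ('a \<times> real) set" assume F: "range F \<subseteq> sets borel" "disjoint_family F"
    have "(\<Sum>n. csum w (\<lambda>i. emeasure (C i w) (F n))) =
        (csum w (\<lambda>i. (\<Sum>n. emeasure (C i w) (F n))))"
      by (rule nn_integral_suminf[symmetric]) simp
    also have "\<dots> = csum w (\<lambda>i. emeasure (C i w) (\<Union>n. F n))"
      using F by (intro nn_integral_cong suminf_emeasure) (auto simp: C_point_measure w)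
    finally show "(\<Sum>n. csum w (\<lambda>i. emeasure (C i w) (F n))) =
       (csum w (\<lambda>i. emeasure (C i w) (\<Union>n. F n)))" .
  qed
  then have "emeasure (superposition N C w) B = ?m B"
    unfolding superposition_def using B sets.sigma_algebra_axioms[of "borel :: ('a \<times> real) measure"]
    by (intro emeasure_measure_of_sigma) (auto simp: positive_def cong: if_cong)
  then show ?thesis by (simp add: m)
qed

lemma sets_\<Xi> [simp]: "sets (\<Xi> w) = sets borel"
  by (simp add: \<Xi>_def observed_process_def)

lemma emeasure_\<Xi>:
  assumes w: "w \<in> space M" and B: "B \<in> sets borel"
  shows "emeasure (\<Xi> w) B = csum w (\<lambda>i. emeasure (C i w) (B \<inter> G))"
proof -
  have "emeasure (\<Xi> w) B = (\<integral>\<^sup>+z. indicator G z * indicator B z \<partial>superposition N C w)"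
    unfolding \<Xi>_def observed_process_def G_def[symmetric] using B
    by (intro emeasure_density) (auto simp: measurable_cong_sets[OF sets_superposition refl])
  also have "\<dots> = (\<integral>\<^sup>+z. indicator (B \<inter> G) z \<partial>superposition N C w)"
    by (intro nn_integral_cong) (auto simp: indicator_def)
  also have "\<dots> = emeasure (superposition N C w) (B \<inter> G)"
    using B by simp
  finally show ?thesis using B w by (simp add: emeasure_superposition)
qed

lemma \<Xi>_point_measure:
  assumes w: "w \<in> space M" shows "\<Xi> w \<in> point_measures"
  by (rule superposition_point_measures(1)[where K="idx w" and \<xi>="\<lambda>i. C i w" and G=G])
    (auto simp: C_point_measure emeasure_\<Xi> w)

lemma measurable_emeasure_C [measurable]:
  "B \<in> sets borel \<Longrightarrow> (\<lambda>w. emeasure (C i w) B) \<in> borel_measurable M"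
  by (rule measurable_compose[OF C_measurable measurable_emeasure_counting_algebra])

lemma measurable_emeasure_\<Xi> [measurable]:
  assumes [measurable]: "B \<in> sets borel"
  shows "(\<lambda>w. emeasure (\<Xi> w) B) \<in> borel_measurable M"
proof -
  have "(\<lambda>w. csum w (\<lambda>i. emeasure (C i w) (B \<inter> G))) \<in> borel_measurable M"
    by measurable
  then show ?thesis by (subst measurable_cong[OF emeasure_\<Xi>]) auto
qed

lemma measurable_\<Xi>: "\<Xi> \<in> M \<rightarrow>\<^sub>M eval_algebra point_measures"
  by (rule measurable_eval_algebraI) (auto simp: \<Xi>_point_measure)

text \<open>Conditional independence controls finitely many clusters at a time; this limit passes to
  all existing ones.\<close>

lemma tendsto_prod_expneg:
  "(\<lambda>n. \<Prod>i<n. if i \<in> idx w then expneg (g i) else 1) \<longlonglongrightarrow> expneg (csum w (\<lambda>i. g i))"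
proof -
  have "(\<Prod>i<n. if i \<in> idx w then expneg (g i) else 1) = expneg (\<Sum>i<n. of_bool (i \<in> idx w) * g i)" for n
    by (subst expneg_sum) (auto intro!: prod.cong)
  moreover have "(\<lambda>n. \<Sum>i<n. of_bool (i \<in> idx w) * g i) \<longlonglongrightarrow> (csum w (\<lambda>i. g i))"
    unfolding idx_nn_integral nn_integral_count_space_nat by (rule summable_LIMSEQ) simp
  ultimately show ?thesis by (simp add: tendsto_expneg)
qed

lemma nn_integral_tendsto_bounded:
  fixes u :: "nat \<Rightarrow> 'w \<Rightarrow> ennreal"
  assumes "\<And>n. u n \<in> borel_measurable M" "v \<in> borel_measurable M" "\<And>n w. u n w \<le> 1"
    and "\<And>w. (\<lambda>n. u n w) \<longlonglongrightarrow> v w"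
  shows "(\<lambda>n. \<integral>\<^sup>+w. u n w \<partial>M) \<longlonglongrightarrow> (\<integral>\<^sup>+w. v w \<partial>M)"
  by (rule nn_integral_dominated_convergence[where w="\<lambda>_. 1"]) (use assms in \<open>auto simp: emeasure_space_1\<close>)

text \<open>For the first n clusters the product identity replaces each factor by the Laplace
  transform of its kernel, a number in [0,1] and hence recovered from its \<open>neglog\<close> by
  \<open>expneg\<close>. Bounded convergence lets n tend to infinity.\<close>

lemma cluster_laplace:
  assumes f [measurable]: "f \<in> borel_measurable counting_algebra"
  shows "(\<integral>\<^sup>+w. expneg (csum w (\<lambda>i. f (C i w))) \<partial>M) =
    (\<integral>\<^sup>+w. expneg (csum w (\<lambda>i. neglog (cluster_mean (\<lambda>\<xi>. expneg (f \<xi>)) (Z i w)))) \<partial>M)"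
proof -
  let ?g = "cluster_mean (\<lambda>\<xi>. expneg (f \<xi>))"
  have g1: "?g z \<le> 1" for z
  proof -
    have "?g z \<le> cluster_mean (\<lambda>_. 1) z"
      unfolding cluster_mean_def by (intro nn_integral_mono expneg_le_1)
    then show ?thesis by (simp add: cluster_mean_1)
  qed
  have prod1: "(\<Prod>i<n. if i \<in> idx w then a i else 1) \<le> 1" if "\<And>i. a i \<le> 1" for n w and a :: "nat \<Rightarrow> ennreal"
    by (rule order_trans[OF prod_mono_ennreal[where g="\<lambda>_. 1"]]) (use that in auto)
  have L: "(\<lambda>n. \<integral>\<^sup>+w. (\<Prod>i<n. if i \<in> idx w then expneg (f (C i w)) else 1) \<partial>M) \<longlonglongrightarrow>
     (\<integral>\<^sup>+w. expneg (csum w (\<lambda>i. f (C i w))) \<partial>M)"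
    by (intro nn_integral_tendsto_bounded tendsto_prod_expneg prod1 expneg_le_1) measurable
  have R: "(\<lambda>n. \<integral>\<^sup>+w. (\<Prod>i<n. if i \<in> idx w then expneg (neglog (?g (Z i w))) else 1) \<partial>M) \<longlonglongrightarrow>
     (\<integral>\<^sup>+w. expneg (csum w (\<lambda>i. neglog (?g (Z i w)))) \<partial>M)"
    by (intro nn_integral_tendsto_bounded tendsto_prod_expneg prod1 expneg_le_1) measurable
  have "(\<integral>\<^sup>+w. (\<Prod>i<n. if i \<in> idx w then expneg (f (C i w)) else 1) \<partial>M) =
      (\<integral>\<^sup>+w. (\<Prod>i<n. if i \<in> idx w then expneg (neglog (?g (Z i w))) else 1) \<partial>M)" for n
  proof -
    have "(\<integral>\<^sup>+w. (\<Prod>i<n. if i \<in> idx w then expneg (f (C i w)) else 1) \<partial>M) =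
      (\<integral>\<^sup>+w\<in>space M. (\<Prod>i<n. if i \<in> idx w then expneg (f (C i w)) else 1) \<partial>M)"
      by (intro nn_integral_cong) simp
    also have "\<dots> = (\<integral>\<^sup>+w\<in>space M. (\<Prod>i<n. if i \<in> idx w then ?g (Z i w) else 1) \<partial>M)"
      by (rule clusters_prod[OF ground.top, of n "\<lambda>_ \<xi>. expneg (f \<xi>)"]) measurable
    also have "\<dots> = (\<integral>\<^sup>+w. (\<Prod>i<n. if i \<in> idx w then expneg (neglog (?g (Z i w))) else 1) \<partial>M)"
      by (intro nn_integral_cong) (auto simp: expneg_neglog[OF g1] intro!: prod.cong)
    finally show ?thesis .
  qed
  with L R show ?thesis using LIMSEQ_unique by simp
qed

lemma ground_expneg_cong:
  assumes B: "B \<in> sets borel" "B' \<in> sets borel" "emeasure \<nu> B = emeasure \<nu> B'"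
  shows "(\<integral>\<^sup>+w. expneg (c * emeasure (H w) B) \<partial>M) =
         (\<integral>\<^sup>+w. expneg (c * emeasure (H w) B') \<partial>M)"
proof (cases "emeasure \<nu> B < \<infinity>")
  case True
  then show ?thesis using B
    by (subst (1 2) nn_integral_ground_count[where g="\<lambda>x. expneg (c * x)"]) (auto simp: measure_def)
next
  case False
  have *: "AE w in M. emeasure (H w) B = \<infinity>" if "B \<in> sets borel" "emeasure \<nu> B = \<infinity>" for B
    using ground that by (simp add: poisson_process_def \<nu>_def)
  from False B(3) have "emeasure \<nu> B = \<infinity>" "emeasure \<nu> B' = \<infinity>" by (simp_all add: less_top[symmetric])
  with *[of B] *[of B'] B show ?thesis
    by (intro nn_integral_cong_AE) (auto elim!: eventually_elim2)
qed

text \<open>The level sets of \<open>h\<close> are disjoint, so their counts are independent and the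
  expectation of the exponential factorises.\<close>

lemma ground_laplace_simple:
  assumes h: "simple_function borel h"
  shows "(\<integral>\<^sup>+w. expneg (csum w (\<lambda>i. h (Z i w))) \<partial>M) =
    (\<Prod>v\<in>range h. \<integral>\<^sup>+w. expneg (v * emeasure (H w) (h -` {v})) \<partial>M)"
proof -
  have fin: "finite (range h)" using simple_functionD(1)[OF h] by simp
  have B: "h -` {v} \<in> sets borel" for v using simple_functionD(2)[OF h, of "{v}"] by simp
  \<comment> \<open>Independence of counts is stated for sets indexed by an initial segment of the
    naturals, so the values of \<open>h\<close> are numbered.\<close>
  obtain e where e: "bij_betw e {..<card (range h)} (range h)"
    using ex_bij_betw_nat_finite[OF fin] by (auto simp: atLeast0LessThan)
  have inj: "inj_on e {..<card (range h)}" using e by (rule bij_betw_imp_inj_on)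
  have "(csum w (\<lambda>i. h (Z i w))) = (\<Sum>v\<in>range h. v * emeasure (H w) (h -` {v}))" for w
  proof -
    have hz: "h z = (\<Sum>v\<in>range h. v * indicator (h -` {v}) z)" for z
      by (rule simple_function_indicator_representation[OF h, unfolded space_borel Int_UNIV_right, OF UNIV_I])
    have "(csum w (\<lambda>i. h (Z i w))) =
        (csum w (\<lambda>i. (\<Sum>v\<in>range h. v * indicator (h -` {v}) (Z i w))))"
      by (intro nn_integral_cong, rule hz)
    also have "\<dots> = (\<Sum>v\<in>range h. v * emeasure (H w) (h -` {v}))"
      using B by (simp add: nn_integral_sum nn_integral_cmult emeasure_ground)
    finally show ?thesis .
  qed
  then have "(\<integral>\<^sup>+w. expneg (csum w (\<lambda>i. h (Z i w))) \<partial>M) =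
     (\<integral>\<^sup>+w. (\<Prod>v\<in>range h. expneg (v * emeasure (H w) (h -` {v}))) \<partial>M)"
    by (simp add: expneg_sum[OF fin])
  also have "\<dots> = (\<integral>\<^sup>+w. (\<Prod>k<card (range h). expneg (e k * emeasure (H w) (h -` {e k}))) \<partial>M)"
    by (subst prod.reindex_bij_betw[OF e, symmetric]) simp
  also have "\<dots> = (\<Prod>k<card (range h). \<integral>\<^sup>+w. expneg (e k * emeasure (H w) (h -` {e k})) \<partial>M)"
  proof (rule indep_vars_nn_integral)
    have "disjoint_family_on (\<lambda>k. h -` {e k}) {..<card (range h)}"
      using inj by (auto simp: disjoint_family_on_def inj_on_def)
    then have "indep_vars (\<lambda>_. borel) (\<lambda>k w. emeasure (H w) (h -` {e k})) {..<card (range h)}"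
      using B by (intro ground_indep) auto
    then show "indep_vars (\<lambda>_. borel) (\<lambda>k w. expneg (e k * emeasure (H w) (h -` {e k}))) {..<card (range h)}"
      by (rule indep_vars_compose2) measurable
  qed auto
  also have "\<dots> = (\<Prod>v\<in>range h. \<integral>\<^sup>+w. expneg (v * emeasure (H w) (h -` {v})) \<partial>M)"
    by (subst prod.reindex_bij_betw[OF e, symmetric]) simp
  finally show ?thesis .
qed

lemma ground_laplace_sup:
  assumes U: "\<And>i. U i \<in> borel_measurable borel" "incseq U"
  shows "(\<lambda>n. \<integral>\<^sup>+w. expneg (csum w (\<lambda>i. U n (Z i w))) \<partial>M) \<longlonglongrightarrow>
    (\<integral>\<^sup>+w. expneg (csum w (\<lambda>i. (SUP n. U n (Z i w)))) \<partial>M)"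
proof (intro nn_integral_tendsto_bounded expneg_le_1 tendsto_expneg)
  note U(1)[measurable]
  have le: "U m x \<le> U n x" if "m \<le> n" for m n x
    using incseqD[OF U(2) that] by (rule le_funD)
  fix w
  have "incseq (\<lambda>n. csum w (\<lambda>i. U n (Z i w)))"
    by (auto simp: incseq_def intro!: nn_integral_mono le)
  then have "(\<lambda>n. csum w (\<lambda>i. U n (Z i w))) \<longlonglongrightarrow> (SUP n. csum w (\<lambda>i. U n (Z i w)))"
    by (rule LIMSEQ_SUP)
  also have "(SUP n. csum w (\<lambda>i. U n (Z i w))) = csum w (\<lambda>i. (SUP n. U n (Z i w)))"
    by (intro nn_integral_monotone_convergence_SUP[symmetric]) (auto simp: incseq_def le_fun_def le)
  finally show "(\<lambda>n. csum w (\<lambda>i. U n (Z i w))) \<longlonglongrightarrow> (csum w (\<lambda>i. (SUP n. U n (Z i w))))" .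
qed (use U(1) in measurable)

text \<open>Level sets of the composed function are preimages under \<open>\<theta>\<close> and have
  the same \<open>\<nu>\<close>-measure, hence counts with the same distribution: the factors agree
  one by one for simple functions, and monotone approximation gives the rest.\<close>

lemma ground_laplace_invariant:
  assumes \<theta> [measurable]: "\<theta> \<in> borel \<rightarrow>\<^sub>M borel" and inv: "distr \<nu> borel \<theta> = \<nu>"
    and h: "h \<in> borel_measurable borel"
  shows "(\<integral>\<^sup>+w. expneg (csum w (\<lambda>i. h (\<theta> (Z i w)))) \<partial>M) =
    (\<integral>\<^sup>+w. expneg (csum w (\<lambda>i. h (Z i w))) \<partial>M)"
proof -
  have \<nu>\<theta>: "emeasure \<nu> (\<theta> -` B) = emeasure \<nu> B" if "B \<in> sets borel" for B
  proof -
    have "emeasure \<nu> B = emeasure (distr \<nu> borel \<theta>) B" by (simp add: inv)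
    also have "\<dots> = emeasure \<nu> (\<theta> -` B)" using that by (subst emeasure_distr) auto
    finally show ?thesis ..
  qed
  have simple: "(\<integral>\<^sup>+w. expneg (csum w (\<lambda>i. h (\<theta> (Z i w)))) \<partial>M) =
    (\<integral>\<^sup>+w. expneg (csum w (\<lambda>i. h (Z i w))) \<partial>M)" if h: "simple_function borel h" for h
  proof -
    have B: "h -` {v} \<in> sets borel" for v using simple_functionD(2)[OF h, of "{v}"] by simp
    have fin: "finite (range h)" using simple_functionD(1)[OF h] by simp
    have h\<theta>: "simple_function borel (\<lambda>z. h (\<theta> z))"
      by (rule simple_function_comp[OF \<theta> h, unfolded comp_def])
    have "(\<integral>\<^sup>+w. expneg (csum w (\<lambda>i. h (\<theta> (Z i w)))) \<partial>M) =
      (\<Prod>v\<in>range (\<lambda>z. h (\<theta> z)). \<integral>\<^sup>+w. expneg (v * emeasure (H w) (\<theta> -` h -` {v})) \<partial>M)"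
      by (subst ground_laplace_simple[OF h\<theta>]) (simp add: vimage_def)
    also have "\<dots> = (\<Prod>v\<in>range h. \<integral>\<^sup>+w. expneg (v * emeasure (H w) (\<theta> -` h -` {v})) \<partial>M)"
    proof (rule prod.mono_neutral_left[OF fin])
      \<comment> \<open>Values of \<open>h\<close> that are never attained after
        \<open>\<theta>\<close> have empty preimage and contribute the factor 1.\<close>
      show "\<forall>v\<in>range h - range (\<lambda>z. h (\<theta> z)). (\<integral>\<^sup>+w. expneg (v * emeasure (H w) (\<theta> -` h -` {v})) \<partial>M) = 1"
      proof
        fix v assume "v \<in> range h - range (\<lambda>z. h (\<theta> z))"
        then have "h (\<theta> x) \<noteq> v" for x by (metis DiffD2 rangeI)
        then have "\<theta> -` h -` {v} = {}" by (simp add: vimage_def)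
        then show "(\<integral>\<^sup>+w. expneg (v * emeasure (H w) (\<theta> -` h -` {v})) \<partial>M) = 1"
          by (simp add: emeasure_space_1)
      qed
    qed auto
    also have "\<dots> = (\<Prod>v\<in>range h. \<integral>\<^sup>+w. expneg (v * emeasure (H w) (h -` {v})) \<partial>M)"
      using B measurable_sets[OF \<theta> B] by (intro prod.cong refl ground_expneg_cong \<nu>\<theta>) auto
    finally show ?thesis by (simp add: ground_laplace_simple[OF h])
  qed
  obtain U where U: "\<And>i. simple_function borel (U i)" "incseq U" "\<And>x. (SUP i. U i x) = h x"
    using borel_measurable_implies_simple_function_sequence'[OF h] by metis
  have mU [measurable]: "U i \<in> borel_measurable borel" for i using U(1) by (rule borel_measurable_simple_function)
  have "(\<lambda>n. \<integral>\<^sup>+w. expneg (csum w (\<lambda>i. U n (Z i w))) \<partial>M) \<longlonglongrightarrow>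
    (\<integral>\<^sup>+w. expneg (csum w (\<lambda>i. h (Z i w))) \<partial>M)"
    using ground_laplace_sup[OF mU U(2)] by (simp add: U(3))
  moreover have inc: "incseq (\<lambda>n z. U n (\<theta> z))"
    unfolding incseq_def by (intro allI impI le_funI le_funD[OF incseqD[OF U(2)]])
  then have "(\<lambda>n. \<integral>\<^sup>+w. expneg (csum w (\<lambda>i. U n (\<theta> (Z i w)))) \<partial>M) \<longlonglongrightarrow>
    (\<integral>\<^sup>+w. expneg (csum w (\<lambda>i. h (\<theta> (Z i w)))) \<partial>M)"
    using ground_laplace_sup[OF _ inc] by (simp add: U(3))
  ultimately show ?thesis
    unfolding simple[OF U(1)] using LIMSEQ_unique by blast
qed

lemma \<nu>_shift: "distr \<nu> borel (tshift s) = \<nu>"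
proof -
  have "\<Lambda> \<Otimes>\<^sub>M lborel = distr \<nu> borel (tshift s)"
  proof (rule pair_measure_eqI)
    show "sigma_finite_measure \<Lambda>" "sigma_finite_measure (lborel :: real measure)" by unfold_locales
    show "sets (\<Lambda> \<Otimes>\<^sub>M lborel) = sets (distr \<nu> borel (tshift s))"
      unfolding \<nu>_def[symmetric] sets_distr by (rule sets_\<nu>)
    fix A :: "'a set" and T :: "real set" assume "A \<in> sets \<Lambda>" and T': "T \<in> sets lborel"
    then have A: "A \<in> sets borel" and T: "T \<in> sets borel" by auto
    have "emeasure (distr \<nu> borel (tshift s)) (A \<times> T) = emeasure \<nu> (tshift s -` (A \<times> T))"
      using times_borel[OF A T] by (subst emeasure_distr) auto
    also have "tshift s -` (A \<times> T) = A \<times> ((\<lambda>t. s + t) -` T)"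
      by (auto simp: tshift_def add.commute)
    also have "emeasure \<nu> \<dots> = emeasure \<Lambda> A * emeasure lborel ((\<lambda>t. s + t) -` T)"
      unfolding \<nu>_def using A measurable_sets[of "\<lambda>t. s + t" borel borel T] T
      by (intro \<Lambda>L.M2.emeasure_pair_measure_Times) auto
    also have "emeasure lborel ((\<lambda>t. s + t) -` T) = emeasure lborel T"
      by (rule emeasure_lborel_translate[OF T])
    finally show "emeasure \<Lambda> A * emeasure lborel T = emeasure (distr \<nu> borel (tshift s)) (A \<times> T)" ..
  qed
  then show ?thesis by (simp add: \<nu>_def)
qed

text \<open>Equivariance is assumed relative to time 0; composing the shifts by \<open>u\<close> and
  by \<open>s\<close> gives it from any starting time, as an identity of measures to integrate
  against.\<close>

lemma kernel_shift: "P (tshift s z) = distr (P z) counting_algebra (time_shift s)"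
proof (rule measure_eqI)
  fix D assume "D \<in> sets (P (tshift s z))"
  then have D: "D \<in> sets counting_algebra" by simp
  obtain y u where z: "z = (y, u)" by fastforce
  have E: "emeasure (P (y, u)) D = emeasure (P (y, 0)) (time_shift u -` D \<inter> space counting_algebra)"
    if "D \<in> sets counting_algebra" for D u
    using equivariant that by (simp add: shift_equivariant_def)
  have D': "time_shift s -` D \<inter> space counting_algebra \<in> sets counting_algebra"
    using measurable_sets[OF measurable_time_shift D] .
  have "emeasure (P (tshift s z)) D = emeasure (P (y, 0)) (time_shift (u + s) -` D \<inter> space counting_algebra)"
    using E[OF D] by (simp add: z tshift_def)
  also have "time_shift (u + s) -` D \<inter> space counting_algebra =
      time_shift u -` (time_shift s -` D \<inter> space counting_algebra) \<inter> space counting_algebra"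
    using measurable_space[OF measurable_time_shift, of _ u]
    by (auto simp: space_counting_algebra time_shift_time_shift)
  also have "emeasure (P (y, 0)) \<dots> = emeasure (P (y, u)) (time_shift s -` D \<inter> space counting_algebra)"
    using E[OF D', of u] by simp
  also have "\<dots> = emeasure (distr (P z) counting_algebra (time_shift s)) D"
    using D measurable_time_shift by (subst emeasure_distr) (auto simp: z measurable_kernel_cong)
  finally show "emeasure (P (tshift s z)) D = emeasure (distr (P z) counting_algebra (time_shift s)) D" .
qed simp

lemma cluster_mean_shift:
  assumes f: "f \<in> borel_measurable counting_algebra"
  shows "cluster_mean f (tshift s z) = cluster_mean (\<lambda>\<xi>. f (time_shift s \<xi>)) z"
  unfolding cluster_mean_def kernel_shift
  using f measurable_time_shift by (subst nn_integral_distr) (auto simp: measurable_kernel_cong)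

lemma \<Xi>_stationary: "time_stationary M \<Xi>"
  unfolding time_stationary_def
proof
  fix s
  have pm: "time_shift s (\<Xi> w) \<in> point_measures" if "w \<in> space M" for w
    by (intro time_shift_point_measures \<Xi>_point_measure that)
  have ts: "emeasure (time_shift s (\<Xi> w)) B = emeasure (\<Xi> w) (tshift s -` B)" if "B \<in> sets borel" for B w
    using that by (simp add: emeasure_time_shift)
  show "distr M (eval_algebra point_measures) (\<lambda>w. time_shift s (\<Xi> w)) = distr M (eval_algebra point_measures) \<Xi>"
  proof (rule point_process_law_eqI[OF _ measurable_\<Xi>])
    show "(\<lambda>w. time_shift s (\<Xi> w)) \<in> M \<rightarrow>\<^sub>M eval_algebra point_measures"
      by (rule measurable_eval_algebraI) (auto simp: pm ts intro!: measurable_emeasure_\<Xi> vimage_shift_borel)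
    fix n and c :: "nat \<Rightarrow> real" and B :: "nat \<Rightarrow> ('a \<times> real) set"
    assume "\<forall>k<n. B k \<in> sets borel"
    then have B: "B k \<in> sets borel" if "k < n" for k using that by simp
    \<comment> \<open>The exponent of the observed process is the sum of this functional over the
      clusters; intersecting with \<open>G\<close> accounts for the restriction to observed
      points.\<close>
    define F where "F \<xi> = (\<Sum>k<n. ennreal (c k) * emeasure \<xi> (B k \<inter> G))" for \<xi> :: "('a \<times> real) measure"
    have F [measurable]: "F \<in> borel_measurable counting_algebra"
      unfolding F_def using B by (intro borel_measurable_sum borel_measurable_times_ennreal measurable_emeasure_counting_algebra) auto
    have sum_eq: "(\<Sum>k<n. ennreal (c k) * emeasure (\<Xi> w) (B' k)) =
       (csum w (\<lambda>i. (\<Sum>k<n. ennreal (c k) * emeasure (C i w) (B' k \<inter> G))))"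
      if "w \<in> space M" "\<And>k. k < n \<Longrightarrow> B' k \<in> sets borel" for w B'
      using that by (simp add: emeasure_\<Xi> nn_integral_sum nn_integral_cmult)
    \<comment> \<open>Observation restricts space only, hence commutes with time shifts.\<close>
    have G: "tshift s -` B \<inter> G = tshift s -` (B \<inter> G)" for B by (auto simp: G_def tshift_def)
    let ?h = "\<lambda>z. neglog (cluster_mean (\<lambda>\<xi>. expneg (F \<xi>)) z)"
    have "(\<integral>\<^sup>+w. expneg (\<Sum>k<n. ennreal (c k) * emeasure (time_shift s (\<Xi> w)) (B k)) \<partial>M) =
       (\<integral>\<^sup>+w. expneg (csum w (\<lambda>i. F (time_shift s (C i w)))) \<partial>M)"
    proof (intro nn_integral_cong arg_cong[where f=expneg])
      fix w assume w: "w \<in> space M"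
      have "(\<Sum>k<n. ennreal (c k) * emeasure (time_shift s (\<Xi> w)) (B k)) =
          (\<Sum>k<n. ennreal (c k) * emeasure (\<Xi> w) (tshift s -` B k))"
        using B by (simp add: ts)
      also have "\<dots> = (csum w (\<lambda>i. (\<Sum>k<n. ennreal (c k) * emeasure (C i w) (tshift s -` (B k \<inter> G)))))"
        using w B vimage_shift_borel by (subst sum_eq) (auto simp: G)
      also have "\<dots> = csum w (\<lambda>i. F (time_shift s (C i w)))"
        unfolding F_def using B w
        by (intro nn_integral_cong sum.cong refl arg_cong2[where f="(*)"] emeasure_time_shift[symmetric])
          (auto simp: C_point_measure)
      finally show "(\<Sum>k<n. ennreal (c k) * emeasure (time_shift s (\<Xi> w)) (B k)) = csum w (\<lambda>i. F (time_shift s (C i w)))" .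
    qed
    also have "\<dots> = (\<integral>\<^sup>+w. expneg (csum w (\<lambda>i. ?h (tshift s (Z i w)))) \<partial>M)"
      using cluster_laplace[OF measurable_compose[OF measurable_time_shift F], of s] cluster_mean_shift[of "\<lambda>\<xi>. expneg (F \<xi>)" s]
      by simp
    also have "\<dots> = (\<integral>\<^sup>+w. expneg (csum w (\<lambda>i. ?h (Z i w))) \<partial>M)"
      by (rule ground_laplace_invariant[OF _ \<nu>_shift]) measurable
    also have "\<dots> = (\<integral>\<^sup>+w. expneg (csum w (\<lambda>i. F (C i w))) \<partial>M)"
      by (rule cluster_laplace[OF F, symmetric])
    also have "\<dots> = (\<integral>\<^sup>+w. expneg (\<Sum>k<n. ennreal (c k) * emeasure (\<Xi> w) (B k)) \<partial>M)"
      unfolding F_def using B by (intro nn_integral_cong arg_cong[where f=expneg] sum_eq[symmetric]) auto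
    finally show "(\<integral>\<^sup>+w. expneg (\<Sum>k<n. ennreal (c k) * emeasure (time_shift s (\<Xi> w)) (B k)) \<partial>M) =
      (\<integral>\<^sup>+w. expneg (\<Sum>k<n. ennreal (c k) * emeasure (\<Xi> w) (B k)) \<partial>M)" .
  qed
qed

end

section \<open>Moments of the observed process\<close>

text \<open>By Tonelli the shift is averaged first: for each x the set of admissible s is a
  translate of \<open>U\<close>, whose length does not depend on x. Sigma-finiteness of
  \<open>q\<close> permits the exchange.\<close>

lemma nn_integral_translates:
  fixes a :: "'x \<Rightarrow> real"
  assumes q: "sigma_finite_measure q" and a [measurable]: "a \<in> borel_measurable q"
    and B [measurable]: "B \<in> sets q" and U [measurable]: "U \<in> sets borel"
  shows "(\<integral>\<^sup>+s. emeasure q {x \<in> B. a x + s \<in> U} \<partial>lborel) = emeasure lborel U * emeasure q B"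
proof -
  interpret q: sigma_finite_measure q by fact
  interpret pair_sigma_finite q "lborel :: real measure" ..
  have "(\<integral>\<^sup>+s. emeasure q {x \<in> B. a x + s \<in> U} \<partial>lborel) =
      (\<integral>\<^sup>+s. (\<integral>\<^sup>+x. indicator U (a x + s) * indicator B x \<partial>q) \<partial>lborel)"
  proof (intro nn_integral_cong)
    fix s
    have "{x \<in> space q. a x + s \<in> U} \<inter> B \<in> sets q" by (intro sets.Int) measurable
    also have "{x \<in> space q. a x + s \<in> U} \<inter> B = {x \<in> B. a x + s \<in> U}"
      using sets.sets_into_space[OF B] by auto
    finally have "emeasure q {x \<in> B. a x + s \<in> U} = (\<integral>\<^sup>+x. indicator {x \<in> B. a x + s \<in> U} x \<partial>q)" by simp
    also have "\<dots> = (\<integral>\<^sup>+x. indicator U (a x + s) * indicator B x \<partial>q)"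
      by (intro nn_integral_cong) (auto simp: indicator_def)
    finally show "emeasure q {x \<in> B. a x + s \<in> U} = (\<integral>\<^sup>+x. indicator U (a x + s) * indicator B x \<partial>q)" .
  qed
  also have "\<dots> = (\<integral>\<^sup>+x. (\<integral>\<^sup>+s. indicator U (a x + s) * indicator B x \<partial>lborel) \<partial>q)"
    by (rule Fubini'[of "\<lambda>x s. indicator U (a x + s) * indicator B x"]) measurable
  also have "\<dots> = (\<integral>\<^sup>+x. emeasure lborel U * indicator B x \<partial>q)"
  proof (intro nn_integral_cong)
    fix x
    have "(\<integral>\<^sup>+s. indicator U (a x + s) * indicator B x \<partial>lborel) =
        (\<integral>\<^sup>+s. indicator ((\<lambda>t. a x + t) -` U) s \<partial>lborel) * indicator B x"
    proof (subst nn_integral_multc[symmetric])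
      show "indicator ((+) (a x) -` U) \<in> borel_measurable lborel"
        using measurable_sets[of "\<lambda>t. a x + t" borel borel U] by simp
      show "(\<integral>\<^sup>+s. indicator U (a x + s) * indicator B x \<partial>lborel) =
          (\<integral>\<^sup>+s. indicator ((+) (a x) -` U) s * indicator B x \<partial>lborel)"
        by (intro nn_integral_cong arg_cong2[where f="(*)"]) (simp_all add: indicator_def)
    qed
    also have "\<dots> = emeasure lborel ((\<lambda>t. a x + t) -` U) * indicator B x"
      using measurable_sets[of "\<lambda>t. a x + t" borel borel U] by (subst nn_integral_indicator) auto
    finally show "(\<integral>\<^sup>+s. indicator U (a x + s) * indicator B x \<partial>lborel) = emeasure lborel U * indicator B x"
      by (simp add: emeasure_lborel_translate)
  qed
  also have "\<dots> = emeasure lborel U * emeasure q B"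
    by (simp add: nn_integral_cmult)
  finally show ?thesis .
qed

lemma bounded_interval_subset:
  fixes B :: "('a::metric_space \<times> real) set"
  assumes "bounded B" obtains n :: nat where "B \<subseteq> UNIV \<times> {- real n..real n}"
proof -
  have "bounded (snd ` B)" using assms by (rule bounded_snd)
  then obtain r where r: "\<And>z. z \<in> B \<Longrightarrow> \<bar>snd z\<bar> \<le> r" unfolding bounded_iff by auto
  obtain n :: nat where "r \<le> real n" using real_arch_simple by blast
  then have "B \<subseteq> UNIV \<times> {- real n..real n}" using r by (force simp: abs_le_iff)
  then show ?thesis by (rule that)
qed

lemma distinct_pairs_time_shift:
  fixes \<xi> :: "('a::metric_space \<times> real) measure"
  assumes "\<xi> \<in> point_measures"
  shows "distinct_pairs (time_shift s \<xi>) (marked_pairs A T) =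
    distinct_pairs \<xi> (marked_pairs A {(t, t'). (t + s, t' + s) \<in> T})"
proof -
  obtain I :: "nat set" and p where \<xi>: "\<xi> = distr (count_space I) borel p" using assms by (rule point_measuresE)
  then have "time_shift s \<xi> = distr (count_space I) borel (tshift s \<circ> p)"
    unfolding time_shift_eq by (simp add: distr_distr)
  then show ?thesis unfolding \<xi>
    by (simp add: distinct_pairs_distr_count_space marked_pairs_def tshift_def split_beta)
qed

lemma distinct_pairs_swap:
  fixes \<xi> :: "'b::t1_space measure"
  assumes "\<xi> \<in> point_measures"
  shows "distinct_pairs \<xi> {(x, y). (y, x) \<in> D} = distinct_pairs \<xi> D"
proof -
  obtain I :: "nat set" and p where \<xi>: "\<xi> = distr (count_space I) borel p" using assms by (rule point_measuresE)
  have "bij_betw prod.swap {(i, j). i \<in> I \<and> j \<in> I \<and> i \<noteq> j \<and> (p i, p j) \<in> {(x, y). (y, x) \<in> D}}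
     {(i, j). i \<in> I \<and> j \<in> I \<and> i \<noteq> j \<and> (p i, p j) \<in> D}"
    by (auto simp: bij_betw_def inj_on_def image_iff)
  from emeasure_count_space_bij_betw[OF this] show ?thesis
    unfolding \<xi> by (simp add: distinct_pairs_distr_count_space)
qed

text \<open>A Borel set of measure 0 contains no enumerated point at all, so the set of pairs may be
  altered there.\<close>

lemma distinct_pairs_cong_null:
  fixes \<xi> :: "'b::t1_space measure"
  assumes \<xi>: "\<xi> \<in> point_measures" and F: "F \<in> sets borel" "emeasure \<xi> F = 0"
    and eq: "\<And>x y. x \<notin> F \<Longrightarrow> y \<notin> F \<Longrightarrow> (x, y) \<in> D \<longleftrightarrow> (x, y) \<in> D'"
  shows "distinct_pairs \<xi> D = distinct_pairs \<xi> D'"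
proof -
  obtain I :: "nat set" and p where p: "\<xi> = distr (count_space I) borel p" using \<xi> by (rule point_measuresE)
  have "emeasure (count_space UNIV) {i\<in>I. p i \<in> F} = 0"
    using F unfolding p by (simp add: emeasure_distr_count_space)
  then have "\<And>i. i \<in> I \<Longrightarrow> p i \<notin> F"
    by (auto simp: emeasure_count_space_eq_0)
  then have "{(i, j). i \<in> I \<and> j \<in> I \<and> i \<noteq> j \<and> (p i, p j) \<in> D} = {(i, j). i \<in> I \<and> j \<in> I \<and> i \<noteq> j \<and> (p i, p j) \<in> D'}"
    using eq by blast
  then show ?thesis unfolding p by (simp add: distinct_pairs_distr_count_space)
qed

lemma factorial_moment2_finite:
  fixes X :: "'w \<Rightarrow> ('a::{metric_space, second_countable_topology} \<times> real) measure"
  assumes L2: "L2_process M X" and X: "\<And>w. w \<in> space M \<Longrightarrow> X w \<in> point_measures"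
    and A: "A \<in> sets borel" "bounded A" and I: "I \<in> sets borel" "bounded I" and J: "J \<in> sets borel" "bounded J"
  shows "factorial_moment2 M X A (I \<times> J) < \<infinity>"
proof -
  have AI: "A \<times> I \<in> sets borel" and AJ: "A \<times> J \<in> sets borel"
    using pair_measureI[OF A(1) I(1)] pair_measureI[OF A(1) J(1)] unfolding borel_prod by auto
  have D: "(A \<times> I) \<times> (A \<times> J) \<in> sets borel"
    using pair_measureI[OF AI AJ] unfolding borel_prod .
  have "factorial_moment2 M X A (I \<times> J) \<le> moment2 M X ((A \<times> I) \<times> (A \<times> J))"
    unfolding factorial_moment2_marked_pairs moment2_def marked_pairs_times
  proof (rule nn_integral_mono)
    fix w assume "w \<in> space M"
    then have \<xi>: "X w \<in> point_measures" by (rule X)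
    have "distinct_pairs (X w) ((A \<times> I) \<times> (A \<times> J)) \<le> emeasure (X w) (A \<times> I) * emeasure (X w) (A \<times> J)"
      by (rule distinct_pairs_le[OF \<xi> AI AJ])
    also have "\<dots> = (\<integral>\<^sup>+p. emeasure (X w) (A \<times> J) * indicator (A \<times> I) p \<partial>X w)"
      using AI \<xi> by (subst nn_integral_cmult_indicator) (auto simp: mult.commute)
    also have "\<dots> = (\<integral>\<^sup>+p. emeasure (X w) (Pair p -` ((A \<times> I) \<times> (A \<times> J))) \<partial>X w)"
      by (intro nn_integral_cong) (auto simp: indicator_def vimage_def)
    finally show "distinct_pairs (X w) ((A \<times> I) \<times> (A \<times> J)) \<le> (\<integral>\<^sup>+p. emeasure (X w) (Pair p -` ((A \<times> I) \<times> (A \<times> J))) \<partial>X w)" .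
  qed
  also have "\<dots> < \<infinity>"
    using L2 D A I J unfolding L2_process_def by (auto intro!: bounded_Times)
  finally show ?thesis .
qed

context observed_cluster_process
begin

section \<open>Moments of the cluster kernel: shifts, causality, sigma-finiteness\<close>

abbreviation cl1 :: "'a \<times> real \<Rightarrow> ('a \<times> real) set \<Rightarrow> ennreal" where
  "cl1 z \<equiv> moment1 (P z) (\<lambda>\<xi>. \<xi>)"

abbreviation cl2 :: "'a \<times> real \<Rightarrow> 'a set \<Rightarrow> (real \<times> real) set \<Rightarrow> ennreal" where
  "cl2 z \<equiv> factorial_moment2 (P z) (\<lambda>\<xi>. \<xi>)"

lemma nn_integral_\<nu>:
  assumes f: "f \<in> borel_measurable borel"
  shows "(\<integral>\<^sup>+z. f z \<partial>\<nu>) = (\<integral>\<^sup>+y. (\<integral>\<^sup>+s. f (y, s) \<partial>lborel) \<partial>\<Lambda>)"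
proof -
  have "f \<in> borel_measurable \<nu>" using f by simp
  then show ?thesis unfolding \<nu>_def by (rule lborel.nn_integral_fst[symmetric])
qed

lemma cl1_eq: "cl1 z B = cluster_mean (\<lambda>\<xi>. emeasure \<xi> B) z"
  by (simp add: moment1_def cluster_mean_def)

lemma cl2_eq: "cl2 z A T = cluster_mean (\<lambda>\<xi>. distinct_pairs \<xi> (marked_pairs A T)) z"
  by (simp add: factorial_moment2_marked_pairs cluster_mean_def)

lemma measurable_cl1: "B \<in> sets borel \<Longrightarrow> (\<lambda>z. cl1 z B) \<in> borel_measurable borel"
  unfolding cl1_eq by (intro measurable_cluster_mean measurable_emeasure_counting_algebra)

lemma measurable_cl2:
  "A \<in> sets borel \<Longrightarrow> T \<in> sets borel \<Longrightarrow> (\<lambda>z. cl2 z A T) \<in> borel_measurable borel"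
  unfolding cl2_eq by (intro measurable_cluster_mean distinct_pairs_measurable sets_marked_pairs)

lemma kernel_point_measures: "\<xi> \<in> space (P z) \<Longrightarrow> \<xi> \<in> point_measures"
  by (simp add: space_counting_algebra)

lemma cl1_shift:
  assumes B: "B \<in> sets borel"
  shows "cl1 (y, s) B = cl1 (y, 0) (tshift s -` B)"
proof -
  have "cl1 (y, s) B = cluster_mean (\<lambda>\<xi>. emeasure \<xi> B) (tshift s (y, 0))"
    by (simp add: cl1_eq tshift_def)
  also have "\<dots> = cluster_mean (\<lambda>\<xi>. emeasure (time_shift s \<xi>) B) (y, 0)"
    using B by (intro cluster_mean_shift measurable_emeasure_counting_algebra)
  also have "\<dots> = cl1 (y, 0) (tshift s -` B)"
    unfolding cl1_eq cluster_mean_def using B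
    by (intro nn_integral_cong emeasure_time_shift) (auto dest: kernel_point_measures simp: space_counting_algebra)
  finally show ?thesis .
qed

lemma cl2_shift:
  assumes A: "A \<in> sets borel" and T: "T \<in> sets borel"
  shows "cl2 (y, s) A T = cl2 (y, 0) A {(t, t'). (t + s, t' + s) \<in> T}"
proof -
  have "cl2 (y, s) A T = cluster_mean (\<lambda>\<xi>. distinct_pairs \<xi> (marked_pairs A T)) (tshift s (y, 0))"
    by (simp add: cl2_eq tshift_def)
  also have "\<dots> = cluster_mean (\<lambda>\<xi>. distinct_pairs (time_shift s \<xi>) (marked_pairs A T)) (y, 0)"
    using A T by (intro cluster_mean_shift distinct_pairs_measurable sets_marked_pairs)
  also have "\<dots> = cl2 (y, 0) A {(t, t'). (t + s, t' + s) \<in> T}"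
    unfolding cl2_eq cluster_mean_def
    by (intro nn_integral_cong distinct_pairs_time_shift) (auto simp: space_counting_algebra)
  finally show ?thesis .
qed

text \<open>Counts are integers or infinite, so failing to be at least 1 means being 0.\<close>

lemma AE_causal: "AE \<xi> in P (y, 0). emeasure \<xi> (UNIV \<times> {..<0}) = 0"
proof -
  have B: "UNIV \<times> {..<0::real} \<in> sets (borel :: ('a \<times> real) measure)" by (rule times_borel) auto
  let ?E = "{\<xi> \<in> space counting_algebra. emeasure \<xi> (UNIV \<times> {..<0::real}) \<ge> 1}"
  have "?E \<in> sets (counting_algebra :: ('a \<times> real) measure measure)"
    using measurable_emeasure_counting_algebra[OF B] by measurable
  then have "?E \<in> null_sets (P (y, 0))"
    using causal by (auto simp: causal_def null_sets_def)
  then have "AE \<xi> in P (y, 0). \<xi> \<notin> ?E" by (rule AE_not_in)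
  with AE_space show ?thesis
  proof eventually_elim
    case (elim \<xi>)
    then have "\<xi> \<in> point_measures" "\<not> emeasure \<xi> (UNIV \<times> {..<0}) \<ge> 1" by (auto simp: space_counting_algebra)
    then show ?case
      using point_measure_values[of \<xi> "UNIV \<times> {..<0}"]
      by (metis infinity_ennreal_def top_greatest less_one linorder_not_le of_nat_0 of_nat_1 of_nat_le_iff)
  qed
qed

lemma cl1_causal:
  assumes A: "A \<in> sets borel"
  shows "cl1 (y, 0) (A \<times> {0..}) = cl1 (y, 0) (A \<times> UNIV)"
  unfolding moment1_def
proof (rule nn_integral_cong_AE)
  show "AE \<xi> in P (y, 0). emeasure \<xi> (A \<times> {0..}) = emeasure \<xi> (A \<times> UNIV)"
    using AE_causal AE_space
  proof eventually_elim
    case (elim \<xi>)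
    then have [simp]: "sets \<xi> = sets borel" by (auto simp: space_counting_algebra)
    have s: "A \<times> {0::real..} \<in> sets borel" "A \<times> {..<0::real} \<in> sets borel" "UNIV \<times> {..<0::real} \<in> sets (borel :: ('a \<times> real) measure)"
      using A by (auto intro!: times_borel)
    have "emeasure \<xi> (A \<times> {..<0}) \<le> emeasure \<xi> (UNIV \<times> {..<0})"
      by (rule emeasure_mono) (use s(3) in auto)
    then have "emeasure \<xi> (A \<times> {..<0}) = 0" using elim by simp
    moreover have "emeasure \<xi> (A \<times> {0..}) + emeasure \<xi> (A \<times> {..<0}) = emeasure \<xi> (A \<times> UNIV)"
    proof (subst plus_emeasure)
      show "A \<times> {0..} \<in> sets \<xi>" "A \<times> {..<0} \<in> sets \<xi>" using s by auto
      have "A \<times> {0..} \<union> A \<times> {..<0} = A \<times> (UNIV :: real set)" by auto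
      then show "emeasure \<xi> (A \<times> {0..} \<union> A \<times> {..<0}) = emeasure \<xi> (A \<times> UNIV)" by (rule arg_cong)
    qed auto
    ultimately show ?case by simp
  qed
qed

text \<open>Almost surely no point of the cluster has negative time, so both sets contain the same
  pairs of its points.\<close>

lemma cl2_causal: "cl2 (y, 0) A (phi -` ({0..} \<times> V)) = cl2 (y, 0) A (phi -` (UNIV \<times> V))"
  unfolding factorial_moment2_marked_pairs
proof (rule nn_integral_cong_AE)
  have B: "UNIV \<times> {..<0::real} \<in> sets (borel :: ('a \<times> real) measure)" by (rule times_borel) auto
  show "AE \<xi> in P (y, 0). distinct_pairs \<xi> (marked_pairs A (phi -` ({0..} \<times> V))) =
      distinct_pairs \<xi> (marked_pairs A (phi -` (UNIV \<times> V)))"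
    using AE_causal AE_space
  proof eventually_elim
    case (elim \<xi>)
    show ?case
      using elim by (intro distinct_pairs_cong_null[OF _ B])
        (auto simp: space_counting_algebra marked_pairs_def phi_def)
  qed
qed

lemma bounded_subset_XX: "A \<subseteq> XX \<Longrightarrow> bounded A"
  using XX(2) bounded_subset by blast

text \<open>The moment functions of the kernel become measures, sigma-finite by
  \<open>kernel_L2\<close>, so that Tonelli applies to them.\<close>

lemma cl_measures:
  assumes A: "A \<in> sets borel" "bounded A"
  shows "T \<in> sets borel \<Longrightarrow> emeasure (factorial_measure2 (P z) (\<lambda>\<xi>. \<xi>) A) T = cl2 z A T"
    and "B \<in> sets borel \<Longrightarrow> emeasure (mean_measure (P z) (\<lambda>\<xi>. \<xi>)) B = cl1 z B"
    and "sigma_finite_measure (factorial_measure2 (P z) (\<lambda>\<xi>. \<xi>) A)"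
    and "sigma_finite_measure (mean_measure (P z) (\<lambda>\<xi>. \<xi>))"
proof -
  have id: "(\<lambda>\<xi>. \<xi>) \<in> P z \<rightarrow>\<^sub>M counting_algebra"
    by (simp add: measurable_kernel_cong)
  show 1: "emeasure (factorial_measure2 (P z) (\<lambda>\<xi>. \<xi>) A) T = cl2 z A T" if "T \<in> sets borel" for T
    using id A(1) that by (rule emeasure_factorial_measure2)
  show 2: "emeasure (mean_measure (P z) (\<lambda>\<xi>. \<xi>)) B = cl1 z B" if "B \<in> sets borel" for B
    using that by (intro emeasure_mean_measure) (auto simp: measurable_kernel_cong space_counting_algebra)
  have L2: "L2_process (P z) (\<lambda>\<xi>. \<xi>)" using kernel_L2[of "fst z" "snd z"] by simp
  have "locally_finite (mean_measure (P z) (\<lambda>\<xi>. \<xi>))"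
    using L2 by (auto simp: locally_finite_def L2_process_def 2)
  then show "sigma_finite_measure (mean_measure (P z) (\<lambda>\<xi>. \<xi>))" by (rule locally_finite_sigma_finite)
  have "locally_finite (factorial_measure2 (P z) (\<lambda>\<xi>. \<xi>) A)"
    unfolding locally_finite_def
  proof (intro conjI ballI impI)
    fix B :: "(real \<times> real) set" assume B: "B \<in> sets borel" "bounded B"
    have I: "fst ` B \<subseteq> cball 0 r \<and> snd ` B \<subseteq> cball 0 r" if "B \<subseteq> cball 0 r" for r
      using that by (force simp: norm_Pair intro: order_trans[OF real_sqrt_sum_squares_ge1] order_trans[OF real_sqrt_sum_squares_ge2])
    obtain r where "B \<subseteq> cball 0 r" using bounded_subset_ballD[OF B(2)] ball_subset_cball by blast
    \<comment> \<open>Finiteness has been derived on rectangles, so a bounded planar set is enclosed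
      in a square.\<close>
    with I have "B \<subseteq> cball 0 r \<times> cball (0::real) r" by force
    then have "emeasure (factorial_measure2 (P z) (\<lambda>\<xi>. \<xi>) A) B \<le> emeasure (factorial_measure2 (P z) (\<lambda>\<xi>. \<xi>) A) (cball 0 r \<times> cball 0 r)"
      by (intro emeasure_mono) (auto intro!: closed_Times borel_closed)
    also have "\<dots> = cl2 z A (cball 0 r \<times> cball 0 r)"
      by (intro 1) (auto intro!: closed_Times borel_closed)
    also have "\<dots> < \<infinity>"
      by (intro factorial_moment2_finite[OF L2] A) (auto simp: space_counting_algebra)
    finally show "emeasure (factorial_measure2 (P z) (\<lambda>\<xi>. \<xi>) A) B < \<infinity>" .
  qed simp
  then show "sigma_finite_measure (factorial_measure2 (P z) (\<lambda>\<xi>. \<xi>) A)" by (rule locally_finite_sigma_finite)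
qed

text \<open>All times are allowed instead of nonnegative ones: causality gives the same value, and
  in this form the translation argument applies directly.\<close>

definition intensity :: "'a set \<Rightarrow> ennreal" where
  "intensity A = (\<integral>\<^sup>+y. cl1 (y, 0) (A \<times> UNIV) \<partial>\<Lambda>)"

text \<open>The time of the first point is left free, so that \<open>V\<close> records the lag
  alone; this is what makes the reflection of lags possible. Causality links it to the condition of
  the theorem.\<close>

definition lag :: "'a set \<Rightarrow> real set \<Rightarrow> ennreal" where
  "lag A V = (\<integral>\<^sup>+y. cl2 (y, 0) A (phi -` (UNIV \<times> V)) \<partial>\<Lambda>)"

section \<open>First and second moments of the observed process\<close>

lemma moment1_\<Xi>:
  assumes B: "B \<in> sets borel"
  shows "moment1 M \<Xi> B = (\<integral>\<^sup>+z. cl1 z (B \<inter> G) \<partial>\<nu>)"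
proof -
  have "moment1 M \<Xi> B = (\<integral>\<^sup>+w. (csum w (\<lambda>i. emeasure (C i w) (B \<inter> G))) \<partial>M)"
    unfolding moment1_def using B by (intro nn_integral_cong emeasure_\<Xi>)
  also have "\<dots> = (\<integral>\<^sup>+z. cl1 z (B \<inter> G) \<partial>\<nu>)"
    unfolding cl1_eq using B by (intro cluster_campbell measurable_emeasure_counting_algebra) auto
  finally show ?thesis .
qed

text \<open>A centre at time s produces in law the time-0 cluster translated by s, so integrating
  over s averages the translates of a fixed mean measure.\<close>

lemma cl1_window:
  assumes A: "A \<in> sets borel" and T: "T \<in> sets borel"
  shows "(\<integral>\<^sup>+z. cl1 z (A \<times> T) \<partial>\<nu>) = intensity A * emeasure lborel T"
proof -
  have AT: "A \<times> T \<in> sets borel" "A \<times> (UNIV :: real set) \<in> sets borel" using A T by (auto intro: times_borel)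
  have "(\<integral>\<^sup>+s. cl1 (y, s) (A \<times> T) \<partial>lborel) = emeasure lborel T * cl1 (y, 0) (A \<times> UNIV)" for y
  proof -
    let ?q = "mean_measure (P (y, 0)) (\<lambda>\<xi>. \<xi>)"
    have "(\<integral>\<^sup>+s. cl1 (y, s) (A \<times> T) \<partial>lborel) = (\<integral>\<^sup>+s. emeasure ?q {x \<in> A \<times> UNIV. snd x + s \<in> T} \<partial>lborel)"
    proof (intro nn_integral_cong)
      fix s
      have "cl1 (y, s) (A \<times> T) = emeasure ?q (tshift s -` (A \<times> T))"
        using AT vimage_shift_borel[OF AT(1)] cl_measures(2)[of "{}"] by (subst cl1_shift) auto
      also have "tshift s -` (A \<times> T) = {x \<in> A \<times> UNIV. snd x + s \<in> T}" by (auto simp: tshift_def)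
      finally show "cl1 (y, s) (A \<times> T) = emeasure ?q {x \<in> A \<times> UNIV. snd x + s \<in> T}" .
    qed
    also have "\<dots> = emeasure lborel T * emeasure ?q (A \<times> UNIV)"
    proof (rule nn_integral_translates)
      show "sigma_finite_measure ?q" by (rule cl_measures(4)[of "{}"]) auto
      have "(snd :: 'a \<times> real \<Rightarrow> real) \<in> borel_measurable borel"
        by (intro borel_measurable_continuous_onI continuous_intros)
      then show "snd \<in> borel_measurable ?q" by (simp add: measurable_cong_sets[OF sets_mean_measure refl])
    qed (use AT T in auto)
    also have "emeasure ?q (A \<times> UNIV) = cl1 (y, 0) (A \<times> UNIV)"
      using AT by (intro cl_measures(2)[of "{}"]) auto
    finally show ?thesis .
  qed
  moreover have "(\<lambda>y. cl1 (y, 0) (A \<times> UNIV)) \<in> borel_measurable \<Lambda>"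
    using measurable_compose[OF _ measurable_cl1[OF AT(2)], of "\<lambda>y. (y, 0)"]
    by (simp add: borel_measurable_continuous_onI continuous_on_Pair)
  ultimately show ?thesis
    using AT by (simp add: nn_integral_\<nu> measurable_cl1 nn_integral_cmult intensity_def mult.commute)
qed

lemma moment1_\<Xi>_times:
  assumes A: "A \<in> sets borel" and T: "T \<in> sets borel"
  shows "moment1 M \<Xi> (A \<times> T) = intensity (A \<inter> XX) * emeasure lborel T"
proof -
  have "A \<times> T \<inter> G = (A \<inter> XX) \<times> T" by (auto simp: G_def)
  then show ?thesis using A T XX by (simp add: moment1_\<Xi> times_borel cl1_window)
qed

lemma measurable_phi [measurable]: "phi \<in> borel \<rightarrow>\<^sub>M borel"
  unfolding phi_def split_beta by (intro borel_measurable_continuous_onI continuous_intros)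

lemma vimage_phi_borel: "S \<in> sets borel \<Longrightarrow> phi -` S \<in> sets borel"
  using measurable_sets[OF measurable_phi, of S] by simp

lemma real_times_borel: "U \<in> sets borel \<Longrightarrow> V \<in> sets borel \<Longrightarrow> U \<times> V \<in> sets (borel :: (real \<times> real) measure)"
  using pair_measureI[of U borel V borel] unfolding borel_prod by simp

lemma measurable_cl2_0:
  "A \<in> sets borel \<Longrightarrow> T \<in> sets borel \<Longrightarrow> (\<lambda>y. cl2 (y, 0) A T) \<in> borel_measurable \<Lambda>"
  using measurable_compose[OF _ measurable_cl2, of "\<lambda>y. (y, 0)"]
  by (simp add: borel_measurable_continuous_onI continuous_on_Pair)

lemma cl2_window:
  assumes A: "A \<in> sets borel" "bounded A" and U: "U \<in> sets borel" and V: "V \<in> sets borel"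
  shows "(\<integral>\<^sup>+z. cl2 z A (phi -` (U \<times> V)) \<partial>\<nu>) = emeasure lborel U * lag A V"
proof -
  have UV: "phi -` (U \<times> V) \<in> sets borel" "phi -` (UNIV \<times> V) \<in> sets borel"
    using U V by (auto intro!: vimage_phi_borel real_times_borel)
  have "(\<integral>\<^sup>+s. cl2 (y, s) A (phi -` (U \<times> V)) \<partial>lborel) = emeasure lborel U * cl2 (y, 0) A (phi -` (UNIV \<times> V))" for y
  proof -
    let ?q = "factorial_measure2 (P (y, 0)) (\<lambda>\<xi>. \<xi>) A"
    have fst_m: "(fst :: real \<times> real \<Rightarrow> real) \<in> borel_measurable borel"
      by (intro borel_measurable_continuous_onI continuous_intros)
    have "(\<integral>\<^sup>+s. cl2 (y, s) A (phi -` (U \<times> V)) \<partial>lborel) = (\<integral>\<^sup>+s. emeasure ?q {x \<in> phi -` (UNIV \<times> V). fst x + s \<in> U} \<partial>lborel)"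
    proof (intro nn_integral_cong)
      fix s
      \<comment> \<open>Shifting both points moves the first time by s and leaves the lag unchanged:
        after \<open>phi\<close> only the first coordinate is translated.\<close>
      have S: "{(t, t'). (t + s, t' + s) \<in> phi -` (U \<times> V)} = {x \<in> phi -` (UNIV \<times> V). fst x + s \<in> U}"
        by (auto simp: phi_def)
      have "(\<lambda>x. fst x + s) -` U \<inter> space borel \<in> sets (borel :: (real \<times> real) measure)"
        using fst_m U by (intro measurable_sets[of _ borel borel]) auto
      then have "phi -` (UNIV \<times> V) \<inter> (\<lambda>x. fst x + s) -` U \<in> sets borel"
        using UV(2) by auto
      also have "phi -` (UNIV \<times> V) \<inter> (\<lambda>x. fst x + s) -` U = {x \<in> phi -` (UNIV \<times> V). fst x + s \<in> U}" by auto
      finally show "cl2 (y, s) A (phi -` (U \<times> V)) = emeasure ?q {x \<in> phi -` (UNIV \<times> V). fst x + s \<in> U}"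
        by (simp only: cl2_shift[OF A(1) UV(1)] S cl_measures(1)[OF A])
    qed
    also have "\<dots> = emeasure lborel U * emeasure ?q (phi -` (UNIV \<times> V))"
    proof (rule nn_integral_translates)
      show "fst \<in> borel_measurable ?q"
        using fst_m by (simp add: measurable_cong_sets[OF sets_factorial_measure2 refl])
    qed (use UV U A cl_measures(3) in auto)
    also have "emeasure ?q (phi -` (UNIV \<times> V)) = cl2 (y, 0) A (phi -` (UNIV \<times> V))"
      using UV A by (intro cl_measures(1)) auto
    finally show ?thesis .
  qed
  then show ?thesis
    using UV A by (simp add: nn_integral_\<nu> measurable_cl2 measurable_cl2_0 nn_integral_cmult lag_def)
qed

lemma \<Xi>_distinct_pairs:
  assumes w: "w \<in> space M" and B: "B1 \<in> sets borel" "B2 \<in> sets borel" "B1 \<subseteq> G" "B2 \<subseteq> G"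
  shows "distinct_pairs (\<Xi> w) (B1 \<times> B2) =
    (csum w (\<lambda>i. distinct_pairs (C i w) (B1 \<times> B2))) +
    (csum w (\<lambda>i. (csum w (\<lambda>j. of_bool (i \<noteq> j) * (emeasure (C i w) B1 * emeasure (C j w) B2)))))"
  by (rule superposition_point_measures(2)[where K="idx w" and \<xi>="\<lambda>i. C i w" and G=G])
    (auto simp: C_point_measure emeasure_\<Xi> w B)

lemma measurable_distinct_pairs_C:
  assumes "B1 \<in> sets borel" "B2 \<in> sets borel"
  shows "(\<lambda>w. distinct_pairs (C i w) (B1 \<times> B2)) \<in> borel_measurable M"
  using assms by (intro measurable_compose[OF C_measurable distinct_pairs_measurable] pair_measureI)

lemma measurable_\<Xi>_distinct_pairs:
  assumes B: "B1 \<in> sets borel" "B2 \<in> sets borel" "B1 \<subseteq> G" "B2 \<subseteq> G"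
  shows "(\<lambda>w. distinct_pairs (\<Xi> w) (B1 \<times> B2)) \<in> borel_measurable M"
proof -
  note measurable_distinct_pairs_C[OF B(1,2), measurable] B(1,2)[measurable]
  have "(\<lambda>w. (csum w (\<lambda>i. distinct_pairs (C i w) (B1 \<times> B2))) +
    (csum w (\<lambda>i. (csum w (\<lambda>j. of_bool (i \<noteq> j) * (emeasure (C i w) B1 * emeasure (C j w) B2))))))
    \<in> borel_measurable M"
    by measurable
  then show ?thesis by (subst measurable_cong[OF \<Xi>_distinct_pairs[OF _ B]]) auto
qed

text \<open>The identity holds in \<open>ennreal\<close> whether or not the moments are finite, so
  it serves both to derive the integral conditions and to conclude from them.\<close>

lemma factorial_moment2_\<Xi>_times:
  assumes A: "A \<in> sets borel" "A \<subseteq> XX" and I: "I \<in> sets borel" and J: "J \<in> sets borel"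
  shows "factorial_moment2 M \<Xi> A (I \<times> J) =
    (intensity A * emeasure lborel I) * (intensity A * emeasure lborel J) + (\<integral>\<^sup>+z. cl2 z A (I \<times> J) \<partial>\<nu>)"
proof -
  have B: "A \<times> I \<in> sets borel" "A \<times> J \<in> sets borel" "A \<times> I \<subseteq> G" "A \<times> J \<subseteq> G"
    using A I J by (auto intro: times_borel simp: G_def)
  note measurable_distinct_pairs_C[OF B(1,2), measurable] B(1,2)[measurable]
  have d: "(\<lambda>\<xi>. distinct_pairs \<xi> ((A \<times> I) \<times> A \<times> J)) \<in> borel_measurable counting_algebra"
    using B by (intro distinct_pairs_measurable pair_measureI)
  have "factorial_moment2 M \<Xi> A (I \<times> J) = (\<integral>\<^sup>+w. distinct_pairs (\<Xi> w) ((A \<times> I) \<times> (A \<times> J)) \<partial>M)"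
    by (simp only: factorial_moment2_marked_pairs marked_pairs_times)
  also have "\<dots> = (\<integral>\<^sup>+w. (csum w (\<lambda>i. distinct_pairs (C i w) ((A \<times> I) \<times> (A \<times> J)))) +
    (csum w (\<lambda>i. (csum w (\<lambda>j. of_bool (i \<noteq> j) * (emeasure (C i w) (A \<times> I) * emeasure (C j w) (A \<times> J)))))) \<partial>M)"
    by (intro nn_integral_cong \<Xi>_distinct_pairs B)
  also have "\<dots> = (\<integral>\<^sup>+w. (csum w (\<lambda>i. distinct_pairs (C i w) ((A \<times> I) \<times> (A \<times> J)))) \<partial>M) +
    (\<integral>\<^sup>+w. (csum w (\<lambda>i. (csum w (\<lambda>j. of_bool (i \<noteq> j) * (emeasure (C i w) (A \<times> I) * emeasure (C j w) (A \<times> J)))))) \<partial>M)"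
    by (rule nn_integral_add) measurable
  also have "\<dots> = (\<integral>\<^sup>+z. cl1 z (A \<times> I) \<partial>\<nu>) * (\<integral>\<^sup>+z. cl1 z (A \<times> J) \<partial>\<nu>) + (\<integral>\<^sup>+z. cl2 z A (I \<times> J) \<partial>\<nu>)"
    unfolding cl2_eq cl1_eq marked_pairs_times
    using d B by (subst add.commute)
      (intro arg_cong2[where f="(+)"] cluster_campbell cluster_campbell_pairs measurable_emeasure_counting_algebra)
  finally show ?thesis using A I J by (simp add: cl1_window)
qed

text \<open>Swapping the two points of a pair changes the sign of its lag and preserves the number
  of pairs.\<close>

lemma lag_reflect:
  assumes A: "A \<in> sets borel" and V: "V \<in> sets borel"
  shows "lag A (uminus -` V) = lag A V"
  unfolding lag_def
proof (intro nn_integral_cong)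
  fix y
  have "marked_pairs A (phi -` (UNIV \<times> (uminus -` V))) = {(p, q). (q, p) \<in> marked_pairs A (phi -` (UNIV \<times> V))}"
    by (auto simp: marked_pairs_def phi_def)
  then show "cl2 (y, 0) A (phi -` (UNIV \<times> (uminus -` V))) = cl2 (y, 0) A (phi -` (UNIV \<times> V))"
    unfolding factorial_moment2_marked_pairs
    by (simp only:) (intro nn_integral_cong distinct_pairs_swap kernel_point_measures)
qed

end

section \<open>Intensity and reduced covariance measures\<close>

lemma null_measure_point_measure: "null_measure (borel :: 'b::topological_space measure) \<in> point_measures"
proof -
  have "null_measure (borel :: 'b measure) = distr (count_space ({} :: nat set)) borel (\<lambda>_. undefined)"
    by (rule measure_eqI) (auto simp: emeasure_distr_count_space)
  then show ?thesis by (simp add: distr_count_space_in_point_measures)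
qed

lemma locally_finite_eqI:
  fixes p q :: "'b::metric_space measure"
  assumes p: "locally_finite p" and q: "locally_finite q"
    and eq: "\<And>B. B \<in> sets borel \<Longrightarrow> bounded B \<Longrightarrow> emeasure p B = emeasure q B"
  shows "p = q"
proof (rule measure_eqI)
  show "sets p = sets q" using p q by (simp add: locally_finite_def)
  fix B assume "B \<in> sets p"
  then have B: "B \<in> sets borel" using p by (simp add: locally_finite_def)
  let ?B = "\<lambda>n::nat. B \<inter> ball (undefined :: 'b) (real n)"
  have U: "(\<Union>n. ?B n) = B"
  proof -
    have "\<exists>n. x \<in> ball (undefined :: 'b) (real n)" for x
      using reals_Archimedean2[of "dist undefined x"] by auto
    then show ?thesis by auto
  qed
  have B': "?B n \<in> sets borel" "bounded (?B n)" for n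
    using B by (auto intro: bounded_subset[OF bounded_ball])
  have inc: "incseq ?B" by (auto simp: mono_def)
  have *: "emeasure r B = (SUP n. emeasure r (?B n))" if "locally_finite r" for r
  proof -
    have "range ?B \<subseteq> sets r" using B' that by (auto simp: locally_finite_def)
    from SUP_emeasure_incseq[OF this inc] show ?thesis by (simp only: U)
  qed
  show "emeasure p B = emeasure q B" using p q B' by (simp add: * eq)
qed

text \<open>In a competing decomposition p, n the measure p vanishes off H, so there minus n equals
  the nonnegative \<open>g\<close> and n vanishes too; on H it vanishes by mutual singularity. Hence
  n is 0 on bounded sets, and p is the given measure.\<close>

lemma jordan_pos_measure:
  fixes \<kappa> :: "'b::metric_space measure"
  assumes \<kappa>: "locally_finite \<kappa>"
    and g: "\<And>S. S \<in> sets borel \<Longrightarrow> bounded S \<Longrightarrow> g S = measure \<kappa> S"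
  shows "jordan_pos g = \<kappa>"
  unfolding jordan_pos_def
proof (rule the_equality)
  have "jordan_decomposition g \<kappa> (null_measure borel)"
    using \<kappa> g by (auto simp: jordan_decomposition_def locally_finite_def measure_def intro!: bexI[of _ UNIV])
  then show "\<exists>n. jordan_decomposition g \<kappa> n" ..
  fix p assume "\<exists>n. jordan_decomposition g p n"
  then obtain n H where p: "locally_finite p" and n: "locally_finite n"
    and H: "H \<in> sets borel" "emeasure p (- H) = 0" "emeasure n H = 0"
    and d: "\<And>S. S \<in> sets borel \<Longrightarrow> bounded S \<Longrightarrow> g S = measure p S - measure n S"
    unfolding jordan_decomposition_def by blast
  have sets [simp]: "sets p = sets borel" "sets n = sets borel" "sets \<kappa> = sets borel"
    using p n \<kappa> by (simp_all add: locally_finite_def)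
  have fin: "emeasure r S \<noteq> top" if "locally_finite r" "S \<in> sets borel" "bounded S" for r and S :: "'b set"
    using that unfolding locally_finite_def by (metis infinity_ennreal_def less_irrefl)
  show "p = \<kappa>"
  proof (rule locally_finite_eqI[OF p \<kappa>])
    fix S :: "'b set" assume S: "S \<in> sets borel" "bounded S"
    have S': "S \<inter> - H \<in> sets borel" "bounded (S \<inter> - H)" "- H \<in> sets borel"
      using S H(1) by (auto intro: bounded_subset)
    have "emeasure p (S \<inter> - H) \<le> emeasure p (- H)" using S'(3) by (intro emeasure_mono) auto
    then have "measure p (S \<inter> - H) = 0" using H by (simp add: measure_def)
    then have "measure n (S \<inter> - H) \<le> 0"
      using d[OF S'(1,2)] g[OF S'(1,2)] measure_nonneg[of \<kappa> "S \<inter> - H"] by linarith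
    then have "emeasure n (S \<inter> - H) = 0"
      using fin[OF n S'(1,2)] by (simp add: emeasure_eq_ennreal_measure ennreal_neg)
    moreover have "emeasure n S \<le> emeasure n (S \<inter> - H) + emeasure n H"
    proof -
      have "emeasure n S \<le> emeasure n ((S \<inter> - H) \<union> H)" using S' H(1) by (intro emeasure_mono) auto
      also have "\<dots> \<le> emeasure n (S \<inter> - H) + emeasure n H" using S' H(1) by (intro emeasure_subadditive) auto
      finally show ?thesis .
    qed
    ultimately have "measure n S = 0" using H by (simp add: measure_def)
    then have "measure p S = measure \<kappa> S" using d[OF S] g[OF S] by simp
    then show "emeasure p S = emeasure \<kappa> S"
      using fin[OF p S] fin[OF \<kappa> S] by (simp add: emeasure_eq_ennreal_measure)
  qed
qed

text \<open>Encoded as a mixture over two indices under counting measure, so that countable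
  additivity comes from \<open>emeasure_mean_measure\<close>.\<close>

definition sum_measure :: "'b::topological_space measure \<Rightarrow> 'b measure \<Rightarrow> 'b measure" where
  "sum_measure \<mu> \<kappa> = mean_measure (count_space UNIV) (\<lambda>b::bool. if b then \<mu> else \<kappa>)"

lemma sets_sum_measure [simp]: "sets (sum_measure \<mu> \<kappa>) = sets borel"
  by (simp add: sum_measure_def)

lemma emeasure_sum_measure:
  assumes "sets \<mu> = sets borel" "sets \<kappa> = sets borel" "B \<in> sets borel"
  shows "emeasure (sum_measure \<mu> \<kappa>) B = emeasure \<mu> B + emeasure \<kappa> B"
  unfolding sum_measure_def using assms
  by (subst emeasure_mean_measure) (auto simp: moment1_def nn_integral_count_space_finite UNIV_bool)

text \<open>\<open>phi\<close> is a shear: each section of the preimage is empty or a translate of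
  \<open>V\<close>.\<close>

lemma emeasure_lborel2_phi:
  assumes U: "U \<in> sets borel" and V: "V \<in> sets borel"
  shows "emeasure (lborel \<Otimes>\<^sub>M lborel) (phi -` (U \<times> V)) = emeasure lborel U * emeasure (lborel :: real measure) V"
proof -
  have m: "phi -` (U \<times> V) \<in> sets (lborel \<Otimes>\<^sub>M lborel)"
  proof -
    have "phi \<in> borel \<rightarrow>\<^sub>M (borel :: (real \<times> real) measure)"
      unfolding phi_def split_beta by (intro borel_measurable_continuous_onI continuous_intros)
    moreover have "U \<times> V \<in> sets (borel :: (real \<times> real) measure)"
      using pair_measureI[OF U V] unfolding borel_prod .
    ultimately have "phi -` (U \<times> V) \<inter> space borel \<in> sets (borel :: (real \<times> real) measure)"
      by (rule measurable_sets)
    then show ?thesis unfolding lborel_prod by simp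
  qed
  have "emeasure (lborel \<Otimes>\<^sub>M lborel) (phi -` (U \<times> V)) = (\<integral>\<^sup>+t. emeasure lborel (Pair t -` phi -` (U \<times> V)) \<partial>lborel)"
    using m by (rule lborel.emeasure_pair_measure_alt)
  also have "\<dots> = (\<integral>\<^sup>+t. emeasure (lborel :: real measure) V * indicator U t \<partial>lborel)"
  proof (intro nn_integral_cong)
    fix t :: real
    have "Pair t -` phi -` (U \<times> V) = (if t \<in> U then (\<lambda>t'. - t + t') -` V else {})"
      by (auto simp: phi_def)
    then show "emeasure lborel (Pair t -` phi -` (U \<times> V)) = emeasure lborel V * indicator U t"
      using emeasure_lborel_translate[OF V, of "- t"] by simp
  qed
  also have "\<dots> = emeasure lborel V * emeasure lborel U"
    using U by (intro nn_integral_cmult_indicator) simp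
  finally show ?thesis by (simp only: mult.commute)
qed

context observed_cluster_process
begin

text \<open>Realises \<open>lag A\<close> as a measure, by mixing over \<open>\<Lambda>\<close> the
  images of the factorial moment measures under the time difference; monotonicity and subadditivity
  of \<open>lag\<close> are read off from it.\<close>

definition lag_measure :: "'a set \<Rightarrow> real measure" where
  "lag_measure A = mean_measure \<Lambda> (\<lambda>y. distr (factorial_measure2 (P (y, 0)) (\<lambda>\<xi>. \<xi>) A) borel (\<lambda>(t, t'). t' - t))"

lemma sets_lag_measure [simp]: "sets (lag_measure A) = sets borel"
  by (simp add: lag_measure_def)

lemma emeasure_lag_measure:
  assumes A: "A \<in> sets borel" "bounded A" and V: "V \<in> sets borel"
  shows "emeasure (lag_measure A) V = lag A V"
proof -
  let ?d = "\<lambda>y. distr (factorial_measure2 (P (y, 0)) (\<lambda>\<xi>. \<xi>) A) borel (\<lambda>(t, t'). t' - t)"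
  have diff: "(\<lambda>(t, t'). t' - t :: real) \<in> borel_measurable borel"
    unfolding split_beta by (intro borel_measurable_continuous_onI continuous_intros)
  have S: "phi -` (UNIV \<times> V) \<in> sets borel" if "V \<in> sets borel" for V
    using that by (intro vimage_phi_borel real_times_borel) auto
  have d: "emeasure (?d y) V = cl2 (y, 0) A (phi -` (UNIV \<times> V))" if V: "V \<in> sets borel" for y V
  proof -
    have "space (factorial_measure2 (P (y, 0)) (\<lambda>\<xi>. \<xi>) A) = UNIV"
      using sets_eq_imp_space_eq[OF sets_factorial_measure2] by simp
    then have "emeasure (?d y) V = emeasure (factorial_measure2 (P (y, 0)) (\<lambda>\<xi>. \<xi>) A) ((\<lambda>(t, t'). t' - t) -` V)"
      using V diff by (subst emeasure_distr) (simp_all add: measurable_cong_sets[OF sets_factorial_measure2 refl])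
    also have "(\<lambda>(t, t'). t' - t) -` V = phi -` (UNIV \<times> V)" by (auto simp: phi_def)
    finally show ?thesis using S[OF V] A by (simp add: cl_measures(1))
  qed
  have "emeasure (lag_measure A) V = moment1 \<Lambda> ?d V"
    unfolding lag_measure_def
  proof (rule emeasure_mean_measure[OF _ _ V])
    fix B :: "real set" assume "B \<in> sets borel"
    then show "(\<lambda>y. emeasure (?d y) B) \<in> borel_measurable \<Lambda>"
      using A S by (simp add: d measurable_cl2_0)
  qed simp
  then show ?thesis by (simp add: moment1_def lag_def d[OF V])
qed

lemma cl2_mono: "T \<subseteq> T' \<Longrightarrow> cl2 z A T \<le> cl2 z A T'"
  unfolding factorial_moment2_marked_pairs
  by (intro nn_integral_mono distinct_pairs_mono) (auto simp: space_counting_algebra marked_pairs_def)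

definition window :: "nat \<Rightarrow> ('a \<times> real) set" where "window n = XX \<times> {- real n..real n}"

lemma window_borel [measurable]: "window n \<in> sets borel"
  unfolding window_def using XX by (intro times_borel) auto

lemma window_subset_G: "window n \<subseteq> G" by (auto simp: window_def G_def)

lemma bounded_window: "bounded (window n)"
  unfolding window_def using XX by (intro bounded_Times) auto

text \<open>The observed process does not charge the complement of \<open>G\<close>, so bounding the
  times is enough, even where \<open>B\<close> is unbounded in space.\<close>

lemma emeasure_\<Xi>_window:
  assumes w: "w \<in> space M" and B: "B \<subseteq> UNIV \<times> {- real n..real n}"
  shows "emeasure (\<Xi> w) B \<le> emeasure (\<Xi> w) (window n)"
proof -
  let ?W = "UNIV \<times> {- real n..real n} :: ('a \<times> real) set"
  have W: "?W \<in> sets borel" by (intro times_borel) auto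
  have "emeasure (\<Xi> w) B \<le> emeasure (\<Xi> w) ?W" using B W by (intro emeasure_mono) auto
  also have "?W \<inter> G = window n \<inter> G" by (auto simp: window_def G_def)
  then have "emeasure (\<Xi> w) ?W = emeasure (\<Xi> w) (window n)"
    using W w by (simp add: emeasure_\<Xi> window_borel)
  finally show ?thesis .
qed

section \<open>Square integrability and the integral conditions\<close>

lemma intensity_finite:
  assumes L2: "L2_process M \<Xi>" and A: "A \<in> sets borel" "A \<subseteq> XX"
  shows "intensity A < \<infinity>"
proof -
  have AXX: "A \<inter> XX = A" using A by auto
  have "A \<times> {0<..1::real} \<in> sets borel" using A by (intro times_borel) auto
  moreover have "bounded (A \<times> {0<..1::real})"
    using bounded_subset_XX[OF A(2)] by (intro bounded_Times) auto
  ultimately have "moment1 M \<Xi> (A \<times> {0<..1}) < \<infinity>"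
    using L2 by (simp add: L2_process_def)
  then show ?thesis using A by (simp add: moment1_\<Xi>_times AXX)
qed

lemma lag_finite:
  assumes L2: "L2_process M \<Xi>" and A: "A \<in> sets borel" "A \<subseteq> XX"
  shows "lag A {0..t} < \<infinity>"
proof -
  have bA: "bounded A" using A bounded_subset_XX by simp
  \<comment> \<open>A first time in (0,1] and a lag in [0,t] place both points in [0,t+1]; the unit
    length of (0,1] makes its factor disappear.\<close>
  let ?I = "{0..t + 1}"
  have "lag A {0..t} = emeasure lborel {0<..1::real} * lag A {0..t}" by simp
  also have "\<dots> = (\<integral>\<^sup>+z. cl2 z A (phi -` ({0<..1} \<times> {0..t})) \<partial>\<nu>)"
    using A bA by (intro cl2_window[symmetric]) auto
  also have "\<dots> \<le> (\<integral>\<^sup>+z. cl2 z A (?I \<times> ?I) \<partial>\<nu>)"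
    by (intro nn_integral_mono cl2_mono) (auto simp: phi_def)
  also have "\<dots> \<le> factorial_moment2 M \<Xi> A (?I \<times> ?I)"
    using A by (simp add: factorial_moment2_\<Xi>_times)
  also have "\<dots> < \<infinity>"
    using A bA by (intro factorial_moment2_finite[OF L2]) (auto simp: \<Xi>_point_measure)
  finally show ?thesis .
qed

text \<open>The integral condition bounds nonnegative lags; the negative half follows by
  reflection.\<close>

lemma lag_symmetric_le:
  assumes A: "A \<in> sets borel" "bounded A"
  shows "lag A {- t..t} \<le> lag A {0..t} + lag A {0..t}"
proof -
  have "lag A {- t..t} \<le> emeasure (lag_measure A) ({- t..0} \<union> {0..t})"
    unfolding emeasure_lag_measure[OF A, symmetric, of "{- t..t}", simplified]
    by (intro emeasure_mono) auto
  also have "\<dots> \<le> emeasure (lag_measure A) {- t..0} + emeasure (lag_measure A) {0..t}"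
    by (intro emeasure_subadditive) auto
  also have "\<dots> = lag A {- t..0} + lag A {0..t}" using A by (simp add: emeasure_lag_measure)
  also have "{- t..0} = uminus -` {0..t}" by auto
  also have "lag A \<dots> = lag A {0..t}" using A by (intro lag_reflect) auto
  finally show ?thesis .
qed

lemma L2_\<Xi>:
  assumes fin: "intensity XX < \<infinity>" "\<And>t. 0 < t \<Longrightarrow> lag XX {0..t} < \<infinity>"
  shows "L2_process M \<Xi>"
proof -
  have m1: "(\<integral>\<^sup>+w. emeasure (\<Xi> w) (window n) \<partial>M) < \<infinity>" for n
  proof -
    have "moment1 M \<Xi> (window n) = intensity XX * emeasure lborel {- real n..real n}"
      unfolding window_def using XX by (simp add: moment1_\<Xi>_times)
    then show ?thesis using fin by (simp add: moment1_def ennreal_mult_less_top)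
  qed
  have m2: "(\<integral>\<^sup>+w. emeasure (\<Xi> w) (window n) * emeasure (\<Xi> w) (window n) \<partial>M) < \<infinity>" for n
  proof -
    let ?I = "{- real n..real n}"
    \<comment> \<open>Two times in [-n,n] differ by at most 2n; the added 1 keeps \<open>t\<close>
      positive when n = 0.\<close>
    define t where "t = 2 * real n + 1"
    have "(\<integral>\<^sup>+z. cl2 z XX (?I \<times> ?I) \<partial>\<nu>) \<le> (\<integral>\<^sup>+z. cl2 z XX (phi -` (?I \<times> {- t..t})) \<partial>\<nu>)"
      by (intro nn_integral_mono cl2_mono) (auto simp: phi_def t_def)
    also have "\<dots> = emeasure lborel ?I * lag XX {- t..t}"
      using XX by (intro cl2_window) auto
    also have "\<dots> < \<infinity>"
    proof -
      have "0 < t" by (simp add: t_def)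
      then have "lag XX {- t..t} < \<infinity>"
        using lag_symmetric_le[OF XX, of t] fin(2)[of t] by (auto simp: le_less_trans)
      then show ?thesis by (simp add: ennreal_mult_less_top)
    qed
    finally have c: "(\<integral>\<^sup>+z. cl2 z XX (?I \<times> ?I) \<partial>\<nu>) < \<infinity>" .
    have "factorial_moment2 M \<Xi> XX (?I \<times> ?I) < \<infinity>"
      using XX c fin(1) by (simp add: factorial_moment2_\<Xi>_times ennreal_mult_less_top)
    then have "(\<integral>\<^sup>+w. distinct_pairs (\<Xi> w) (window n \<times> window n) \<partial>M) < \<infinity>"
      by (simp add: factorial_moment2_marked_pairs marked_pairs_times window_def)
    \<comment> \<open>The square of a count is its pair count plus the count itself.\<close>
    moreover have "(\<integral>\<^sup>+w. emeasure (\<Xi> w) (window n) * emeasure (\<Xi> w) (window n) \<partial>M) =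
       (\<integral>\<^sup>+w. distinct_pairs (\<Xi> w) (window n \<times> window n) \<partial>M) + (\<integral>\<^sup>+w. emeasure (\<Xi> w) (window n) \<partial>M)"
    proof (subst nn_integral_add[symmetric])
      show "(\<integral>\<^sup>+w. emeasure (\<Xi> w) (window n) * emeasure (\<Xi> w) (window n) \<partial>M) =
         (\<integral>\<^sup>+w. distinct_pairs (\<Xi> w) (window n \<times> window n) + emeasure (\<Xi> w) (window n) \<partial>M)"
        using distinct_pairs_plus_diagonal[OF \<Xi>_point_measure window_borel window_borel, of _ n n]
        by (intro nn_integral_cong) simp
    qed (intro measurable_\<Xi>_distinct_pairs measurable_emeasure_\<Xi> window_borel window_subset_G)+
    ultimately show ?thesis using m1[of n] by simp
  qed
  show ?thesis
    unfolding L2_process_def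
  proof (intro conjI ballI impI)
    fix B :: "('a \<times> real) set" assume "bounded B"
    then obtain n where "B \<subseteq> UNIV \<times> {- real n..real n}" by (rule bounded_interval_subset)
    then have "moment1 M \<Xi> B \<le> (\<integral>\<^sup>+w. emeasure (\<Xi> w) (window n) \<partial>M)"
      unfolding moment1_def by (intro nn_integral_mono emeasure_\<Xi>_window)
    then show "moment1 M \<Xi> B < \<infinity>" using m1[of n] by (rule le_less_trans)
  next
    fix D :: "(('a \<times> real) \<times> ('a \<times> real)) set" assume "bounded D"
    \<comment> \<open>Both projections of \<open>D\<close> lie in one strip of bounded times, which
      contains every section of \<open>D\<close> and makes the section at \<open>p\<close> empty for
      \<open>p\<close> outside the strip.\<close>
    then have "bounded (fst ` D \<union> snd ` D)" by (simp add: bounded_fst bounded_snd)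
    then obtain n where n: "fst ` D \<union> snd ` D \<subseteq> UNIV \<times> {- real n..real n}" by (rule bounded_interval_subset)
    let ?W = "UNIV \<times> {- real n..real n} :: ('a \<times> real) set"
    have W: "?W \<in> sets borel" by (intro times_borel) auto
    have "moment2 M \<Xi> D \<le> (\<integral>\<^sup>+w. emeasure (\<Xi> w) (window n) * emeasure (\<Xi> w) (window n) \<partial>M)"
      unfolding moment2_def
    proof (rule nn_integral_mono)
      fix w assume w: "w \<in> space M"
      have "(\<integral>\<^sup>+p. emeasure (\<Xi> w) (Pair p -` D) \<partial>\<Xi> w) \<le> (\<integral>\<^sup>+p. emeasure (\<Xi> w) (window n) * indicator ?W p \<partial>\<Xi> w)"
      proof (rule nn_integral_mono)
        fix p
        show "emeasure (\<Xi> w) (Pair p -` D) \<le> emeasure (\<Xi> w) (window n) * indicator ?W p"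
        proof (cases "p \<in> ?W")
          case True
          have "Pair p -` D \<subseteq> ?W" using n by force
          then show ?thesis using True w by (simp add: emeasure_\<Xi>_window)
        next
          case False
          then have "Pair p -` D = {}" using n by force
          then show ?thesis by simp
        qed
      qed
      also have "\<dots> = emeasure (\<Xi> w) (window n) * emeasure (\<Xi> w) ?W"
        using W by (intro nn_integral_cmult_indicator) simp
      also have "\<dots> \<le> emeasure (\<Xi> w) (window n) * emeasure (\<Xi> w) (window n)"
        using w by (intro mult_left_mono emeasure_\<Xi>_window) auto
      finally show "(\<integral>\<^sup>+p. emeasure (\<Xi> w) (Pair p -` D) \<partial>\<Xi> w) \<le> emeasure (\<Xi> w) (window n) * emeasure (\<Xi> w) (window n)" .
    qed
    then show "moment2 M \<Xi> D < \<infinity>" using m2[of n] by (rule le_less_trans)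
  qed
qed

lemma AE_\<Xi>_window:
  assumes L2: "L2_process M \<Xi>"
  shows "AE w in M. \<forall>n. emeasure (\<Xi> w) (window n) < \<infinity>"
proof -
  have "AE w in M. emeasure (\<Xi> w) (window n) \<noteq> \<infinity>" for n
  proof (rule nn_integral_PInf_AE)
    have "moment1 M \<Xi> (window n) < \<infinity>"
      using L2 bounded_window window_borel by (simp add: L2_process_def)
    then show "(\<integral>\<^sup>+w. emeasure (\<Xi> w) (window n) \<partial>M) \<noteq> \<infinity>" by (simp add: moment1_def)
  qed (intro measurable_emeasure_\<Xi> window_borel)
  then show ?thesis by (simp add: AE_all_countable less_top)
qed

text \<open>Uncountably many intervals are covered by countably many windows, so a single null set
  serves all of them.\<close>

lemma well_defined_\<Xi>:
  assumes L2: "L2_process M \<Xi>"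
  shows "well_defined_on XX M \<Xi>"
  unfolding well_defined_on_def
  using AE_\<Xi>_window[OF L2] AE_space
proof eventually_elim
  case (elim w)
  show ?case
  proof (intro allI impI)
    fix I :: "real set" assume "is_interval I \<and> bounded I"
    then obtain r where r: "\<And>t. t \<in> I \<Longrightarrow> \<bar>t\<bar> \<le> r" unfolding bounded_iff by auto
    obtain n :: nat where "r \<le> real n" using real_arch_simple by blast
    then have "XX \<times> I \<subseteq> UNIV \<times> {- real n..real n}" using r by (force simp: abs_le_iff)
    from emeasure_\<Xi>_window[OF elim(2) this] show "emeasure (\<Xi> w) (XX \<times> I) < \<infinity>"
      using elim(1) by (metis le_less_trans)
  qed
qed

text \<open>\<open>emeasure_factorial_measure2\<close> applies to maps into
  \<open>counting_algebra\<close>, where the process is known to lie only almost surely; on the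
  exceptional null event it is replaced by the null measure.\<close>

lemma locally_finite_version:
  assumes L2: "L2_process M \<Xi>"
  obtains X where "X \<in> M \<rightarrow>\<^sub>M counting_algebra" "AE w in M. X w = \<Xi> w"
proof -
  let ?Q = "\<lambda>w. \<forall>n. emeasure (\<Xi> w) (window n) < \<infinity>"
  let ?X = "\<lambda>w. if ?Q w then \<Xi> w else null_measure borel"
  have Q: "Measurable.pred M ?Q" by measurable
  have "?X \<in> M \<rightarrow>\<^sub>M eval_algebra {\<xi> \<in> point_measures. locally_finite \<xi>}"
  proof (rule measurable_eval_algebraI)
    fix w assume w: "w \<in> space M"
    have "locally_finite (\<Xi> w)" if "?Q w"
      unfolding locally_finite_def
    proof (intro conjI ballI impI)
      fix B :: "('a \<times> real) set" assume "bounded B"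
      then obtain n where "B \<subseteq> UNIV \<times> {- real n..real n}" by (rule bounded_interval_subset)
      from emeasure_\<Xi>_window[OF w this] show "emeasure (\<Xi> w) B < \<infinity>"
        using that by (metis le_less_trans)
    qed simp
    then show "?X w \<in> {\<xi> \<in> point_measures. locally_finite \<xi>}"
      using w by (auto simp: \<Xi>_point_measure null_measure_point_measure locally_finite_def)
  next
    fix B :: "('a \<times> real) set" assume B [measurable]: "B \<in> sets borel"
    have "(\<lambda>w. if ?Q w then emeasure (\<Xi> w) B else 0) \<in> borel_measurable M"
      using Q by measurable
    also have "(\<lambda>w. if ?Q w then emeasure (\<Xi> w) B else 0) = (\<lambda>w. emeasure (?X w) B)" by auto
    finally show "(\<lambda>w. emeasure (?X w) B) \<in> borel_measurable M" .
  qed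
  moreover have "AE w in M. ?X w = \<Xi> w"
    using AE_\<Xi>_window[OF L2] by eventually_elim simp
  ultimately show ?thesis using that by (simp add: counting_algebra_def)
qed

text \<open>Both sides are measures in the set of pairs of times, and they agree on rectangles.\<close>

lemma factorial_measure_\<Xi>:
  assumes L2: "L2_process M \<Xi>" and A: "A \<in> sets borel" "A \<subseteq> XX"
  shows "\<exists>F. sets F = sets borel \<and> (\<forall>T\<in>sets borel. emeasure F T = factorial_moment2 M \<Xi> A T) \<and>
    (\<forall>T\<in>sets borel. emeasure F T =
      intensity A * intensity A * emeasure (lborel \<Otimes>\<^sub>M lborel) T + (\<integral>\<^sup>+z. cl2 z A T \<partial>\<nu>))"
proof -
  obtain X where X: "X \<in> M \<rightarrow>\<^sub>M counting_algebra" "AE w in M. X w = \<Xi> w"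
    using locally_finite_version[OF L2] .
  have bA: "bounded A" using A bounded_subset_XX by simp
  \<comment> \<open>Built from the locally finite version, whose moments are those of the process
    itself.\<close>
  define F where "F = factorial_measure2 M X A"
  have F: "emeasure F T = factorial_moment2 M \<Xi> A T" if "T \<in> sets borel" for T
  proof -
    have "emeasure F T = factorial_moment2 M X A T"
      unfolding F_def using X(1) A(1) that by (rule emeasure_factorial_measure2)
    also have "\<dots> = factorial_moment2 M \<Xi> A T"
      unfolding factorial_moment2_def using X(2) by (intro nn_integral_cong_AE) auto
    finally show ?thesis .
  qed
  \<comment> \<open>\<open>K1\<close> accounts for pairs from different clusters, \<open>K2\<close>
    for pairs from the same cluster.\<close>
  define K1 where "K1 = density (lborel \<Otimes>\<^sub>M lborel) (\<lambda>_::real \<times> real. intensity A * intensity A)"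
  define K2 where "K2 = mean_measure \<nu> (\<lambda>z. factorial_measure2 (P z) (\<lambda>\<xi>. \<xi>) A)"
  have K1_sets: "sets K1 = sets borel" by (simp add: K1_def lborel_prod)
  have K1: "emeasure K1 T = intensity A * intensity A * emeasure (lborel \<Otimes>\<^sub>M lborel) T" if "T \<in> sets borel" for T
    using that by (simp add: K1_def emeasure_density_const lborel_prod)
  have K2: "emeasure K2 T = (\<integral>\<^sup>+z. cl2 z A T \<partial>\<nu>)" if T: "T \<in> sets borel" for T
  proof -
    have "emeasure K2 T = moment1 \<nu> (\<lambda>z. factorial_measure2 (P z) (\<lambda>\<xi>. \<xi>) A) T"
      unfolding K2_def
    proof (rule emeasure_mean_measure[OF _ _ T])
      fix B :: "(real \<times> real) set" assume "B \<in> sets borel"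
      then show "(\<lambda>z. emeasure (factorial_measure2 (P z) (\<lambda>\<xi>. \<xi>) A) B) \<in> borel_measurable \<nu>"
        unfolding measurable_cong_sets[OF sets_\<nu> refl]
        by (simp add: cl_measures(1)[OF A(1) bA] measurable_cl2[OF A(1)])
    qed simp
    then show ?thesis by (simp add: moment1_def cl_measures(1)[OF A(1) bA T])
  qed
  have K2_sets: "sets K2 = sets borel" by (simp add: K2_def)
  let ?E = "{I \<times> J | I J. I \<in> sets (borel :: real measure) \<and> J \<in> sets (borel :: real measure)}"
  have sigma: "sets (borel :: (real \<times> real) measure) = sigma_sets UNIV ?E"
    using sets_pair_measure[of "borel :: real measure" "borel :: real measure"] unfolding borel_prod by simp
  have "F = sum_measure K1 K2"
  proof (rule measure_eqI_generator_eq[where \<Omega>=UNIV and A="\<lambda>n::nat. {- real n..real n} \<times> {- real n..real n}"])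
    show "Int_stable ?E"
      by (rule Int_stable_pair_measure_generator)
    show "sets F = sigma_sets UNIV ?E"
      by (simp add: F_def sigma)
    show "sets (sum_measure K1 K2) = sigma_sets UNIV ?E"
      by (simp add: sigma)
    fix R assume "R \<in> ?E"
    then obtain I J where R: "R = I \<times> J" and I: "I \<in> sets borel" and J: "J \<in> sets borel" by auto
    have IJ: "I \<times> J \<in> sets borel" using I J by (rule real_times_borel)
    have "emeasure (lborel \<Otimes>\<^sub>M lborel) (I \<times> J) = emeasure lborel I * emeasure lborel J"
      using I J by (intro lborel.emeasure_pair_measure_Times) auto
    then show "emeasure F R = emeasure (sum_measure K1 K2) R"
      using I J A IJ
      by (simp add: R F emeasure_sum_measure K1_sets K2_sets K1 K2 factorial_moment2_\<Xi>_times mult_ac)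
  next
    show "range (\<lambda>n::nat. {- real n..real n} \<times> {- real n..real n}) \<subseteq>
      ?E"
    proof clarify
      fix n :: nat
      show "\<exists>I J. {- real n..real n} \<times> {- real n..real n} = I \<times> J \<and>
          I \<in> sets (borel :: real measure) \<and> J \<in> sets (borel :: real measure)"
        by (intro exI[of _ "{- real n..real n}"]) simp
    qed
    show "(\<Union>n::nat. {- real n..real n} \<times> {- real n..real n}) = UNIV"
    proof -
      have "\<exists>n::nat. \<bar>a\<bar> \<le> real n \<and> \<bar>b\<bar> \<le> real n" for a b :: real
        using real_arch_simple[of "max \<bar>a\<bar> \<bar>b\<bar>"] by auto
      then show ?thesis by (force simp: abs_le_iff)
    qed
    fix n :: nat
    \<comment> \<open>Square integrability makes the exhausting squares finite, as uniqueness from a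
      generator requires.\<close>
    have "factorial_moment2 M \<Xi> A ({- real n..real n} \<times> {- real n..real n}) < \<infinity>"
      using A bA by (intro factorial_moment2_finite[OF L2]) (auto simp: \<Xi>_point_measure)
    then show "emeasure F ({- real n..real n} \<times> {- real n..real n}) \<noteq> \<infinity>"
      by (subst F) (auto intro!: real_times_borel)
  qed auto
  then have "emeasure F T = emeasure K1 T + emeasure K2 T" if "T \<in> sets borel" for T
    using that by (simp add: emeasure_sum_measure K1_sets K2_sets)
  then show ?thesis
    using F by (intro exI[of _ F]) (auto simp: F_def K1 K2)
qed

section \<open>Identification of the spatial intensity and of the reduced measures\<close>

definition intensity_measure :: "'a measure" where
  "intensity_measure = mean_measure \<Lambda> (\<lambda>y. distr (density (mean_measure (P (y, 0)) (\<lambda>\<xi>. \<xi>)) (indicator G)) borel fst)"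

lemma sets_intensity_measure [simp]: "sets intensity_measure = sets borel"
  by (simp add: intensity_measure_def)

lemma emeasure_intensity_measure:
  assumes A: "A \<in> sets borel"
  shows "emeasure intensity_measure A = intensity (A \<inter> XX)"
proof -
  let ?q = "\<lambda>y. mean_measure (P (y, 0)) (\<lambda>\<xi>. \<xi>)"
  let ?d = "\<lambda>y. distr (density (?q y) (indicator G)) borel fst"
  have q_cong: "measurable (?q y) K = measurable borel K" for y and K :: "'k measure"
    by (rule measurable_cong_sets) auto
  have fst_m: "(fst :: 'a \<times> real \<Rightarrow> 'a) \<in> borel \<rightarrow>\<^sub>M borel"
    by (intro borel_measurable_continuous_onI continuous_intros)
  have S: "(A \<inter> XX) \<times> (UNIV :: real set) \<in> sets borel" if "A \<in> sets borel" for A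
    using that XX by (intro times_borel) auto
  have d: "emeasure (?d y) A = cl1 (y, 0) ((A \<inter> XX) \<times> UNIV)" if A: "A \<in> sets borel" for y A
  proof -
    have sp: "space (?q y) = UNIV" using sets_eq_imp_space_eq[OF sets_mean_measure] by simp
    have AU: "A \<times> (UNIV :: real set) \<in> sets borel" using A by (intro times_borel) auto
    have "emeasure (?d y) A = emeasure (density (?q y) (indicator G)) (A \<times> UNIV)"
      using A fst_m sp by (subst emeasure_distr) (auto simp: q_cong fst_vimage_eq_Times)
    also have "\<dots> = (\<integral>\<^sup>+z. indicator G z * indicator (A \<times> UNIV) z \<partial>?q y)"
      using AU by (intro emeasure_density) (auto simp: q_cong)
    also have "\<dots> = (\<integral>\<^sup>+z. indicator ((A \<inter> XX) \<times> UNIV) z \<partial>?q y)"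
      by (intro nn_integral_cong) (auto simp: indicator_def G_def)
    also have "\<dots> = emeasure (?q y) ((A \<inter> XX) \<times> UNIV)" using S[OF A] by (intro nn_integral_indicator) simp
    finally show ?thesis using S[OF A] cl_measures(2)[of "{}"] by simp
  qed
  have "emeasure intensity_measure A = moment1 \<Lambda> ?d A"
    unfolding intensity_measure_def
  proof (rule emeasure_mean_measure[OF _ _ A])
    fix B :: "'a set" assume "B \<in> sets borel"
    then show "(\<lambda>y. emeasure (?d y) B) \<in> borel_measurable \<Lambda>"
      using measurable_compose[OF _ measurable_cl1[OF S], of "\<lambda>y. (y, 0)"]
      by (simp add: d borel_measurable_continuous_onI continuous_on_Pair)
  qed simp
  then show ?thesis by (simp add: moment1_def intensity_def d[OF A])
qed

text \<open>Product measures are determined by rectangles, which shows that the candidate has the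
  defining property; for uniqueness, a time interval of length 1 recovers the spatial
  factor.\<close>

lemma spatial_intensity_\<Xi>:
  assumes fin: "intensity XX < \<infinity>"
  shows "spatial_intensity M \<Xi> = intensity_measure"
  unfolding spatial_intensity_def
proof (rule the_equality)
  have space: "space intensity_measure = UNIV"
    using sets_eq_imp_space_eq[OF sets_intensity_measure] by simp
  have fin_m: "finite_measure intensity_measure"
    using fin by (intro finite_measureI) (simp add: space emeasure_intensity_measure)
  then interpret \<mu>: finite_measure intensity_measure .
  have mm: "emeasure (mean_measure M \<Xi>) B = moment1 M \<Xi> B" if "B \<in> sets borel" for B
    using that by (intro emeasure_mean_measure) auto
  have "intensity_measure \<Otimes>\<^sub>M lborel = mean_measure M \<Xi>"
  proof (rule pair_measure_eqI)
    show "sigma_finite_measure intensity_measure" "sigma_finite_measure (lborel :: real measure)" by unfold_locales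
    have "sets (intensity_measure \<Otimes>\<^sub>M lborel) = sets (borel \<Otimes>\<^sub>M borel :: ('a \<times> real) measure)"
      by (intro sets_pair_measure_cong) auto
    then show "sets (intensity_measure \<Otimes>\<^sub>M lborel) = sets (mean_measure M \<Xi>)"
      unfolding borel_prod sets_mean_measure .
    fix A :: "'a set" and T :: "real set" assume "A \<in> sets intensity_measure" "T \<in> sets lborel"
    then show "emeasure intensity_measure A * emeasure lborel T = emeasure (mean_measure M \<Xi>) (A \<times> T)"
      by (simp add: mm times_borel moment1_\<Xi>_times emeasure_intensity_measure)
  qed
  then show "sets intensity_measure = sets borel \<and> finite_measure intensity_measure \<and>
      (\<forall>B\<in>sets borel. moment1 M \<Xi> B = emeasure (intensity_measure \<Otimes>\<^sub>M lborel) B)"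
    using fin_m mm by simp
  fix \<mu>' :: "'a measure" assume \<mu>': "sets \<mu>' = sets borel \<and> finite_measure \<mu>' \<and>
      (\<forall>B\<in>sets borel. moment1 M \<Xi> B = emeasure (\<mu>' \<Otimes>\<^sub>M lborel) B)"
  show "\<mu>' = intensity_measure"
  proof (rule measure_eqI)
    show "sets \<mu>' = sets intensity_measure" using \<mu>' by simp
    fix A assume "A \<in> sets \<mu>'"
    then have A: "A \<in> sets borel" using \<mu>' by simp
    have "emeasure \<mu>' A = emeasure (\<mu>' \<Otimes>\<^sub>M lborel) (A \<times> {0<..1::real})"
      using A \<mu>' by (subst lborel.emeasure_pair_measure_Times) auto
    also have "\<dots> = moment1 M \<Xi> (A \<times> {0<..1})"
      using \<mu>' A by (simp add: times_borel)
    also have "\<dots> = emeasure intensity_measure A"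
      using A by (simp add: moment1_\<Xi>_times emeasure_intensity_measure)
    finally show "emeasure \<mu>' A = emeasure intensity_measure A" .
  qed
qed

lemma lag_bounded_finite:
  assumes L2: "L2_process M \<Xi>" and A: "A \<in> sets borel" "A \<subseteq> XX" and S: "S \<in> sets borel" "bounded S"
  shows "lag A S < \<infinity>"
proof -
  have bA: "bounded A" using A bounded_subset_XX by simp
  obtain t where t: "\<And>x. x \<in> S \<Longrightarrow> \<bar>x\<bar> \<le> t" using S(2) unfolding bounded_iff by auto
  have "lag A S = emeasure (lag_measure A) S" using A bA S by (simp add: emeasure_lag_measure)
  also have "\<dots> \<le> emeasure (lag_measure A) {- t..t}"
    using t by (intro emeasure_mono) (force simp: abs_le_iff)+
  also have "\<dots> \<le> lag A {0..t} + lag A {0..t}"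
    using lag_symmetric_le[OF A(1) bA, of t] A bA by (simp add: emeasure_lag_measure)
  also have "\<dots> < \<infinity>" using lag_finite[OF L2 A, of t] by simp
  finally show ?thesis .
qed

lemma locally_finite_lag_measure:
  assumes L2: "L2_process M \<Xi>" and A: "A \<in> sets borel" "A \<subseteq> XX"
  shows "locally_finite (lag_measure A)"
  using A bounded_subset_XX[OF A(2)] lag_bounded_finite[OF L2 A]
  by (simp add: locally_finite_def emeasure_lag_measure)

text \<open>Under \<open>phi\<close>, pairs from different clusters keep a multiple of planar
  Lebesgue measure, as \<open>phi\<close> is a shear, and pairs from one cluster give Lebesgue
  measure times \<open>lag_measure A\<close>. Both share the Lebesgue factor in the first
  coordinate, which can be split off.\<close>

lemma reduced_moment2_\<Xi>:
  assumes L2: "L2_process M \<Xi>" and A: "A \<in> sets borel" "A \<subseteq> XX"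
  shows "reduced_moment2 M \<Xi> A =
    sum_measure (density lborel (\<lambda>_. intensity A * intensity A)) (lag_measure A)" (is "_ = ?R")
  unfolding reduced_moment2_def
proof (rule the_equality)
  have bA: "bounded A" using A bounded_subset_XX by simp
  obtain F where F: "sets F = sets borel"
    "\<And>T. T \<in> sets borel \<Longrightarrow> emeasure F T = factorial_moment2 M \<Xi> A T"
    "\<And>T. T \<in> sets borel \<Longrightarrow> emeasure F T =
      intensity A * intensity A * emeasure (lborel \<Otimes>\<^sub>M lborel) T + (\<integral>\<^sup>+z. cl2 z A T \<partial>\<nu>)"
    using factorial_measure_\<Xi>[OF L2 A] by blast
  have R: "emeasure ?R S = intensity A * intensity A * emeasure lborel S + lag A S" if "S \<in> sets borel" for S
    using that A bA by (simp add: emeasure_sum_measure emeasure_density_const emeasure_lag_measure)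
  have phi_R: "factorial_moment2 M \<Xi> A (phi -` (U \<times> V)) = emeasure lborel U * emeasure ?R V"
    if U: "U \<in> sets borel" and V: "V \<in> sets borel" for U V
  proof -
    have UV: "phi -` (U \<times> V) \<in> sets borel" using U V by (intro vimage_phi_borel real_times_borel)
    have "factorial_moment2 M \<Xi> A (phi -` (U \<times> V)) =
      intensity A * intensity A * (emeasure lborel U * emeasure lborel V) + emeasure lborel U * lag A V"
      using F(2,3)[OF UV] U V A bA by (simp add: emeasure_lborel2_phi cl2_window)
    then show ?thesis using V by (simp add: R distrib_left mult_ac)
  qed
  have R_lf: "locally_finite ?R"
    unfolding locally_finite_def
  proof (intro conjI ballI impI)
    fix S :: "real set" assume S: "S \<in> sets borel" "bounded S"
    have "emeasure lborel S < \<infinity>" using S(2) by (rule emeasure_bounded_finite)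
    then show "emeasure ?R S < \<infinity>"
      using intensity_finite[OF L2 A] lag_bounded_finite[OF L2 A S] S
      by (simp add: R ennreal_mult_less_top)
  qed simp
  interpret R: sigma_finite_measure ?R by (rule locally_finite_sigma_finite[OF R_lf])
  have F_phi: "phi \<in> F \<rightarrow>\<^sub>M borel" using F(1) measurable_phi measurable_cong_sets by blast
  have F_space: "space F = UNIV" using sets_eq_imp_space_eq[OF F(1)] by simp
  have dF: "emeasure (distr F borel phi) S = factorial_moment2 M \<Xi> A (phi -` S)" if "S \<in> sets borel" for S
    using that F_phi F_space by (simp add: emeasure_distr F(2) vimage_phi_borel)
  have "lborel \<Otimes>\<^sub>M ?R = distr F borel phi"
  proof (rule pair_measure_eqI)
    show "sigma_finite_measure (lborel :: real measure)" "sigma_finite_measure ?R" by unfold_locales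
    have "sets (lborel \<Otimes>\<^sub>M ?R) = sets (borel \<Otimes>\<^sub>M borel :: (real \<times> real) measure)"
      by (intro sets_pair_measure_cong) auto
    then show "sets (lborel \<Otimes>\<^sub>M ?R) = sets (distr F borel phi)"
      unfolding borel_prod sets_distr .
    fix U V :: "real set" assume "U \<in> sets lborel" "V \<in> sets ?R"
    then show "emeasure lborel U * emeasure ?R V = emeasure (distr F borel phi) (U \<times> V)"
      by (simp add: dF real_times_borel phi_R)
  qed
  then show "locally_finite ?R \<and> (\<forall>S\<in>sets borel. factorial_moment2 M \<Xi> A (phi -` S) = emeasure (lborel \<Otimes>\<^sub>M ?R) S)"
    using R_lf dF by simp
  fix \<kappa> :: "real measure"
  assume \<kappa>: "locally_finite \<kappa> \<and> (\<forall>S\<in>sets borel. factorial_moment2 M \<Xi> A (phi -` S) = emeasure (lborel \<Otimes>\<^sub>M \<kappa>) S)"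
  have \<kappa>_sets: "sets \<kappa> = sets borel" using \<kappa> by (simp add: locally_finite_def)
  interpret \<kappa>: sigma_finite_measure \<kappa> using \<kappa> by (intro locally_finite_sigma_finite) simp
  show "\<kappa> = ?R"
  proof (rule measure_eqI)
    show "sets \<kappa> = sets ?R" by (simp add: \<kappa>_sets)
    fix V assume "V \<in> sets \<kappa>"
    then have V: "V \<in> sets borel" by (simp add: \<kappa>_sets)
    have I: "{0<..1::real} \<in> sets borel" by simp
    \<comment> \<open>An interval of length 1 in the first coordinate isolates the second
      factor.\<close>
    have "emeasure \<kappa> V = emeasure (lborel \<Otimes>\<^sub>M \<kappa>) ({0<..1::real} \<times> V)"
      using V by (subst \<kappa>.emeasure_pair_measure_Times) (auto simp: \<kappa>_sets)
    also have "\<dots> = factorial_moment2 M \<Xi> A (phi -` ({0<..1} \<times> V))"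
      using \<kappa> real_times_borel[OF I V] by simp
    also have "\<dots> = emeasure ?R V" using V by (simp add: phi_R)
    finally show "emeasure \<kappa> V = emeasure ?R V" .
  qed
qed

text \<open>The squared intensity is exactly the contribution of pairs from different clusters and
  cancels. Boundedness of \<open>S\<close> keeps all terms finite, so passing from
  \<open>ennreal\<close> to the reals is faithful.\<close>

lemma reduced_cov_\<Xi>:
  assumes L2: "L2_process M \<Xi>" and A: "A \<in> sets borel" "A \<subseteq> XX" and S: "S \<in> sets borel" "bounded S"
  shows "reduced_cov M \<Xi> A S = measure (lag_measure A) S"
proof -
  have bA: "bounded A" using A bounded_subset_XX by simp
  have AXX: "A \<inter> XX = A" using A by auto
  obtain m where m: "intensity A = ennreal m" "0 \<le> m"
    using intensity_finite[OF L2 A] by (cases "intensity A") auto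
  have finS: "emeasure lborel S \<noteq> \<infinity>" using emeasure_bounded_finite[OF S(2)] by auto
  have finL: "emeasure (lag_measure A) S \<noteq> \<infinity>"
    using lag_bounded_finite[OF L2 A S] A bA S by (simp add: emeasure_lag_measure)
  have "measure (spatial_intensity M \<Xi>) A = m"
    using spatial_intensity_\<Xi>[OF intensity_finite[OF L2 XX(1) order_refl]] A m
    by (simp add: measure_def emeasure_intensity_measure AXX)
  moreover have "emeasure (reduced_moment2 M \<Xi> A) S = ennreal (m * m * measure lborel S + measure (lag_measure A) S)"
    using S finS finL m
    by (simp add: reduced_moment2_\<Xi>[OF L2 A] emeasure_sum_measure emeasure_density_const emeasure_eq_ennreal_measure
        ennreal_mult ennreal_plus)
  then have "measure (reduced_moment2 M \<Xi> A) S =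
      enn2real (ennreal (m * m * measure lborel S + measure (lag_measure A) S))"
    by (simp only: measure_def[of "reduced_moment2 M \<Xi> A"])
  then have "measure (reduced_moment2 M \<Xi> A) S = m * m * measure lborel S + measure (lag_measure A) S"
    using m by (simp only:) (rule enn2real_ennreal, simp)
  ultimately show ?thesis by (simp add: reduced_cov_def power2_eq_square)
qed

lemma jordan_pos_\<Xi>:
  assumes L2: "L2_process M \<Xi>" and A: "A \<in> sets borel" "A \<subseteq> XX"
  shows "jordan_pos (reduced_cov M \<Xi> A) = lag_measure A"
  by (rule jordan_pos_measure[OF locally_finite_lag_measure[OF L2 A] reduced_cov_\<Xi>[OF L2 A]])

lemma intensity_causal:
  "A \<in> sets borel \<Longrightarrow> (\<integral>\<^sup>+y. cl1 (y, 0) (A \<times> {0..}) \<partial>\<Lambda>) = intensity A"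
  by (simp add: cl1_causal intensity_def)

lemma lag_causal: "(\<integral>\<^sup>+y. cl2 (y, 0) A (phi -` ({0..} \<times> V)) \<partial>\<Lambda>) = lag A V"
  by (simp add: cl2_causal lag_def)

text \<open>Stationarity always holds and square integrability implies well-definedness, so only
  square integrability is at stake; in the backward direction the conditions are used at
  \<open>A = XX\<close>.\<close>

lemma L2_\<Xi>_iff:
  "well_defined_on XX M \<Xi> \<and> time_stationary M \<Xi> \<and> L2_process M \<Xi> \<longleftrightarrow>
    (\<forall>A\<in>sets borel. A \<subseteq> XX \<longrightarrow> intensity A < \<infinity> \<and> (\<forall>t>0. lag A {0..t} < \<infinity>))"
  using XX(1) L2_\<Xi> \<Xi>_stationary well_defined_\<Xi> intensity_finite lag_finite by blast

lemma moments_\<Xi>: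
  assumes L2: "L2_process M \<Xi>" and A: "A \<in> sets borel" "A \<subseteq> XX" and t: "0 < t"
  shows "moment1 M \<Xi> (A \<times> {0<..t}) = ennreal t * emeasure (spatial_intensity M \<Xi>) A"
    and "emeasure (spatial_intensity M \<Xi>) A = intensity A"
    and "reduced_cov M \<Xi> A {0..t} = measure (jordan_pos (reduced_cov M \<Xi> A)) {0..t}"
    and "emeasure (jordan_pos (reduced_cov M \<Xi> A)) {0..t} = lag A {0..t}"
proof -
  have AXX: "A \<inter> XX = A" using A by auto
  show \<mu>: "emeasure (spatial_intensity M \<Xi>) A = intensity A"
    using spatial_intensity_\<Xi>[OF intensity_finite[OF L2 XX(1) order_refl]] A
    by (simp add: emeasure_intensity_measure AXX)
  show "moment1 M \<Xi> (A \<times> {0<..t}) = ennreal t * emeasure (spatial_intensity M \<Xi>) A"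
    using A t by (simp add: \<mu> moment1_\<Xi>_times AXX mult.commute)
  show "reduced_cov M \<Xi> A {0..t} = measure (jordan_pos (reduced_cov M \<Xi> A)) {0..t}"
    by (simp add: jordan_pos_\<Xi>[OF L2 A] reduced_cov_\<Xi>[OF L2 A])
  show "emeasure (jordan_pos (reduced_cov M \<Xi> A)) {0..t} = lag A {0..t}"
    using A bounded_subset_XX[OF A(2)] by (simp add: jordan_pos_\<Xi>[OF L2 A] emeasure_lag_measure)
qed

end

theorem proposition4p8:
  fixes XX :: "'a::polish_space set"
    and \<Lambda> :: "'a measure"
    and P :: "'a \<times> real \<Rightarrow> ('a \<times> real) measure measure"
    and M :: "'w measure"
    and N :: "'w \<Rightarrow> enat"
    and Z :: "nat \<Rightarrow> 'w \<Rightarrow> 'a \<times> real"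
    and C :: "nat \<Rightarrow> 'w \<Rightarrow> ('a \<times> real) measure"
    and \<Xi> :: "'w \<Rightarrow> ('a \<times> real) measure"
  assumes XX: "XX \<in> sets borel" "bounded XX"
    and \<Lambda>: "locally_finite \<Lambda>"
    and P: "cluster_kernel P" "shift_equivariant P" "causal P"
    and P_moments: "\<And>y s. L2_process (P (y, s)) (\<lambda>\<xi>. \<xi>)"
    and process: "poisson_cluster_process M \<Lambda> P N Z C"
    and \<Xi>: "\<Xi> = observed_process XX N C"
  shows
    "(well_defined_on XX M \<Xi> \<and> time_stationary M \<Xi> \<and> L2_process M \<Xi> \<longleftrightarrow>
       (\<forall>A\<in>sets borel. A \<subseteq> XX \<longrightarrow>
          (\<integral>\<^sup>+y. moment1 (P (y, 0)) (\<lambda>\<xi>. \<xi>) (A \<times> {0..}) \<partial>\<Lambda>) < \<infinity> \<and>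
          (\<forall>t>0. (\<integral>\<^sup>+y. factorial_moment2 (P (y, 0)) (\<lambda>\<xi>. \<xi>) A (phi -` ({0..} \<times> {0..t})) \<partial>\<Lambda>) < \<infinity>))) \<and>
     (well_defined_on XX M \<Xi> \<and> time_stationary M \<Xi> \<and> L2_process M \<Xi> \<longrightarrow>
       (\<forall>A\<in>sets borel. A \<subseteq> XX \<longrightarrow> (\<forall>t>0.
          moment1 M \<Xi> (A \<times> {0<..t}) = ennreal t * emeasure (spatial_intensity M \<Xi>) A \<and>
          ennreal t * emeasure (spatial_intensity M \<Xi>) A =
            ennreal t * (\<integral>\<^sup>+y. moment1 (P (y, 0)) (\<lambda>\<xi>. \<xi>) (A \<times> {0..}) \<partial>\<Lambda>) \<and>
          reduced_cov M \<Xi> A {0..t} = measure (jordan_pos (reduced_cov M \<Xi> A)) {0..t} \<and>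
          emeasure (jordan_pos (reduced_cov M \<Xi> A)) {0..t} =
            (\<integral>\<^sup>+y. factorial_moment2 (P (y, 0)) (\<lambda>\<xi>. \<xi>) A (phi -` ({0..} \<times> {0..t})) \<partial>\<Lambda>))))"
proof -
  interpret poisson_cluster_process M \<Lambda> P N Z C by (rule process)
  interpret O: observed_cluster_process M \<Lambda> P N Z C XX
    by unfold_locales (use assms in auto)
  have \<Xi>_eq: "\<Xi> = O.\<Xi>" by (simp add: \<Xi> O.\<Xi>_def)
  show ?thesis
    \<comment> \<open>Causality trades the nonnegative first times of the statement for unrestricted
      ones.\<close>
    unfolding \<Xi>_eq O.lag_causal
  proof (intro conjI impI ballI allI)
    show "well_defined_on XX M O.\<Xi> \<and> time_stationary M O.\<Xi> \<and> L2_process M O.\<Xi> \<longleftrightarrow>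
       (\<forall>A\<in>sets borel. A \<subseteq> XX \<longrightarrow>
          (\<integral>\<^sup>+y. O.cl1 (y, 0) (A \<times> {0..}) \<partial>\<Lambda>) < \<infinity> \<and> (\<forall>t>0. O.lag A {0..t} < \<infinity>))"
      using O.L2_\<Xi>_iff by (simp add: O.intensity_causal)
  next
    fix A and t :: real
    assume "well_defined_on XX M O.\<Xi> \<and> time_stationary M O.\<Xi> \<and> L2_process M O.\<Xi>"
      and A: "A \<in> sets borel" "A \<subseteq> XX" and t: "0 < t"
    then have L2: "L2_process M O.\<Xi>" by simp
    note mom = O.moments_\<Xi>[OF L2 A t]
    show "moment1 M O.\<Xi> (A \<times> {0<..t}) = ennreal t * emeasure (spatial_intensity M O.\<Xi>) A"
      by (rule mom(1))
    show "ennreal t * emeasure (spatial_intensity M O.\<Xi>) A =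
        ennreal t * (\<integral>\<^sup>+y. O.cl1 (y, 0) (A \<times> {0..}) \<partial>\<Lambda>)"
      using A by (simp add: mom(2) O.intensity_causal)
    show "reduced_cov M O.\<Xi> A {0..t} = measure (jordan_pos (reduced_cov M O.\<Xi> A)) {0..t}"
      by (rule mom(3))
    show "emeasure (jordan_pos (reduced_cov M O.\<Xi> A)) {0..t} = O.lag A {0..t}"
      by (rule mom(4))
  qed
qed

end
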